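(* Let $\Omega\subset\mathbb{H}^n$ be a bounded domain and let $F:\Omega\times\mathbb{R}\to\mathbb{R}^+$ be a continuous function which is non-decreasing in the second variable. Let $u$ be a bounded viscosity subsolution and $v$ a bounded viscosity supersolution of the equation $-\det(f)+F(q,f)=0$ in $\Omega$. If $u\le v$ on $\partial\Omega$, then $u\le v$ on $\Omega$.
   Context: $\mathbb{R}^+=[0,\infty)$. The condition "$u\le v$ on $\partial\Omega$" means $\limsup_{\Omega\ni q\to\zeta}(u(q)-v(q))\le 0$ for every $\zeta\in\partial\Omega$. Write $q=(q_0,\dots,q_{n-1})^t\in\mathbb{H}^n$, $q_j=x_{4j}+x_{4j+1}\mathbf{i}+x_{4j+2}\mathbf{j}+x_{4j+3}\mathbf{k}$, so $\mathbb{H}^n\cong\mathbb{R}^{4n}$. For $\mathbb{H}$-valued $C^1$ functions, $\overline{\partial}_{q_j}f=\partial_{x_{4j}}f+\mathbf{i}\,\partial_{x_{4j+1}}f+\mathbf{j}\,\partial_{x_{4j+2}}f+\mathbf{k}\,\partial_{x_{4j+3}}f$ and $\partial_{q_j}f=\partial_{x_{4j}}f-\partial_{x_{4j+1}}f\,\mathbf{i}-\partial_{x_{4j+2}}f\,\mathbf{j}-\partial_{x_{4j+3}}f\,\mathbf{k}$. The quaternionic Hessian of a real $C^2$ function $u$ is the matrix with entries $\frac{\partial^2u}{\partial\bar q_j\partial q_k}=\overline{\partial}_{q_j}\partial_{q_k}u$. It is hyperhermitian, i.e. equal to its quaternionic conjugate transpose. The Moore determinant $\det A$ of a hyperhermitian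 $n\times n$ matrix $A$ is the product $\lambda_1\cdots\lambda_n$, where $U^*AU=\mathrm{diag}(\lambda_1,\dots,\lambda_n)$ is real diagonal for a quaternionic unitary matrix $U$. For $u\in C^2$, $\det(u)$ denotes the Moore determinant of the quaternionic Hessian of $u$. Touching: a $C^2$ function $\varphi$ near $q_0\in\Omega$ touches $f$ from above (resp. below) at $q_0$ if $\varphi(q_0)=f(q_0)$ and $\varphi\ge f$ (resp. $\varphi\le f$) in a neighborhood of $q_0$. Viscosity subsolution: an upper semicontinuous $f:\Omega\to\mathbb{R}\cup\{-\infty\}$, $f\not\equiv-\infty$, such that for every $q_0\in\Omega$ and every $C^2$ function $\varphi$ touching $f$ from above at $q_0$, $\det(\varphi)(q_0)\ge F(q_0,\varphi(q_0))$. Viscosity supersolution: a lower semicontinuous $f:\Omega\to\mathbb{R}\cup\{+\infty\}$, $f\not\equiv+\infty$, such that for every $q_0\in\Omega$ and every $C^2$ function $\varphi$ touching $f$ from below at $q_0$, $\det(\varphi)_+(q_0)\le F(q_0,\varphi(q_0))$. Here $\det(\varphi)_+(q_0)$ equals $\det(\varphi)(q_0)$ if the quaternionic Hessian of $\varphi$ at $q_0$ is non-negative, and $0$ otherwise. *)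

theory Defs
  imports "HOL-Analysis.Analysis"
begin

section \<open>Quaternions\<close>

codatatype quat = Quat (qRe: real) (qIm1: real) (qIm2: real) (qIm3: real)

lemma quat_eq_iff:
  "x = y \<longleftrightarrow> qRe x = qRe y \<and> qIm1 x = qIm1 y \<and> qIm2 x = qIm2 y \<and> qIm3 x = qIm3 y"
  by (auto intro: quat.expand)

instantiation quat :: ab_group_add
begin

primcorec zero_quat where
    "qRe 0 = 0"
  | "qIm1 0 = 0"
  | "qIm2 0 = 0"
  | "qIm3 0 = 0"

primcorec plus_quat where
    "qRe (x + y) = qRe x + qRe y"
  | "qIm1 (x + y) = qIm1 x + qIm1 y"
  | "qIm2 (x + y) = qIm2 x + qIm2 y"
  | "qIm3 (x + y) = qIm3 x + qIm3 y"

primcorec uminus_quat where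
    "qRe (- x) = - qRe x"
  | "qIm1 (- x) = - qIm1 x"
  | "qIm2 (- x) = - qIm2 x"
  | "qIm3 (- x) = - qIm3 x"

primcorec minus_quat where
    "qRe (x - y) = qRe x - qRe y"
  | "qIm1 (x - y) = qIm1 x - qIm1 y"
  | "qIm2 (x - y) = qIm2 x - qIm2 y"
  | "qIm3 (x - y) = qIm3 x - qIm3 y"

instance
  by standard (simp_all add: quat_eq_iff)

end

instantiation quat :: ring_1
begin

primcorec one_quat where
    "qRe 1 = 1"
  | "qIm1 1 = 0"
  | "qIm2 1 = 0"
  | "qIm3 1 = 0"

primcorec times_quat where
    "qRe (x * y) = qRe x * qRe y - qIm1 x * qIm1 y - qIm2 x * qIm2 y - qIm3 x * qIm3 y"
  | "qIm1 (x * y) = qRe x * qIm1 y + qIm1 x * qRe y + qIm2 x * qIm3 y - qIm3 x * qIm2 y"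
  | "qIm2 (x * y) = qRe x * qIm2 y - qIm1 x * qIm3 y + qIm2 x * qRe y + qIm3 x * qIm1 y"
  | "qIm3 (x * y) = qRe x * qIm3 y + qIm1 x * qIm2 y - qIm2 x * qIm1 y + qIm3 x * qRe y"

instance
  by standard (simp_all add: quat_eq_iff algebra_simps)

end

instantiation quat :: real_algebra_1
begin

primcorec scaleR_quat where
    "qRe (scaleR r x) = r * qRe x"
  | "qIm1 (scaleR r x) = r * qIm1 x"
  | "qIm2 (scaleR r x) = r * qIm2 x"
  | "qIm3 (scaleR r x) = r * qIm3 x"

instance
  by standard (simp_all add: quat_eq_iff algebra_simps)

end

instantiation quat :: real_inner
begin

definition inner_quat :: "quat \<Rightarrow> quat \<Rightarrow> real" where
  "inner_quat x y = qRe x * qRe y + qIm1 x * qIm1 y + qIm2 x * qIm2 y + qIm3 x * qIm3 y"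

definition norm_quat :: "quat \<Rightarrow> real" where
  "norm_quat x = sqrt (inner x x)"

definition sgn_quat :: "quat \<Rightarrow> quat" where
  "sgn_quat x = x /\<^sub>R norm x"

definition dist_quat :: "quat \<Rightarrow> quat \<Rightarrow> real" where
  "dist_quat x y = norm (x - y)"

definition uniformity_quat :: "(quat \<times> quat) filter" where
  "uniformity_quat = (INF e\<in>{0<..}. principal {(x, y). dist x y < e})"

definition open_quat :: "quat set \<Rightarrow> bool" where
  "open_quat U \<longleftrightarrow> (\<forall>x\<in>U. eventually (\<lambda>(x', y). x' = x \<longrightarrow> y \<in> U) uniformity)"

instance
proof
  fix x y z :: quat and r :: real and U :: "quat set"
  show "dist x y = norm (x - y)" by (rule dist_quat_def)
  show "sgn x = x /\<^sub>R norm x" by (rule sgn_quat_def)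
  show "uniformity = (INF e\<in>{0<..}. principal {(x, y). dist (x::quat) y < e})"
    by (rule uniformity_quat_def)
  show "open U \<longleftrightarrow> (\<forall>x\<in>U. eventually (\<lambda>(x', y). x' = x \<longrightarrow> y \<in> U) uniformity)"
    by (rule open_quat_def)
  show "norm x = sqrt (inner x x)" by (rule norm_quat_def)
  show "inner x y = inner y x" by (simp add: inner_quat_def mult.commute)
  show "inner (x + y) z = inner x z + inner y z" by (simp add: inner_quat_def algebra_simps)
  show "inner (r *\<^sub>R x) y = r * inner x y" by (simp add: inner_quat_def algebra_simps)
  show "0 \<le> inner x x" by (simp add: inner_quat_def)
  have "a * a + b * b + c * c + d * d = 0 \<longleftrightarrow> a = 0 \<and> b = 0 \<and> c = 0 \<and> d = 0"
    for a b c d :: real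
    by (smt (verit) mult_eq_0_iff zero_le_square)
  then show "inner x x = 0 \<longleftrightarrow> x = 0"
    by (simp add: inner_quat_def quat_eq_iff)
qed

end

instance quat :: real_normed_algebra_1
proof
  fix x y :: quat
  have "inner (x * y) (x * y) = inner x x * inner y y"
    unfolding inner_quat_def times_quat.sel by algebra
  then show "norm (x * y) \<le> norm x * norm y"
    by (simp add: norm_quat_def real_sqrt_mult)
  show "norm (1::quat) = 1"
    by (simp add: norm_quat_def inner_quat_def)
qed

primcorec quat_i :: quat (\<open>\<i>\<^sub>H\<close>) where
    "qRe \<i>\<^sub>H = 0"
  | "qIm1 \<i>\<^sub>H = 1"
  | "qIm2 \<i>\<^sub>H = 0"
  | "qIm3 \<i>\<^sub>H = 0"

primcorec quat_j :: quat (\<open>\<j>\<^sub>H\<close>) where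
    "qRe \<j>\<^sub>H = 0"
  | "qIm1 \<j>\<^sub>H = 0"
  | "qIm2 \<j>\<^sub>H = 1"
  | "qIm3 \<j>\<^sub>H = 0"

primcorec quat_k :: quat (\<open>\<k>\<^sub>H\<close>) where
    "qRe \<k>\<^sub>H = 0"
  | "qIm1 \<k>\<^sub>H = 0"
  | "qIm2 \<k>\<^sub>H = 0"
  | "qIm3 \<k>\<^sub>H = 1"

lemma hamilton_relations:
  "\<i>\<^sub>H * \<i>\<^sub>H = -1" "\<j>\<^sub>H * \<j>\<^sub>H = -1" "\<k>\<^sub>H * \<k>\<^sub>H = -1"
  "\<i>\<^sub>H * \<j>\<^sub>H = \<k>\<^sub>H" "\<j>\<^sub>H * \<k>\<^sub>H = \<i>\<^sub>H" "\<k>\<^sub>H * \<i>\<^sub>H = \<j>\<^sub>H"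
  "\<j>\<^sub>H * \<i>\<^sub>H = - \<k>\<^sub>H" "\<k>\<^sub>H * \<j>\<^sub>H = - \<i>\<^sub>H" "\<i>\<^sub>H * \<k>\<^sub>H = - \<j>\<^sub>H"
  by (simp_all add: quat_eq_iff)

instantiation quat :: euclidean_space
begin

definition Basis_quat_def: "Basis = {1, \<i>\<^sub>H, \<j>\<^sub>H, \<k>\<^sub>H}"

instance
proof
  show "(Basis :: quat set) \<noteq> {}" "finite (Basis :: quat set)"
    by (simp_all add: Basis_quat_def)
next
  fix u v :: quat
  assume "u \<in> Basis" "v \<in> Basis"
  then show "inner u v = (if u = v then 1 else 0)"
    unfolding Basis_quat_def by (elim insertE emptyE) (simp_all add: inner_quat_def quat_eq_iff)
next
  fix x :: quat
  show "(\<forall>u\<in>Basis. inner x u = 0) \<longleftrightarrow> x = 0"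
    unfolding Basis_quat_def by (simp add: inner_quat_def) (simp add: quat_eq_iff)
qed

end

primcorec qcnj :: "quat \<Rightarrow> quat" where
    "qRe (qcnj x) = qRe x"
  | "qIm1 (qcnj x) = - qIm1 x"
  | "qIm2 (qcnj x) = - qIm2 x"
  | "qIm3 (qcnj x) = - qIm3 x"

section \<open>Hyperhermitian matrices and the Moore determinant\<close>

definition qadjoint :: "quat^'n^'m \<Rightarrow> quat^'m^'n" where
  "qadjoint A = (\<chi> j k. qcnj (A $ k $ j))"

definition hyperhermitian :: "quat^'n^'n \<Rightarrow> bool" where
  "hyperhermitian A \<longleftrightarrow> qadjoint A = A"

definition qunitary :: "quat^'n^'n \<Rightarrow> bool" where
  "qunitary U \<longleftrightarrow> qadjoint U ** U = mat 1 \<and> U ** qadjoint U = mat 1"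

definition real_diag :: "real^'n \<Rightarrow> quat^'n^'n" where
  "real_diag l = (\<chi> j k. if j = k then of_real (l $ j) else 0)"

text \<open>Meaningful for hyperhermitian matrices only; these are unitarily diagonalizable
  with uniquely determined real eigenvalues.\<close>
definition moore_det :: "quat^'n^'n \<Rightarrow> real" where
  "moore_det A =
     (THE d. \<exists>U l. qunitary U \<and> qadjoint U ** A ** U = real_diag l \<and> d = (\<Prod>j\<in>UNIV. l $ j))"

text \<open>The form \<open>X\<^sup>* A X\<close> is real when \<open>A\<close> is hyperhermitian, so taking its real
  part loses nothing.\<close>
definition hyperhermitian_nonneg :: "quat^'n^'n \<Rightarrow> bool" where
  "hyperhermitian_nonneg A \<longleftrightarrow> hyperhermitian A \<and>
     (\<forall>X::quat^'n. 0 \<le> qRe (\<Sum>j\<in>UNIV. \<Sum>k\<in>UNIV. qcnj (X $ j) * A $ j $ k * X $ k))"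

section \<open>The quaternionic Hessian\<close>

text \<open>\<open>C\<^sup>1\<close> and \<open>C\<^sup>2\<close> via continuity of the Frechet derivative in operator norm, for open \<open>S\<close>.\<close>
definition C1_on :: "'a::real_normed_vector set \<Rightarrow> ('a \<Rightarrow> 'b::real_normed_vector) \<Rightarrow> bool" where
  "C1_on S f \<longleftrightarrow> (\<exists>f'. (\<forall>x\<in>S. (f has_derivative blinfun_apply (f' x)) (at x)) \<and>
     continuous_on S f')"

definition C2_on :: "'a::real_normed_vector set \<Rightarrow> ('a \<Rightarrow> 'b::real_normed_vector) \<Rightarrow> bool" where
  "C2_on S f \<longleftrightarrow> (\<exists>f'. (\<forall>x\<in>S. (f has_derivative blinfun_apply (f' x)) (at x)) \<and>
     C1_on S f')"

text \<open>Derivative in the direction of the real coordinate vector \<open>e \<in> {1, \<i>\<^sub>H, \<j>\<^sub>H, \<k>\<^sub>H}\<close> of the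
  \<open>j\<close>-th quaternionic variable, i.e. one of \<open>\<partial>/\<partial>x\<^bsub>4j\<^esub>, \<dots>, \<partial>/\<partial>x\<^bsub>4j+3\<^esub>\<close>.\<close>
definition qpartial :: "'n \<Rightarrow> quat \<Rightarrow> (quat^'n \<Rightarrow> quat) \<Rightarrow> quat^'n \<Rightarrow> quat" where
  "qpartial j e f q = frechet_derivative f (at q) (axis j e)"

definition del_bar :: "'n \<Rightarrow> (quat^'n \<Rightarrow> quat) \<Rightarrow> quat^'n \<Rightarrow> quat" where
  "del_bar j f q = qpartial j 1 f q + \<i>\<^sub>H * qpartial j \<i>\<^sub>H f q
     + \<j>\<^sub>H * qpartial j \<j>\<^sub>H f q + \<k>\<^sub>H * qpartial j \<k>\<^sub>H f q"

definition del :: "'n \<Rightarrow> (quat^'n \<Rightarrow> quat) \<Rightarrow> quat^'n \<Rightarrow> quat" where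
  "del j f q = qpartial j 1 f q - qpartial j \<i>\<^sub>H f q * \<i>\<^sub>H
     - qpartial j \<j>\<^sub>H f q * \<j>\<^sub>H - qpartial j \<k>\<^sub>H f q * \<k>\<^sub>H"

definition qhessian :: "(quat^'n \<Rightarrow> real) \<Rightarrow> quat^'n \<Rightarrow> quat^'n^'n" where
  "qhessian u q = (\<chi> j k. del_bar j (del k (\<lambda>p. of_real (u p))) q)"

definition hess_det :: "(quat^'n \<Rightarrow> real) \<Rightarrow> quat^'n \<Rightarrow> real" where
  "hess_det u q = moore_det (qhessian u q)"

definition hess_det_plus :: "(quat^'n \<Rightarrow> real) \<Rightarrow> quat^'n \<Rightarrow> real" where
  "hess_det_plus u q = (if hyperhermitian_nonneg (qhessian u q) then hess_det u q else 0)"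

section \<open>Viscosity sub- and supersolutions\<close>

definition usc_on :: "'a::topological_space set \<Rightarrow> ('a \<Rightarrow> ereal) \<Rightarrow> bool" where
  "usc_on S f \<longleftrightarrow> (\<forall>a. openin (top_of_set S) {x \<in> S. f x < a})"

definition lsc_on :: "'a::topological_space set \<Rightarrow> ('a \<Rightarrow> ereal) \<Rightarrow> bool" where
  "lsc_on S f \<longleftrightarrow> (\<forall>a. openin (top_of_set S) {x \<in> S. a < f x})"

definition touches_above ::
    "(quat^'n) set \<Rightarrow> (quat^'n \<Rightarrow> ereal) \<Rightarrow> (quat^'n \<Rightarrow> real) \<Rightarrow> quat^'n \<Rightarrow> bool" where
  "touches_above \<Omega> f \<phi> q0 \<longleftrightarrow> ereal (\<phi> q0) = f q0 \<and>
     (\<exists>N. open N \<and> q0 \<in> N \<and> N \<subseteq> \<Omega> \<and> C2_on N \<phi> \<and> (\<forall>q\<in>N. f q \<le> ereal (\<phi> q)))"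

definition touches_below ::
    "(quat^'n) set \<Rightarrow> (quat^'n \<Rightarrow> ereal) \<Rightarrow> (quat^'n \<Rightarrow> real) \<Rightarrow> quat^'n \<Rightarrow> bool" where
  "touches_below \<Omega> f \<phi> q0 \<longleftrightarrow> ereal (\<phi> q0) = f q0 \<and>
     (\<exists>N. open N \<and> q0 \<in> N \<and> N \<subseteq> \<Omega> \<and> C2_on N \<phi> \<and> (\<forall>q\<in>N. ereal (\<phi> q) \<le> f q))"

text \<open>Solutions of \<open>- det(f) + F(q, f) = 0\<close> in an open set \<open>\<Omega>\<close>; only values in \<open>\<Omega>\<close> matter.\<close>
definition viscosity_subsolution ::
    "(quat^'n) set \<Rightarrow> (quat^'n \<Rightarrow> real \<Rightarrow> real) \<Rightarrow> (quat^'n \<Rightarrow> ereal) \<Rightarrow> bool" where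
  "viscosity_subsolution \<Omega> F f \<longleftrightarrow>
     usc_on \<Omega> f \<and> (\<forall>q\<in>\<Omega>. f q \<noteq> \<infinity>) \<and> (\<exists>q\<in>\<Omega>. f q \<noteq> -\<infinity>) \<and>
     (\<forall>q0\<in>\<Omega>. \<forall>\<phi>. touches_above \<Omega> f \<phi> q0 \<longrightarrow> hess_det \<phi> q0 \<ge> F q0 (\<phi> q0))"

definition viscosity_supersolution ::
    "(quat^'n) set \<Rightarrow> (quat^'n \<Rightarrow> real \<Rightarrow> real) \<Rightarrow> (quat^'n \<Rightarrow> ereal) \<Rightarrow> bool" where
  "viscosity_supersolution \<Omega> F f \<longleftrightarrow>
     lsc_on \<Omega> f \<and> (\<forall>q\<in>\<Omega>. f q \<noteq> -\<infinity>) \<and> (\<exists>q\<in>\<Omega>. f q \<noteq> \<infinity>) \<and>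
     (\<forall>q0\<in>\<Omega>. \<forall>\<phi>. touches_below \<Omega> f \<phi> q0 \<longrightarrow> hess_det_plus \<phi> q0 \<le> F q0 (\<phi> q0))"

text \<open>\<open>\<Omega>\<close> is meant to be open, so that \<open>at \<zeta> within \<Omega>\<close> is the filter \<open>\<Omega> \<ni> q \<rightarrow> \<zeta>\<close> at a
  boundary point \<open>\<zeta>\<close>, and \<open>u - v\<close> to be finite on \<open>\<Omega>\<close>.\<close>
definition boundary_le ::
    "(quat^'n) set \<Rightarrow> (quat^'n \<Rightarrow> ereal) \<Rightarrow> (quat^'n \<Rightarrow> ereal) \<Rightarrow> bool" where
  "boundary_le \<Omega> u v \<longleftrightarrow>
     (\<forall>\<zeta>\<in>frontier \<Omega>. Limsup (at \<zeta> within \<Omega>) (\<lambda>q. u q - v q) \<le> 0)"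

end

theory Submission
  imports Defs
begin

text \<open>
The comparison principle for \<open>- det f + F (q, f) = 0\<close> is proved by regularizing the subsolution until it is
smooth; then it can be used directly as a test function for the supersolution. No doubling of
variables and no almost everywhere second derivatives occur. This works because \<open>det\<^sup>1\<^sup>/\<^sup>n\<close> is concave on
nonnegative hyperhermitian matrices: it is the infimum of the linear functions \<open>A \<mapsto> tr (B A) / n\<close> over
positive \<open>B\<close> with \<open>det B = 1\<close> (\<open>weighted_trace_lower_bound\<close>, \<open>prod_ge_of_weighted_sums\<close>). To compute
with the Moore determinant one needs the spectral theorem for hyperhermitian matrices
(\<open>quaternionic_spectral_theorem\<close>) and uniqueness of the product of the eigenvalues
(\<open>eigenvalue_product_unique\<close>).

A subsolution of the determinant inequality has a nonnegative Hessian in the viscosity sense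
(\<open>nonneg_of_hess_det_nonneg\<close>) and is therefore a viscosity subsolution of a family of linear
equations with constant coefficients, each a sum of second derivatives in finitely many real
directions (\<open>qhessian_form\<close>). Linear inequalities survive averaging over translates. For viscosity
inequalities this is the heart of the matter (\<open>mollify_subsolution\<close>): smooth functions evolving
under a random walk are compared with the subsolution by a discrete parabolic maximum principle
(\<open>walk_max_principle\<close>), which yields a sub-mean-value inequality for the walk. That inequality
can be averaged, and for smooth functions it gives back the differential inequality. Hence
mollification preserves the determinant inequality (\<open>mollify_eigenvalues\<close>).

Mollification needs a continuous function, so sup-convolution is applied first
(\<open>sup_convolution_subsolution\<close>); it respects the inequality up to a small shift of the point in \<open>F\<close>.
Adding \<open>\<epsilon> |q|\<^sup>2\<close> makes the inequality strict. At an interior maximum of the difference to the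
supersolution, strictness, monotonicity and continuity of \<open>F\<close> give a contradiction
(\<open>comparison_principle_real\<close>).
\<close>

section \<open>Twice continuously differentiable test functions\<close>

text \<open>A \<open>C\<^sup>2\<close> function on the whole space, bundled with its first and second derivative so that second
derivatives can be computed with. Symmetry of the second derivative is part of the bundle: every test
function below is a polynomial, a mollification, or built from these by sums and translations, and for
those symmetry is read off from the formula.\<close>

definition C2_jet ::
  "('a::euclidean_space \<Rightarrow> real) \<Rightarrow> ('a \<Rightarrow> 'a \<Rightarrow>\<^sub>L real) \<Rightarrow> ('a \<Rightarrow> 'a \<Rightarrow>\<^sub>L 'a \<Rightarrow>\<^sub>L real) \<Rightarrow> bool" where
  "C2_jet f f' f'' \<longleftrightarrow>
     (\<forall>x. (f has_derivative f' x) (at x)) \<and> (\<forall>x. (f' has_derivative f'' x) (at x)) \<and>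
     continuous_on UNIV f'' \<and> (\<forall>x h k. f'' x h k = f'' x k h)"

lemma C2_jet_C2_on: "C2_jet f f' f'' \<Longrightarrow> C2_on S f"
  unfolding C2_jet_def C2_on_def C1_on_def by (meson continuous_on_subset subset_UNIV)

lemma C2_jet_continuous:
  assumes "C2_jet f f' f''" shows "continuous_on S f"
  using assms unfolding C2_jet_def
  by (meson continuous_at_imp_continuous_on has_derivative_continuous)

lemma C2_jet_add:
  assumes "C2_jet f f' f''" "C2_jet g g' g''"
  shows "C2_jet (\<lambda>x. f x + g x) (\<lambda>x. f' x + g' x) (\<lambda>x. f'' x + g'' x)"
  using assms unfolding C2_jet_def
  by (auto simp: blinfun.add_left plus_blinfun.rep_eq intro!: continuous_intros has_derivative_add)

lemma C2_jet_scaleR: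
  assumes "C2_jet f f' f''"
  shows "C2_jet (\<lambda>x. c * f x) (\<lambda>x. c *\<^sub>R f' x) (\<lambda>x. c *\<^sub>R f'' x)"
proof -
  have a: "((\<lambda>x. c * f x) has_derivative blinfun_apply (c *\<^sub>R f' x)) (at x)" for x
    using assms unfolding C2_jet_def by (auto simp: scaleR_blinfun.rep_eq intro!: derivative_eq_intros)
  have b: "((\<lambda>x. c *\<^sub>R f' x) has_derivative blinfun_apply (c *\<^sub>R f'' x)) (at x)" for x
    using assms unfolding C2_jet_def by (auto simp: scaleR_blinfun.rep_eq intro!: derivative_eq_intros)
  show ?thesis
    using assms a b unfolding C2_jet_def
    by (auto simp: blinfun.scaleR_left intro!: continuous_intros)
qed

lemma C2_jet_const: "C2_jet (\<lambda>_. c) (\<lambda>_. 0) (\<lambda>_. 0)"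
proof -
  have c: "((\<lambda>_::'a. d::'c::real_normed_vector) has_derivative blinfun_apply 0) (at x)" for d x
    using has_derivative_const[of d "at x"] by (simp only: zero_blinfun.rep_eq)
  show ?thesis unfolding C2_jet_def by (intro conjI allI c) auto
qed

lemma C2_jet_translate:
  assumes "C2_jet f f' f''"
  shows "C2_jet (\<lambda>x. f (x + a)) (\<lambda>x. f' (x + a)) (\<lambda>x. f'' (x + a))"
proof -
  have add: "((\<lambda>x. x + a) has_derivative (\<lambda>h. h)) (at x)" for x
    using has_derivative_add[OF has_derivative_ident has_derivative_const[of a]] by simp
  have a: "((\<lambda>x. f (x + a)) has_derivative blinfun_apply (f' (x + a))) (at x)" for x
    by (rule has_derivative_compose[OF add]) (use assms in \<open>unfold C2_jet_def, blast\<close>)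
  have b: "((\<lambda>x. f' (x + a)) has_derivative blinfun_apply (f'' (x + a))) (at x)" for x
    by (rule has_derivative_compose[OF add]) (use assms in \<open>unfold C2_jet_def, blast\<close>)
  have "continuous_on UNIV (\<lambda>x. f'' (x + a))"
    by (rule continuous_on_compose2[where g=f'' and t=UNIV])
      (use assms in \<open>auto simp: C2_jet_def intro!: continuous_intros\<close>)
  moreover have "f'' x h k = f'' x k h" for x h k
    using assms unfolding C2_jet_def by blast
  ultimately show ?thesis
    unfolding C2_jet_def using a b by blast
qed

lemma C2_jet_sum:
  assumes "finite I" "\<And>i. i \<in> I \<Longrightarrow> C2_jet (f i) (f' i) (f'' i)"
  shows "C2_jet (\<lambda>x. \<Sum>i\<in>I. f i x) (\<lambda>x. \<Sum>i\<in>I. f' i x) (\<lambda>x. \<Sum>i\<in>I. f'' i x)"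
  using assms
proof (induction I rule: finite_induct)
  case empty
  then show ?case by (simp add: C2_jet_const)
next
  case (insert i I)
  then show ?case using C2_jet_add[of "f i" "f' i" "f'' i"] by simp
qed

lemma C2_jet_quadratic:
  fixes \<beta> :: "'a::euclidean_space \<Rightarrow> 'a \<Rightarrow> real"
  assumes "bilinear \<beta>" and sym: "\<And>h k. \<beta> h k = \<beta> k h"
  obtains p' p'' where "C2_jet (\<lambda>x. \<beta> (x - q) (x - q)) p' p''"
    and "\<And>x h k. p'' x h k = 2 * \<beta> h k"
proof -
  have lr: "linear (\<beta> h)" and ll: "linear (\<lambda>h. \<beta> h k)" for h k
    using assms(1) by (auto simp: bilinear_def)
  have br: "bounded_linear (\<lambda>k. 2 * \<beta> h k)" for h
    using lr[of h] by (auto simp: linear_conv_bounded_linear intro!: bounded_linear_intros)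
  define B where "B h = Blinfun (\<lambda>k. 2 * \<beta> h k)" for h
  have B: "B h k = 2 * \<beta> h k" for h k
    unfolding B_def by (simp add: bounded_linear_Blinfun_apply[OF br])
  have "linear B"
    by (rule linearI; rule blinfun_eqI)
       (simp_all add: B blinfun.add_left blinfun.scaleR_left linear_add[OF ll] linear_scale[OF ll] algebra_simps)
  then have Bb: "bounded_linear B" by (simp add: linear_conv_bounded_linear)
  define C where "C = Blinfun B"
  have C: "C h = B h" for h unfolding C_def by (simp add: bounded_linear_Blinfun_apply[OF Bb])
  interpret bb: bounded_bilinear \<beta> using assms(1) by (simp add: bilinear_conv_bounded_bilinear)
  have d1: "((\<lambda>x. \<beta> (x - q) (x - q)) has_derivative blinfun_apply (C (x - q))) (at x)" for x
  proof -
    have "((\<lambda>x. \<beta> (x - q) (x - q)) has_derivative (\<lambda>h. \<beta> (x - q) h + \<beta> h (x - q))) (at x)"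
      by (rule bb.FDERIV) (auto intro!: derivative_eq_intros)
    then show ?thesis
      by (rule has_derivative_eq_rhs) (auto simp: C B sym)
  qed
  have d2: "((\<lambda>x. C (x - q)) has_derivative blinfun_apply C) (at x)" for x
    by (auto intro!: derivative_eq_intros)
  have "C2_jet (\<lambda>x. \<beta> (x - q) (x - q)) (\<lambda>x. C (x - q)) (\<lambda>_. C)"
    unfolding C2_jet_def using d1 d2 by (auto simp: C B sym)
  then show thesis by (rule that) (simp add: C B)
qed

lemma C2_jet_dist_sq:
  fixes q :: "'a::euclidean_space"
  obtains p' p'' where "C2_jet (\<lambda>x. A * (norm (x - q))^2) p' p''"
    and "\<And>x h k. p'' x h k = 2 * A * (h \<bullet> k)"
proof -
  have "bilinear (\<lambda>h k::'a. A * (h \<bullet> k))"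
    by (auto simp: bilinear_def intro!: linearI simp: algebra_simps)
  from C2_jet_quadratic[OF this, of q] obtain p' p'' where
    "C2_jet (\<lambda>x. A * ((x - q) \<bullet> (x - q))) p' p''" "\<And>x h k. p'' x h k = 2 * (A * (h \<bullet> k))"
    by (auto simp: inner_commute)
  then show thesis by (intro that[of p' p'']) (auto simp: power2_norm_eq_inner)
qed

text \<open>The even function \<open>t \<mapsto> f (x + t d) + f (x - t d)\<close> has no first order term at \<open>0\<close>, so its Taylor
expansion expresses the second difference through the second derivative with no remainder of first order.\<close>

lemma C2_jet_second_difference:
  assumes j: "C2_jet f f' f''" and "0 < r"
  obtains \<xi> where "0 < \<xi>" "\<xi> < r"
    "f (x + r *\<^sub>R d) + f (x - r *\<^sub>R d) - 2 * f x
       = r^2 / 2 * (f'' (x + \<xi> *\<^sub>R d) d d + f'' (x - \<xi> *\<^sub>R d) d d)"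
proof -
  have df: "(f has_derivative f' x) (at x)" and df': "(f' has_derivative f'' x) (at x)" for x
    using j by (auto simp: C2_jet_def)
  define D :: "nat \<Rightarrow> real \<Rightarrow> real" where
    "D m = (if m = 0 then (\<lambda>t. f (x + t *\<^sub>R d) + f (x - t *\<^sub>R d))
            else if m = 1 then (\<lambda>t. f' (x + t *\<^sub>R d) d - f' (x - t *\<^sub>R d) d)
            else (\<lambda>t. f'' (x + t *\<^sub>R d) d d + f'' (x - t *\<^sub>R d) d d))" for m
  have line: "((\<lambda>t. g (x + t *\<^sub>R e)) has_derivative (\<lambda>s. g' (s *\<^sub>R e))) (at t)"
    if "(g has_derivative g') (at (x + t *\<^sub>R e))" for g :: "'a \<Rightarrow> 'b::real_normed_vector" and g' t e
    by (rule has_derivative_compose[where f="\<lambda>t. x + t *\<^sub>R e" and s=UNIV, OF _ that])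
       (auto intro!: derivative_eq_intros)
  have 0: "(D 0 has_real_derivative D 1 t) (at t)" for t
  proof -
    have "((\<lambda>t. f (x + t *\<^sub>R d) + f (x + t *\<^sub>R (- d))) has_derivative
        (\<lambda>s. f' (x + t *\<^sub>R d) (s *\<^sub>R d) + f' (x + t *\<^sub>R (- d)) (s *\<^sub>R (- d)))) (at t)"
      by (intro has_derivative_add line df)
    moreover have "(\<lambda>s. f' (x + t *\<^sub>R d) (s *\<^sub>R d) + f' (x + t *\<^sub>R (- d)) (s *\<^sub>R (- d))) = (*) (D 1 t)"
      by (auto simp: D_def fun_eq_iff blinfun.minus_right blinfun.scaleR_right algebra_simps)
    moreover have "(\<lambda>t. f (x + t *\<^sub>R d) + f (x + t *\<^sub>R (- d))) = D 0"
      by (simp add: D_def)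
    ultimately show ?thesis
      unfolding has_field_derivative_def by simp
  qed
  have line': "((\<lambda>t. f' (x + t *\<^sub>R e) d) has_derivative (\<lambda>s. f'' (x + t *\<^sub>R e) (s *\<^sub>R e) d)) (at t)" for t e
    using bounded_linear.has_derivative[OF blinfun.bounded_linear_left line[of f' _ t e, OF df']] .
  have 1: "(D 1 has_real_derivative D 2 t) (at t)" for t
  proof -
    have "((\<lambda>t. f' (x + t *\<^sub>R d) d - f' (x + t *\<^sub>R (- d)) d) has_derivative
        (\<lambda>s. f'' (x + t *\<^sub>R d) (s *\<^sub>R d) d - f'' (x + t *\<^sub>R (- d)) (s *\<^sub>R (- d)) d)) (at t)"
      by (intro has_derivative_diff line')
    moreover have "(\<lambda>s. f'' (x + t *\<^sub>R d) (s *\<^sub>R d) d - f'' (x + t *\<^sub>R (- d)) (s *\<^sub>R (- d)) d) = (*) (D 2 t)"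
      by (auto simp: D_def fun_eq_iff blinfun.minus_right blinfun.scaleR_right
          blinfun.minus_left blinfun.scaleR_left algebra_simps)
    moreover have "(\<lambda>t. f' (x + t *\<^sub>R d) d - f' (x + t *\<^sub>R (- d)) d) = D 1"
      by (simp add: D_def)
    ultimately show ?thesis
      unfolding has_field_derivative_def by simp
  qed
  have "\<exists>t. 0 < t \<and> t < r \<and> D 0 r = (\<Sum>m<2. D m 0 / fact m * r ^ m) + D 2 t / fact 2 * r ^ 2"
    using \<open>0 < r\<close> 0 1
    by (intro Maclaurin) (auto simp: less_Suc_eq numeral_2_eq_2)
  then obtain \<xi> where xi: "0 < \<xi>" "\<xi> < r"
    "D 0 r = (\<Sum>m<2. D m 0 / fact m * r ^ m) + D 2 \<xi> / fact 2 * r ^ 2" by blast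
  have "D 0 r = 2 * f x + r^2 / 2 * D 2 \<xi>"
    using xi(3) by (simp add: lessThan_nat_numeral lessThan_Suc numeral_2_eq_2) (simp add: D_def)
  then show thesis using xi(1,2) by (intro that[of \<xi>]) (simp_all add: D_def)
qed

section \<open>Symmetric random walks\<close>

text \<open>One step of the symmetric random walk with step size \<open>r\<close> along the directions \<open>d i\<close>, acting on
functions. Its values may lie in any normed space, so that it also acts on derivatives, with which it
commutes. Up to the factor \<open>r\<^sup>2 / (2 |I|)\<close> it is the identity plus the operator \<open>dirsum\<close> below; its
iterates play the part of the heat semigroup of that operator but are finite averages.\<close>

definition walk :: "'i set \<Rightarrow> ('i \<Rightarrow> 'a::euclidean_space) \<Rightarrow> real \<Rightarrow> ('a \<Rightarrow> 'b::real_normed_vector) \<Rightarrow> 'a \<Rightarrow> 'b" where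
  "walk I d r f x = (1 / (2 * real (card I))) *\<^sub>R (\<Sum>i\<in>I. f (x + r *\<^sub>R d i) + f (x - r *\<^sub>R d i))"

text \<open>The constant-coefficient operator \<open>\<Sum>\<^sub>i \<partial>\<^sup>2 / \<partial>d\<^sub>i\<^sup>2\<close>, given the second derivative of the function.\<close>

definition dirsum :: "'i set \<Rightarrow> ('i \<Rightarrow> 'a::euclidean_space) \<Rightarrow> ('a \<Rightarrow> 'a \<Rightarrow>\<^sub>L 'a \<Rightarrow>\<^sub>L real) \<Rightarrow> 'a \<Rightarrow> real" where
  "dirsum I d f'' x = (\<Sum>i\<in>I. f'' x (d i) (d i))"

lemma walk_add: "walk I d r (\<lambda>x. f x + g x) x = walk I d r f x + walk I d r g x"
  by (simp add: walk_def sum.distrib algebra_simps)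

lemma walk_scaleR: "walk I d r (\<lambda>x. c *\<^sub>R f x) x = c *\<^sub>R walk I d r f x"
  by (simp add: walk_def scaleR_sum_right scaleR_add_right mult.commute)

lemma walk_const:
  assumes "finite I" "I \<noteq> {}" shows "walk I d r (\<lambda>_. c) = (\<lambda>_. c)"
proof -
  have "(2 * real (card I)) *\<^sub>R c = (\<Sum>i\<in>I. c + c)"
    by (simp add: sum_constant_scaleR flip: scaleR_2)
  then show ?thesis using assms by (simp add: walk_def fun_eq_iff) (simp add: flip: \<open>_ = (\<Sum>i\<in>I. c + c)\<close>)
qed

lemma walk_mono:
  fixes f g :: "_ \<Rightarrow> real"
  assumes "\<And>x. f x \<le> g x" shows "walk I d r f x \<le> walk I d r g x"
  using assms unfolding walk_def
  by (intro scaleR_left_mono sum_mono add_mono) auto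

lemma walk_pow_add:
  "(walk I d r ^^ k) (\<lambda>x. f x + g x) x = (walk I d r ^^ k) f x + (walk I d r ^^ k) g x"
proof (induction k arbitrary: x)
  case (Suc k)
  then have "(walk I d r ^^ k) (\<lambda>x. f x + g x) = (\<lambda>x. (walk I d r ^^ k) f x + (walk I d r ^^ k) g x)"
    by auto
  then show ?case by (simp add: walk_add)
qed simp

lemma walk_pow_scaleR: "(walk I d r ^^ k) (\<lambda>x. c *\<^sub>R f x) x = c *\<^sub>R (walk I d r ^^ k) f x"
proof (induction k arbitrary: x)
  case (Suc k)
  then have "(walk I d r ^^ k) (\<lambda>x. c *\<^sub>R f x) = (\<lambda>x. c *\<^sub>R (walk I d r ^^ k) f x)"
    by auto
  then show ?case by (simp add: walk_scaleR)
qed simp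

lemma walk_pow_mult:
  fixes f :: "_ \<Rightarrow> real"
  shows "(walk I d r ^^ k) (\<lambda>x. c * f x) x = c * (walk I d r ^^ k) f x"
  using walk_pow_scaleR[of k I d r c f x] by simp

lemma walk_pow_diff:
  "(walk I d r ^^ k) (\<lambda>x. f x - g x) x = (walk I d r ^^ k) f x - (walk I d r ^^ k) g x"
  using walk_pow_add[of k I d r f "\<lambda>x. (-1) *\<^sub>R g x" x] walk_pow_scaleR[of k I d r "-1" g x] by simp

lemma walk_pow_const:
  assumes "finite I" "I \<noteq> {}" shows "(walk I d r ^^ k) (\<lambda>_. c) = (\<lambda>_. c)"
  by (induction k) (simp_all add: walk_const[OF assms])

lemma walk_pow_mono:
  fixes f g :: "_ \<Rightarrow> real"
  assumes "\<And>x. f x \<le> g x" shows "(walk I d r ^^ k) f x \<le> (walk I d r ^^ k) g x"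
  using assms by (induction k arbitrary: x) (auto intro: walk_mono)

lemma walk_pow_ge_const:
  fixes f :: "_ \<Rightarrow> real"
  assumes "finite I" "I \<noteq> {}" "\<And>x. c \<le> f x" shows "c \<le> (walk I d r ^^ k) f x"
  using walk_pow_mono[of "\<lambda>_. c" f k I d r x] assms by (simp add: walk_pow_const)

text \<open>After \<open>k\<close> steps the walk has second moment proportional to \<open>k r\<^sup>2\<close>; this controls how far mass can
escape and replaces tail estimates.\<close>

lemma walk_pow_dist_sq:
  assumes "finite I" "I \<noteq> {}"
  shows "(walk I d r ^^ k) (\<lambda>y. (norm (y - x))^2) y
    = (norm (y - x))^2 + real k * (r^2 * ((\<Sum>i\<in>I. (norm (d i))^2) / real (card I)))"
proof -
  define s where "s = (\<Sum>i\<in>I. (norm (d i))^2) / real (card I)"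
  have c: "card I \<noteq> 0" using assms by simp
  have par: "(norm (y + r *\<^sub>R d i - x))^2 + (norm (y - r *\<^sub>R d i - x))^2
      = 2 * (norm (y - x))^2 + 2 * r^2 * (norm (d i))^2" for y i
  proof -
    have "(norm (a + b))^2 + (norm (a - b))^2 = 2 * (norm a)^2 + 2 * (norm b)^2" for a b :: 'b
      by (simp add: power2_norm_eq_inner inner_diff_left inner_diff_right inner_add_left inner_add_right)
    from this[of "y - x" "r *\<^sub>R d i"] show ?thesis by (simp add: algebra_simps)
  qed
  have one: "walk I d r (\<lambda>y. (norm (y - x))^2) = (\<lambda>y. (norm (y - x))^2 + r^2 * s)"
    unfolding walk_def par s_def using c
    by (auto simp: fun_eq_iff sum.distrib field_simps simp flip: sum_distrib_left)
  have "(walk I d r ^^ k) (\<lambda>y. (norm (y - x))^2) = (\<lambda>y. (norm (y - x))^2 + real k * (r^2 * s))"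
  proof (induction k)
    case (Suc k)
    show ?case
      unfolding funpow.simps o_def Suc.IH
      by (simp add: walk_add one walk_const[OF assms] algebra_simps fun_eq_iff)
  qed simp
  then show ?thesis by (simp add: s_def)
qed

lemma C2_jet_walk:
  assumes "finite I" "C2_jet f f' f''"
  shows "C2_jet (walk I d r f) (walk I d r f') (walk I d r f'')"
proof -
  have "C2_jet (\<lambda>x. (1 / (2 * real (card I))) * (\<Sum>i\<in>I. f (x + r *\<^sub>R d i) + f (x + - (r *\<^sub>R d i))))
     (\<lambda>x. (1 / (2 * real (card I))) *\<^sub>R (\<Sum>i\<in>I. f' (x + r *\<^sub>R d i) + f' (x + - (r *\<^sub>R d i))))
     (\<lambda>x. (1 / (2 * real (card I))) *\<^sub>R (\<Sum>i\<in>I. f'' (x + r *\<^sub>R d i) + f'' (x + - (r *\<^sub>R d i))))"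
    by (intro C2_jet_scaleR C2_jet_sum C2_jet_add C2_jet_translate assms)
  then show ?thesis unfolding walk_def[abs_def] by simp
qed

lemma C2_jet_walk_pow:
  assumes "finite I" "C2_jet f f' f''"
  shows "C2_jet ((walk I d r ^^ k) f) ((walk I d r ^^ k) f') ((walk I d r ^^ k) f'')"
  by (induction k) (simp_all add: assms C2_jet_walk)

lemma dirsum_walk: "dirsum I d (walk J e r f'') x = walk J e r (dirsum I d f'') x"
proof -
  have 1: "walk J e r f'' x u v = walk J e r (\<lambda>y. f'' y u v) x" for u v
    by (simp add: walk_def blinfun.scaleR_left blinfun.sum_left blinfun.add_left)
  have "dirsum I d (walk J e r f'') x = (\<Sum>i\<in>I. walk J e r (\<lambda>y. f'' y (d i) (d i)) x)"
    by (simp add: dirsum_def 1)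
  also have "\<dots> = walk J e r (dirsum I d f'') x"
    unfolding walk_def dirsum_def
    by (simp add: sum.distrib[symmetric] sum.swap[of _ J I] flip: scaleR_sum_right sum_divide_distrib)
  finally show ?thesis .
qed

lemma dirsum_walk_pow: "dirsum I d ((walk J e r ^^ k) f'') x = (walk J e r ^^ k) (dirsum I d f'') x"
proof (induction k arbitrary: x)
  case (Suc k)
  then have "dirsum I d ((walk J e r ^^ k) f'') = (walk J e r ^^ k) (dirsum I d f'')" by auto
  then show ?case by (simp add: dirsum_walk)
qed simp

lemma blinfun2_bound: "\<bar>blinfun_apply (blinfun_apply B h) h\<bar> \<le> norm B * (norm h)^2"
proof -
  have "norm (B h h) \<le> norm (B h) * norm h" by (rule norm_blinfun)
  also have "\<dots> \<le> (norm B * norm h) * norm h" by (intro mult_right_mono norm_blinfun) auto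
  finally show ?thesis by (simp add: power2_eq_square mult.assoc)
qed

text \<open>Consistency of the walk with the operator \<open>dirsum\<close>, uniformly on the whole space. The second form is
needed because the maximum principle below sees the operator after the step, not before it.\<close>

lemma walk_consistent:
  assumes I: "finite I" "I \<noteq> {}" and j: "C2_jet f f' f''"
    and uc: "isUCont f''" and "0 < \<epsilon>"
  obtains r0 where "0 < r0"
    "\<And>r x. 0 < r \<Longrightarrow> r < r0 \<Longrightarrow>
       \<bar>walk I d r f x - f x - r^2 / (2 * real (card I)) * dirsum I d f'' x\<bar> \<le> r^2 / (2 * real (card I)) * \<epsilon>"
    "\<And>r x. 0 < r \<Longrightarrow> r < r0 \<Longrightarrow> \<bar>walk I d r (dirsum I d f'') x - dirsum I d f'' x\<bar> \<le> \<epsilon>"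
proof -
  have half: "\<bar>(a + b) / 2\<bar> \<le> c" if "\<bar>a\<bar> \<le> c" "\<bar>b\<bar> \<le> c" for a b c :: real
    using that by (auto simp: abs_le_iff)
  define s where "s = (\<Sum>i\<in>I. (norm (d i))^2)"
  have s0: "0 \<le> s" by (simp add: s_def sum_nonneg)
  define e where "e = \<epsilon> / (1 + s)"
  have e: "0 < e" "e * s \<le> \<epsilon>"
    using s0 \<open>0 < \<epsilon>\<close> by (auto simp: e_def field_simps)
  obtain \<delta> where \<delta>: "0 < \<delta>" "\<And>x y. dist y x < \<delta> \<Longrightarrow> dist (f'' y) (f'' x) < e"
    using uc e(1) unfolding uniformly_continuous_on_def by blast
  define m where "m = 1 + Max ((\<lambda>i. norm (d i)) ` I)"
  have m: "norm (d i) < m" if "i \<in> I" for i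
  proof -
    have "norm (d i) \<le> Max ((\<lambda>i. norm (d i)) ` I)" using I that by (intro Max_ge) auto
    then show ?thesis unfolding m_def by linarith
  qed
  have m0: "0 < m" using I m norm_ge_zero by (metis ex_in_conv le_less_trans)
  define r0 where "r0 = \<delta> / m"
  have r0: "0 < r0" using \<delta>(1) m0 by (simp add: r0_def)
  have close: "norm (f'' y - f'' x) < e"
    if "i \<in> I" "0 \<le> \<xi>" "\<xi> < r0" "y = x + \<xi> *\<^sub>R d i \<or> y = x - \<xi> *\<^sub>R d i" for i \<xi> x y
  proof -
    have "dist y x = \<xi> * norm (d i)" using that by (auto simp: dist_norm)
    also have "\<dots> \<le> \<xi> * m" using m[OF that(1)] that by (intro mult_left_mono) auto
    also have "\<dots> < \<delta>" using that m0 by (simp add: r0_def field_simps)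
    finally show ?thesis using \<delta>(2) by (simp add: dist_norm)
  qed
  have near: "\<bar>f'' y (d k) (d k) - f'' x (d k) (d k)\<bar> \<le> e * (norm (d k))^2"
    if "norm (f'' y - f'' x) < e" for x y k
  proof -
    have "\<bar>(f'' y - f'' x) (d k) (d k)\<bar> \<le> norm (f'' y - f'' x) * (norm (d k))^2"
      by (rule blinfun2_bound)
    also have "\<dots> \<le> e * (norm (d k))^2"
      using that by (intro mult_right_mono) auto
    finally show ?thesis by (simp add: blinfun.diff_left)
  qed
  have A: "\<bar>walk I d r f x - f x - r^2 / (2 * real (card I)) * dirsum I d f'' x\<bar> \<le> r^2 / (2 * real (card I)) * \<epsilon>"
    if r: "0 < r" "r < r0" for r x
  proof -
    let ?D = "\<lambda>i. f (x + r *\<^sub>R d i) + f (x - r *\<^sub>R d i) - 2 * f x - r^2 * f'' x (d i) (d i)"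
    have sd: "\<bar>?D i\<bar>
        \<le> r^2 * (e * (norm (d i))^2)" if i: "i \<in> I" for i
    proof -
      obtain \<xi> where xi: "0 < \<xi>" "\<xi> < r"
        "f (x + r *\<^sub>R d i) + f (x - r *\<^sub>R d i) - 2 * f x
           = r^2 / 2 * (f'' (x + \<xi> *\<^sub>R d i) (d i) (d i) + f'' (x - \<xi> *\<^sub>R d i) (d i) (d i))"
        using C2_jet_second_difference[OF j r(1)] .
      have n1: "\<bar>f'' (x + \<xi> *\<^sub>R d i) (d i) (d i) - f'' x (d i) (d i)\<bar> \<le> e * (norm (d i))^2"
        using xi r i by (intro near close[of i \<xi>]) auto
      have n2: "\<bar>f'' (x - \<xi> *\<^sub>R d i) (d i) (d i) - f'' x (d i) (d i)\<bar> \<le> e * (norm (d i))^2"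
        using xi r i by (intro near close[of i \<xi>]) auto
      have "?D i
        = r^2 * (((f'' (x + \<xi> *\<^sub>R d i) (d i) (d i) - f'' x (d i) (d i))
            + (f'' (x - \<xi> *\<^sub>R d i) (d i) (d i) - f'' x (d i) (d i))) / 2)"
        unfolding xi(3) by (simp add: field_simps)
      moreover have "\<bar>((f'' (x + \<xi> *\<^sub>R d i) (d i) (d i) - f'' x (d i) (d i))
            + (f'' (x - \<xi> *\<^sub>R d i) (d i) (d i) - f'' x (d i) (d i))) / 2\<bar> \<le> e * (norm (d i))^2"
        using half[OF n1 n2] .
      ultimately show ?thesis by (simp only: abs_mult abs_power2 mult_left_mono zero_le_power2)
    qed
    have "walk I d r f x - f x - r^2 / (2 * real (card I)) * dirsum I d f'' x
      = (1 / (2 * real (card I))) * (\<Sum>i\<in>I. ?D i)"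
    proof -
      have "(\<Sum>i\<in>I. ?D i)
        = (\<Sum>i\<in>I. f (x + r *\<^sub>R d i) + f (x - r *\<^sub>R d i)) - real (card I) * (2 * f x) - r^2 * dirsum I d f'' x"
        by (simp add: sum_subtractf dirsum_def sum_distrib_left)
      then show ?thesis
        using I by (simp add: walk_def right_diff_distrib)
    qed
    moreover have "\<bar>\<Sum>i\<in>I. ?D i\<bar>
        \<le> (\<Sum>i\<in>I. r^2 * (e * (norm (d i))^2))"
      by (rule order_trans[OF sum_abs sum_mono[OF sd]])
    moreover have "(\<Sum>i\<in>I. r^2 * (e * (norm (d i))^2)) = r^2 * (e * s)"
      by (simp add: s_def sum_distrib_left)
    moreover have "r^2 * (e * s) \<le> r^2 * \<epsilon>" using e(2) by (intro mult_left_mono) auto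
    ultimately show ?thesis by (simp add: abs_mult divide_right_mono)
  qed
  have B: "\<bar>walk I d r (dirsum I d f'') x - dirsum I d f'' x\<bar> \<le> \<epsilon>"
    if r: "0 < r" "r < r0" for r x
  proof -
    have *: "\<bar>dirsum I d f'' y - dirsum I d f'' x\<bar> \<le> \<epsilon>"
      if "i \<in> I" "y = x + r *\<^sub>R d i \<or> y = x - r *\<^sub>R d i" for i y
    proof -
      have ne: "norm (f'' y - f'' x) < e" using that r by (intro close[of i r]) auto
      have "\<bar>dirsum I d f'' y - dirsum I d f'' x\<bar> = \<bar>\<Sum>i\<in>I. f'' y (d i) (d i) - f'' x (d i) (d i)\<bar>"
        by (simp add: dirsum_def sum_subtractf)
      also have "\<dots> \<le> (\<Sum>i\<in>I. e * (norm (d i))^2)"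
        by (rule order_trans[OF sum_abs sum_mono]) (rule near[OF ne])
      also have "\<dots> \<le> \<epsilon>" using e by (simp add: s_def sum_distrib_left)
      finally show ?thesis .
    qed
    have "walk I d r (dirsum I d f'') x - dirsum I d f'' x = (1 / (2 * real (card I))) *
       (\<Sum>i\<in>I. (dirsum I d f'' (x + r *\<^sub>R d i) - dirsum I d f'' x) + (dirsum I d f'' (x - r *\<^sub>R d i) - dirsum I d f'' x))"
      using I by (simp add: walk_def sum_subtractf sum.distrib field_simps)
    also have "\<bar>\<dots>\<bar> \<le> (1 / (2 * real (card I))) * (\<Sum>i\<in>I. 2 * \<epsilon>)"
      unfolding abs_mult
    proof (intro mult_mono order_trans[OF sum_abs sum_mono])
      fix i assume "i \<in> I"
      then show "\<bar>dirsum I d f'' (x + r *\<^sub>R d i) - dirsum I d f'' x + (dirsum I d f'' (x - r *\<^sub>R d i) - dirsum I d f'' x)\<bar> \<le> 2 * \<epsilon>"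
        by (intro order_trans[OF abs_triangle_ineq] order_trans[OF add_mono[OF * *]]) auto
    qed auto
    also have "\<dots> = \<epsilon>" using I by simp
    finally show ?thesis .
  qed
  show thesis using that[OF r0 A B] .
qed

section \<open>A discrete parabolic maximum principle\<close>

text \<open>Let \<open>z\<close> be a viscosity subsolution of \<open>L z \<ge> - c\<close>, with \<open>L = dirsum I d\<close>, wherever it is positive.
The walk \<open>S\<close> started at a smooth majorant \<open>g\<close> of \<open>z\<close> produces smooth functions, so each of them is
an admissible test function: at a point where \<open>z - S\<^sup>k\<^sup>+\<^sup>1 g\<close> is maximal, \<open>L (S\<^sup>k\<^sup>+\<^sup>1 g) \<ge> - c\<close>.
One step adds \<open>r\<^sup>2 / (2 |I|) L\<close> up to a small error, so at that point \<open>z - S\<^sup>k g\<close> is smaller by at most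
\<open>r\<^sup>2 / (2 |I|) (c + e)\<close>, and induction bounds the maximum. Positivity of \<open>S\<^sup>k g\<close> and the compact
support of \<open>z\<close> keep the relevant maxima at points where \<open>z > 0\<close>.\<close>

lemma walk_max_principle:
  fixes z g :: "'a::euclidean_space \<Rightarrow> real"
  assumes I: "finite I" "I \<noteq> {}"
    and zc: "continuous_on UNIV z" and z0: "\<And>x. 0 \<le> z x" and zR: "\<And>x. R < norm x \<Longrightarrow> z x = 0"
    and touch: "\<And>\<phi> \<phi>' \<phi>'' x. C2_jet \<phi> \<phi>' \<phi>'' \<Longrightarrow> (\<And>y. z y \<le> \<phi> y) \<Longrightarrow> z x = \<phi> x \<Longrightarrow> 0 < z x
       \<Longrightarrow> - c \<le> dirsum I d \<phi>'' x"
    and "0 \<le> c" "0 \<le> e"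
    and j: "C2_jet g g' g''" and zg: "\<And>x. z x \<le> g x"
    and cons: "\<And>x. \<bar>walk I d r g x - g x - r^2 / (2 * real (card I)) * walk I d r (dirsum I d g'') x\<bar>
       \<le> r^2 / (2 * real (card I)) * e"
  shows "z x \<le> (walk I d r ^^ k) g x + real k * (r^2 / (2 * real (card I)) * (c + e))"
proof (induction k arbitrary: x)
  case 0
  then show ?case using zg by simp
next
  case (Suc k)
  define h where "h = r^2 / (2 * real (card I))"
  have h0: "0 \<le> h" by (simp add: h_def)
  define \<tau> where "\<tau> = h * (c + e)"
  have tau: "0 \<le> \<tau>" using h0 \<open>0 \<le> c\<close> \<open>0 \<le> e\<close> by (simp add: \<tau>_def)
  define \<psi> where "\<psi> = (walk I d r ^^ Suc k) g"
  have j\<psi>: "C2_jet \<psi> ((walk I d r ^^ Suc k) g') ((walk I d r ^^ Suc k) g'')"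
    unfolding \<psi>_def by (rule C2_jet_walk_pow[OF I(1) j])
  have \<psi>0: "0 \<le> \<psi> y" for y
    unfolding \<psi>_def using z0 zg by (intro walk_pow_ge_const I) (meson order_trans)
  show ?case
  proof (rule ccontr)
    assume "\<not> ?thesis"
    then have x: "real (Suc k) * \<tau> < z x - \<psi> x"
      by (simp add: \<psi>_def \<tau>_def h_def)
    have "0 \<le> real (Suc k) * \<tau>" using tau by simp
    then have zx: "0 < z x" using x \<psi>0[of x] by linarith
    then have xR: "x \<in> cball 0 R" using zR[of x] by (auto simp: not_less[symmetric])
    have "continuous_on (cball 0 R) (\<lambda>y. z y - \<psi> y)"
      by (intro continuous_intros continuous_on_subset[OF zc] C2_jet_continuous[OF j\<psi>]) auto
    then obtain m where m: "m \<in> cball 0 R" "\<And>y. y \<in> cball 0 R \<Longrightarrow> z y - \<psi> y \<le> z m - \<psi> m"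
      using continuous_attains_sup[OF compact_cball, of 0 R "\<lambda>y. z y - \<psi> y"] xR by blast
    define \<sigma> where "\<sigma> = z m - \<psi> m"
    have \<sigma>: "real (Suc k) * \<tau> < \<sigma>" using x m(2)[OF xR] by (simp add: \<sigma>_def)
    then have \<sigma>0: "0 < \<sigma>" using \<open>0 \<le> real (Suc k) * \<tau>\<close> by linarith
    have "- c \<le> dirsum I d (\<lambda>y. (walk I d r ^^ Suc k) g'' y + 0) m"
    proof (rule touch)
      show "C2_jet (\<lambda>y. \<psi> y + \<sigma>) (\<lambda>y. (walk I d r ^^ Suc k) g' y + 0) (\<lambda>y. (walk I d r ^^ Suc k) g'' y + 0)"
        by (rule C2_jet_add[OF j\<psi> C2_jet_const])
      show "z y \<le> \<psi> y + \<sigma>" for y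
      proof (cases "y \<in> cball 0 R")
        case True
        then show ?thesis using m(2)[OF True] by (simp add: \<sigma>_def)
      next
        case False
        then show ?thesis using zR[of y] \<psi>0[of y] \<sigma>0 by auto
      qed
      show "z m = \<psi> m + \<sigma>" "0 < z m" using \<sigma>0 \<psi>0[of m] by (auto simp: \<sigma>_def)
    qed
    then have L: "- c \<le> (walk I d r ^^ k) (walk I d r (dirsum I d g'')) m"
      by (simp only: add_0_right dirsum_walk_pow) (simp only: funpow_Suc_right o_def)
    \<comment> \<open>Undo one step at the contact point: \<open>\<psi> m\<close> differs from \<open>S\<^sup>k g m\<close> by a multiple of \<open>L \<psi> m \<ge> - c\<close>.\<close>
    have "(walk I d r ^^ k) g m \<le> \<psi> m + \<tau>"
    proof -
      have "walk I d r g y - g y - h * walk I d r (dirsum I d g'') y \<ge> - (h * e)" for y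
        using cons[of y] unfolding h_def[symmetric] by linarith
      then have "- (h * e) \<le> (walk I d r ^^ k) (\<lambda>y. walk I d r g y - g y - h * walk I d r (dirsum I d g'') y) m"
        by (intro walk_pow_ge_const I)
      also have "\<dots> = \<psi> m - (walk I d r ^^ k) g m - h * (walk I d r ^^ k) (walk I d r (dirsum I d g'')) m"
        by (simp only: walk_pow_diff walk_pow_mult \<psi>_def funpow_Suc_right o_def)
      finally have "(walk I d r ^^ k) g m \<le> \<psi> m + h * e - h * (walk I d r ^^ k) (walk I d r (dirsum I d g'')) m"
        by linarith
      moreover have "h * - c \<le> h * (walk I d r ^^ k) (walk I d r (dirsum I d g'')) m"
        by (intro mult_left_mono L h0)
      ultimately show ?thesis by (simp add: \<tau>_def algebra_simps)
    qed
    moreover have "z m \<le> (walk I d r ^^ k) g m + real k * \<tau>"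
      using Suc.IH[of m] by (simp add: \<tau>_def h_def)
    ultimately have "\<sigma> \<le> real (Suc k) * \<tau>" by (simp add: \<sigma>_def algebra_simps)
    then show False using \<sigma> by simp
  qed
qed

text \<open>Passage from the viscosity inequality to the classical one for any smooth average \<open>f\<close> of translates
of \<open>z\<close>; the hypothesis \<open>inherit\<close> is all that is used of averaging. The maximum principle gives
\<open>z \<le> S\<^sup>k z + k r\<^sup>2 / (2 |I|) (c + e) + \<eta>\<close>, and \<open>f\<close> inherits this. If \<open>L f x < - c\<close> at some point, then
\<open>L f < - c\<close> near \<open>x\<close>, and up to a small time \<open>t = k r\<^sup>2\<close> little of the walk has left that
neighbourhood, so \<open>S\<^sup>k f x\<close> drops below \<open>f x\<close> faster than the inherited inequality allows.\<close>

lemma averaged_subsolution: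
  fixes z f :: "'a::euclidean_space \<Rightarrow> real"
  assumes I: "finite I" "I \<noteq> {}"
    and zc: "continuous_on UNIV z" and z0: "\<And>x. 0 \<le> z x" and zR: "\<And>x. R < norm x \<Longrightarrow> z x = 0"
    and touch: "\<And>\<phi> \<phi>' \<phi>'' x. C2_jet \<phi> \<phi>' \<phi>'' \<Longrightarrow> (\<And>y. z y \<le> \<phi> y) \<Longrightarrow> z x = \<phi> x \<Longrightarrow> 0 < z x
       \<Longrightarrow> - c \<le> dirsum I d \<phi>'' x"
    and "0 \<le> c"
    and approx: "\<And>\<eta>. 0 < \<eta> \<Longrightarrow> \<exists>g g' g''. C2_jet g g' g'' \<and> isUCont g'' \<and>
       (\<forall>x. z x \<le> g x \<and> g x \<le> z x + \<eta>)"
    and j: "C2_jet f f' f''" and uc: "isUCont f''" and bd: "bounded (range f'')"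
    and inherit: "\<And>r k \<tau> x. (\<And>x. z x \<le> (walk I d r ^^ k) z x + \<tau>) \<Longrightarrow> f x \<le> (walk I d r ^^ k) f x + \<tau>"
  shows "- c \<le> dirsum I d f'' x"
proof (rule ccontr)
  assume neg: "\<not> ?thesis"
  obtain a where a: "0 < a" "dirsum I d f'' x = - c - 3 * a"
  proof
    show "0 < (- c - dirsum I d f'' x) / 3" using neg by simp
    show "dirsum I d f'' x = - c - 3 * ((- c - dirsum I d f'' x) / 3)" by algebra
  qed
  define s where "s = (\<Sum>i\<in>I. (norm (d i))^2) / real (card I)"
  have s0: "0 \<le> s" by (simp add: s_def sum_nonneg)
  define N where "N = 2 * real (card I)"
  have N: "0 < N" using I by (simp add: N_def card_gt_0_iff)
  \<comment> \<open>A global quadratic upper bound for \<open>L f\<close>, so that the mean of \<open>L f\<close> after several steps is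
    controlled by the second moment of the walk alone.\<close>
  obtain \<kappa> where \<kappa>: "0 \<le> \<kappa>" "\<And>y. dirsum I d f'' y \<le> - c - 2 * a + \<kappa> * (norm (y - x))^2"
  proof -
    obtain B where B: "\<And>y. norm (f'' y) \<le> B" using bd by (auto simp: bounded_iff)
    have B0: "0 \<le> B" using B norm_ge_zero order_trans by blast
    have Lb: "dirsum I d f'' y \<le> (\<Sum>i\<in>I. B * (norm (d i))^2)" for y
      unfolding dirsum_def
    proof (rule sum_mono)
      fix i
      have "f'' y (d i) (d i) \<le> norm (f'' y) * (norm (d i))^2"
        using blinfun2_bound[of "f'' y" "d i"] by linarith
      also have "\<dots> \<le> B * (norm (d i))^2" by (intro mult_right_mono B) auto
      finally show "f'' y (d i) (d i) \<le> B * (norm (d i))^2" .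
    qed
    define b where "b = (\<Sum>i\<in>I. B * (norm (d i))^2)"
    have b0: "0 \<le> b" using B0 by (auto simp: b_def intro!: sum_nonneg)
    have "continuous_on UNIV (dirsum I d f'')"
      unfolding dirsum_def[abs_def] using j by (auto simp: C2_jet_def intro!: continuous_intros)
    then have "isCont (dirsum I d f'') x" by (simp add: continuous_on_eq_continuous_at)
    then obtain \<delta> where \<delta>: "0 < \<delta>" "\<And>y. dist y x < \<delta> \<Longrightarrow> dist (dirsum I d f'' y) (dirsum I d f'' x) < a"
      unfolding continuous_at_eps_delta using a(1) by blast
    define \<kappa> where "\<kappa> = (b + c + 2 * a) / \<delta>^2"
    show thesis
    proof (rule that[of \<kappa>])
      show k0: "0 \<le> \<kappa>" using b0 \<open>0 \<le> c\<close> a \<delta>(1) by (simp add: \<kappa>_def)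
      show "dirsum I d f'' y \<le> - c - 2 * a + \<kappa> * (norm (y - x))^2" for y
      proof (cases "dist y x < \<delta>")
        case True
        then have "dirsum I d f'' y < - c - 2 * a" using \<delta>(2)[OF True] a(2) by (auto simp: dist_real_def)
        moreover have "0 \<le> \<kappa> * (norm (y - x))^2" using k0 by simp
        ultimately show ?thesis by linarith
      next
        case False
        then have "\<delta>^2 \<le> (norm (y - x))^2" using \<delta>(1) by (intro power_mono) (auto simp: dist_norm)
        then have "\<kappa> * \<delta>^2 \<le> \<kappa> * (norm (y - x))^2" using k0 by (intro mult_left_mono)
        moreover have "\<kappa> * \<delta>^2 = b + c + 2 * a" using \<delta>(1) by (simp add: \<kappa>_def)
        ultimately show ?thesis using Lb[of y] unfolding b_def[symmetric] by linarith
      qed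
    qed
  qed
  \<comment> \<open>The time is chosen so short that \<open>\<kappa>\<close> times the second moment stays below \<open>a / 2\<close>; then \<open>e\<close> and \<open>\<eta>\<close>
    are small relative to \<open>a\<close> and \<open>t a\<close>, and only afterwards the step size \<open>r\<close> is fixed.\<close>
  define t where "t = a / (2 * (\<kappa> * s + 1))"
  have ks: "0 \<le> \<kappa> * s" using \<kappa>(1) s0 by simp
  have t: "0 < t" using a(1) ks by (simp add: t_def)
  have "\<kappa> * s * t \<le> (\<kappa> * s + 1) * t" using t by (intro mult_right_mono) auto
  also have "\<dots> = a / 2" using ks by (simp add: t_def field_simps)
  finally have kst: "\<kappa> * s * t \<le> a / 2" .
  define e where "e = a / 4"
  have e: "0 < e" "0 < e / 2" using a by (auto simp: e_def)
  define \<eta> where "\<eta> = t * a / (4 * N)"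
  have \<eta>: "0 < \<eta>" using t a N by (simp add: \<eta>_def)
  obtain g g' g'' where g: "C2_jet g g' g''" "isUCont g''"
    "\<And>x. z x \<le> g x" "\<And>x. g x \<le> z x + \<eta>" using approx[OF \<eta>] by blast
  obtain r1 where r1: "0 < r1"
    "\<And>r x. 0 < r \<Longrightarrow> r < r1 \<Longrightarrow> \<bar>walk I d r f x - f x - r^2 / N * dirsum I d f'' x\<bar> \<le> r^2 / N * e"
    using walk_consistent[OF I j uc e(1), where d=d] unfolding N_def by metis
  obtain r2 where r2: "0 < r2"
    "\<And>r x. 0 < r \<Longrightarrow> r < r2 \<Longrightarrow> \<bar>walk I d r g x - g x - r^2 / N * dirsum I d g'' x\<bar> \<le> r^2 / N * (e / 2)"
    "\<And>r x. 0 < r \<Longrightarrow> r < r2 \<Longrightarrow> \<bar>walk I d r (dirsum I d g'') x - dirsum I d g'' x\<bar> \<le> e / 2"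
    using walk_consistent[OF I g(1,2) e(2), where d=d] unfolding N_def by metis
  define r where "r = Min {r1 / 2, r2 / 2, sqrt (t / 2)}"
  have r: "0 < r" "r < r1" "r < r2" "r \<le> sqrt (t / 2)"
    using r1(1) r2(1) t by (auto simp: r_def min_def)
  let ?S = "walk I d r"
  have r2t: "r^2 \<le> t / 2"
    using power_mono[OF r(4), of 2] r(1) t by simp
  define k where "k = nat \<lfloor>t / r^2\<rfloor>"
  have kr: "real k * r^2 \<le> t" "t / 2 \<le> real k * r^2"
  proof -
    have r20: "0 < r^2" using r(1) by simp
    have "0 \<le> t / r^2" using t r20 by simp
    then have k: "real k \<le> t / r^2" "t / r^2 < real k + 1"
      unfolding k_def by linarith+
    show "real k * r^2 \<le> t" using k(1) r20 by (simp add: field_simps)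
    have "t < (real k + 1) * r^2" using k(2) r20 by (simp add: field_simps)
    then show "t / 2 \<le> real k * r^2" using r2t by (simp add: algebra_simps)
  qed
  have h0: "0 \<le> r^2 / N" using N by simp
  have zk: "z y \<le> (?S ^^ k) z y + (\<eta> + real k * (r^2 / N * (c + e)))" for y
  proof -
    have "z y \<le> (?S ^^ k) g y + real k * (r^2 / N * (c + e))"
      unfolding N_def
    proof (rule walk_max_principle[OF I zc z0 zR touch \<open>0 \<le> c\<close> _ g(1,3)])
      show "0 \<le> e" using e by simp
      fix x
      have "r^2 / N * \<bar>?S (dirsum I d g'') x - dirsum I d g'' x\<bar> \<le> r^2 / N * (e / 2)"
        by (intro mult_left_mono r2(3) r h0)
      then have "\<bar>r^2 / N * ?S (dirsum I d g'') x - r^2 / N * dirsum I d g'' x\<bar> \<le> r^2 / N * (e / 2)"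
        unfolding right_diff_distrib[symmetric] abs_mult abs_of_nonneg[OF h0] .
      moreover have "r^2 / N * e = r^2 / N * (e / 2) + r^2 / N * (e / 2)" by (simp add: field_simps)
      moreover have "\<bar>b - q\<bar> \<le> 2 * e" if "\<bar>b - p\<bar> \<le> e" "\<bar>q - p\<bar> \<le> e" for b p q e :: real
        using that by linarith
      ultimately have "\<bar>?S g x - g x - r^2 / N * ?S (dirsum I d g'') x\<bar> \<le> r^2 / N * e"
        using r2(2)[OF r(1,3), of x] by fastforce
      then show "\<bar>?S g x - g x - r^2 / (2 * real (card I)) * ?S (dirsum I d g'') x\<bar>
          \<le> r^2 / (2 * real (card I)) * e"
        by (simp add: N_def)
    qed
    moreover have "(?S ^^ k) g y \<le> (?S ^^ k) (\<lambda>y. z y + \<eta>) y"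
      by (intro walk_pow_mono g)
    moreover have "(?S ^^ k) (\<lambda>y. z y + \<eta>) y = (?S ^^ k) z y + \<eta>"
      by (simp add: walk_pow_add walk_pow_const[OF I])
    ultimately show ?thesis by linarith
  qed
  have fk: "f x \<le> (?S ^^ k) f x + (\<eta> + real k * (r^2 / N * (c + e)))"
    by (rule inherit[OF zk])
  \<comment> \<open>Each step moves the mean by a multiple of the mean of \<open>L f\<close>, which the quadratic bound controls.\<close>
  have up: "(?S ^^ i) f x \<le> f x + real i * (r^2 / N * (- c - 2 * a + a / 2 + e))" if "i \<le> k" for i
    using that
  proof (induction i)
    case (Suc i)
    have "?S f y \<le> f y + r^2 / N * (- c - 2 * a + e + \<kappa> * (norm (y - x))^2)" for y
    proof -
      have "?S f y \<le> f y + r^2 / N * dirsum I d f'' y + r^2 / N * e"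
        using r1(2)[OF r(1,2), of y] by linarith
      also have "r^2 / N * dirsum I d f'' y \<le> r^2 / N * (- c - 2 * a + \<kappa> * (norm (y - x))^2)"
        by (intro mult_left_mono \<kappa> h0)
      finally show ?thesis by (simp add: algebra_simps)
    qed
    then have "(?S ^^ i) (?S f) x
      \<le> (?S ^^ i) (\<lambda>y. f y + r^2 / N * (- c - 2 * a + e + \<kappa> * (norm (y - x))^2)) x"
      by (intro walk_pow_mono)
    also have "\<dots> = (?S ^^ i) f x + r^2 / N * (- c - 2 * a + e + \<kappa> * (real i * (r^2 * s)))"
      unfolding walk_pow_add walk_pow_mult walk_pow_const[OF I] walk_pow_dist_sq[OF I] s_def by simp
    also have "\<dots> \<le> (?S ^^ i) f x + r^2 / N * (- c - 2 * a + a / 2 + e)" (is "_ \<le> _ + ?D")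
    proof (intro add_left_mono mult_left_mono h0)
      have "real i * r^2 \<le> real k * r^2" using Suc.prems by (intro mult_right_mono) auto
      then have "real i * r^2 \<le> t" using kr by linarith
      then have "\<kappa> * s * (real i * r^2) \<le> \<kappa> * s * t" using ks by (intro mult_left_mono)
      then have "\<kappa> * (real i * (r^2 * s)) \<le> a / 2" using kst by (simp add: algebra_simps)
      then show "- c - 2 * a + e + \<kappa> * (real i * (r^2 * s)) \<le> - c - 2 * a + a / 2 + e" by simp
    qed
    finally have step: "(?S ^^ i) (?S f) x \<le> (?S ^^ i) f x + ?D" .
    have "(?S ^^ Suc i) f x = (?S ^^ i) (?S f) x"
      by (simp only: funpow_Suc_right o_def)
    also have "\<dots> \<le> f x + real i * ?D + ?D" using step Suc by fastforce
    also have "\<dots> = f x + real (Suc i) * ?D"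
      unfolding of_nat_Suc distrib_right mult_1 by (simp only: add_ac)
    finally show ?case .
  qed simp
  have "0 \<le> \<eta> + real k * (r^2 / N * (c + e)) + real k * (r^2 / N * (- c - 2 * a + a / 2 + e))"
    using fk up[of k] by linarith
  also have "\<dots> = \<eta> - real k * r^2 * a / N"
    using N by (simp add: e_def field_simps)
  also have "\<dots> \<le> \<eta> - t / 2 * a / N"
    using kr(2) a N by (intro diff_left_mono divide_right_mono mult_right_mono) auto
  also have "\<dots> < 0" using t a N by (simp add: \<eta>_def field_simps)
  finally show False by simp
qed

section \<open>Mollification\<close>

lemma C2_jet_compose:
  fixes f :: "'a::euclidean_space \<Rightarrow> real" and \<phi> :: "real \<Rightarrow> real"
  assumes j: "C2_jet f f' f''"
    and \<phi>: "\<And>t. (\<phi> has_real_derivative \<phi>' t) (at t)" "\<And>t. (\<phi>' has_real_derivative \<phi>'' t) (at t)"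
      "continuous_on UNIV \<phi>''"
  shows "C2_jet (\<lambda>x. \<phi> (f x)) (\<lambda>x. \<phi>' (f x) *\<^sub>R f' x)
     (\<lambda>x. \<phi>' (f x) *\<^sub>R f'' x + \<phi>'' (f x) *\<^sub>R (blinfun_scaleR_left (f' x) o\<^sub>L f' x))"
proof -
  have df: "(f has_derivative f' x) (at x)" and df': "(f' has_derivative f'' x) (at x)" for x
    using j by (auto simp: C2_jet_def)
  have cf: "continuous_on UNIV f" using C2_jet_continuous[OF j] .
  have cf': "continuous_on UNIV f'"
    using df' by (meson continuous_at_imp_continuous_on has_derivative_continuous)
  have cf'': "continuous_on UNIV f''" using j by (simp add: C2_jet_def)
  have c1: "continuous_on UNIV (\<lambda>x. \<phi>' (f x))"
    by (rule continuous_on_compose2[OF _ cf, of UNIV])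
       (auto intro!: continuous_at_imp_continuous_on DERIV_isCont \<phi>)
  have c2: "continuous_on UNIV (\<lambda>x. \<phi>'' (f x))"
    by (rule continuous_on_compose2[OF \<phi>(3) cf]) auto
  have d1: "((\<lambda>x. \<phi> (f x)) has_derivative (\<phi>' (f x) *\<^sub>R f' x)) (at x)" for x
    using has_derivative_compose[OF df \<phi>(1)[unfolded has_field_derivative_def]]
    by (rule has_derivative_eq_rhs) (simp add: scaleR_blinfun.rep_eq fun_eq_iff)
  have d\<phi>': "((\<lambda>x. \<phi>' (f x)) has_derivative (\<lambda>h. \<phi>'' (f x) * f' x h)) (at x)" for x
    using has_derivative_compose[OF df \<phi>(2)[unfolded has_field_derivative_def]] .
  have d2: "((\<lambda>x. \<phi>' (f x) *\<^sub>R f' x) has_derivative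
      (\<phi>' (f x) *\<^sub>R f'' x + \<phi>'' (f x) *\<^sub>R (blinfun_scaleR_left (f' x) o\<^sub>L f' x))) (at x)" for x
    using has_derivative_scaleR[OF d\<phi>' df']
    by (rule has_derivative_eq_rhs)
       (simp add: fun_eq_iff blinfun.add_left blinfun.scaleR_left mult.commute)
  have "continuous_on UNIV (\<lambda>x. blinfun_scaleR_left (f' x) o\<^sub>L f' x)"
    by (intro bounded_bilinear.continuous_on[OF bounded_bilinear_blinfun_compose] cf'
        bounded_linear.continuous_on[OF bounded_linear_blinfun_scaleR_left])
  then have "continuous_on UNIV
     (\<lambda>x. \<phi>' (f x) *\<^sub>R f'' x + \<phi>'' (f x) *\<^sub>R (blinfun_scaleR_left (f' x) o\<^sub>L f' x))"
    by (intro continuous_on_add continuous_on_scaleR c1 c2 cf'')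
  moreover have "f'' x h k = f'' x k h" for x h k using j by (simp add: C2_jet_def)
  ultimately show ?thesis
    unfolding C2_jet_def using d1 d2
    by (simp add: blinfun.add_left blinfun.scaleR_left mult.commute)
qed

lemma DERIV_pos_part_power:
  "((\<lambda>t::real. max 0 t ^ Suc (Suc n)) has_real_derivative real (Suc (Suc n)) * max 0 t ^ Suc n) (at t)"
proof (cases t "0::real" rule: linorder_cases)
  case greater
  have "((\<lambda>t. t ^ Suc (Suc n)) has_real_derivative real (Suc (Suc n)) * max 0 t ^ Suc n) (at t)"
    using greater DERIV_pow[of "Suc (Suc n)" t] by (simp add: max_def)
  then show ?thesis
    by (rule has_field_derivative_transform_within_open[where S="{0<..}"]) (use greater in auto)
next
  case less
  have "((\<lambda>t. 0) has_real_derivative real (Suc (Suc n)) * max 0 t ^ Suc n) (at t)"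
    using less by (auto simp: max_def)
  then show ?thesis
    by (rule has_field_derivative_transform_within_open[where S="{..<0}"]) (use less in auto)
next
  case equal
  have "((\<lambda>y::real. max 0 y ^ Suc n) \<longlongrightarrow> max 0 0 ^ Suc n) (at 0)"
    by (intro tendsto_intros)
  then have "((\<lambda>y::real. (max 0 y ^ Suc (Suc n) - max 0 0 ^ Suc (Suc n)) / (y - 0)) \<longlongrightarrow> 0) (at 0)"
    by (auto simp: max_def eventually_at_filter elim!: Lim_transform_eventually)
  then show ?thesis
    by (simp add: has_field_derivative_iff equal)
qed

lemma integrable_compact_support:
  fixes f :: "'a::euclidean_space \<Rightarrow> real"
  assumes "continuous_on UNIV f" "\<And>x. R < norm x \<Longrightarrow> f x = 0"
  shows "integrable lborel f"
proof -
  have "integrable lborel (\<lambda>x. indicator (cball 0 R) x *\<^sub>R f x)"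
    by (intro borel_integrable_compact continuous_on_subset[OF assms(1)]) auto
  moreover have "(\<lambda>x. indicator (cball 0 R) x *\<^sub>R f x) = f"
    using assms(2) by (auto simp: indicator_def fun_eq_iff not_le)
  ultimately show ?thesis by simp
qed

lemma integral_compact_support:
  fixes f :: "'a::euclidean_space \<Rightarrow> real"
  assumes "continuous_on UNIV f" "\<And>x. R < norm x \<Longrightarrow> f x = 0" "cball 0 R \<subseteq> cbox a b"
  shows "(\<integral>x. f x \<partial>lborel) = integral (cbox a b) f"
proof -
  have "(\<integral>x. f x \<partial>lborel) = integral UNIV f"
    using integral_lborel[OF integrable_compact_support[OF assms(1,2)]] by simp
  also have "\<dots> = integral UNIV (\<lambda>x. if x \<in> cbox a b then f x else 0)"
    by (rule arg_cong[of _ _ "integral UNIV"]) (use assms in \<open>force simp: fun_eq_iff\<close>)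
  also have "\<dots> = integral (cbox a b) f" by (rule integral_restrict_UNIV)
  finally show ?thesis .
qed

lemma uniformly_continuous_compact_support:
  fixes f :: "'a::euclidean_space \<Rightarrow> 'b::real_normed_vector"
  assumes "continuous_on UNIV f" "\<And>x. R < norm x \<Longrightarrow> f x = 0"
  shows "isUCont f"
  unfolding uniformly_continuous_on_def
proof (intro allI impI)
  fix e :: real assume e: "0 < e"
  have "uniformly_continuous_on (cball 0 (R + 1)) f"
    by (intro compact_uniformly_continuous continuous_on_subset[OF assms(1)]) auto
  then obtain \<delta> where \<delta>: "0 < \<delta>" "\<And>x y. norm x \<le> R + 1 \<Longrightarrow> norm y \<le> R + 1 \<Longrightarrow> dist y x < \<delta> \<Longrightarrow> dist (f y) (f x) < e"
    unfolding uniformly_continuous_on_def using e by (force simp: dist_norm)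
  have "dist (f y) (f x) < e" if "dist y x < min \<delta> 1" for x y
  proof (cases "norm x \<le> R + 1 \<and> norm y \<le> R + 1")
    case True
    then show ?thesis using \<delta> that by auto
  next
    case False
    have "norm x \<le> norm y + dist y x" "norm y \<le> norm x + dist y x"
      using norm_triangle_ineq2[of x y] norm_triangle_ineq2[of y x] by (auto simp: dist_norm norm_minus_commute)
    then have "R < norm x" "R < norm y" using False that by auto
    then show ?thesis using assms(2) e by simp
  qed
  then show "\<exists>d>0. \<forall>x\<in>UNIV. \<forall>x'\<in>UNIV. dist x' x < d \<longrightarrow> dist (f x') (f x) < e"
    using \<delta>(1) by (intro exI[of _ "min \<delta> 1"]) auto
qed

lemma bounded_compact_support:
  fixes f :: "'a::euclidean_space \<Rightarrow> 'b::real_normed_vector"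
  assumes "continuous_on UNIV f" "\<And>x. R < norm x \<Longrightarrow> f x = 0"
  obtains B where "0 < B" "\<And>x. norm (f x) \<le> B"
proof -
  have "bounded (f ` cball 0 R)"
    by (intro compact_imp_bounded compact_continuous_image continuous_on_subset[OF assms(1)]) auto
  then obtain B where "0 < B" "\<And>x. norm x \<le> R \<Longrightarrow> norm (f x) \<le> B"
    by (auto simp: bounded_pos)
  then have "norm (f x) \<le> B" for x using assms(2)[of x] by (cases "norm x \<le> R") auto
  then show thesis using that \<open>0 < B\<close> by blast
qed

text \<open>The kernel and its second derivative are required to vanish outside the ball of radius \<open>s\<close>; the latter
makes the second derivative of a mollification bounded and uniformly continuous.\<close>

definition mollify_kernel ::
  "real \<Rightarrow> ('a::euclidean_space \<Rightarrow> real) \<Rightarrow> ('a \<Rightarrow> 'a \<Rightarrow>\<^sub>L real) \<Rightarrow> ('a \<Rightarrow> 'a \<Rightarrow>\<^sub>L 'a \<Rightarrow>\<^sub>L real) \<Rightarrow> bool" where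
  "mollify_kernel s \<rho> \<rho>' \<rho>'' \<longleftrightarrow> C2_jet \<rho> \<rho>' \<rho>'' \<and> (\<forall>y. 0 \<le> \<rho> y) \<and>
     (\<forall>y. s < norm y \<longrightarrow> \<rho> y = 0 \<and> \<rho>'' y = 0) \<and> (\<integral>y. \<rho> y \<partial>lborel) = 1"

text \<open>The cube of the positive part of \<open>s\<^sup>2 - |y|\<^sup>2\<close> is of class \<open>C\<^sup>2\<close>, and no smaller integer power is.\<close>

lemma mollify_kernel_exists:
  assumes "0 < s"
  obtains \<rho> :: "'a::euclidean_space \<Rightarrow> real" and \<rho>' \<rho>'' where "mollify_kernel s \<rho> \<rho>' \<rho>''"
proof -
  define q where "q y = -1 * (norm (y - 0))^2 + s^2" for y :: 'a
  obtain p' p'' where "C2_jet (\<lambda>y::'a. -1 * (norm (y - 0))^2) p' p''"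
    using C2_jet_dist_sq[of "-1" 0] by metis
  from C2_jet_add[OF this C2_jet_const[of "s^2"]] obtain q' q'' where q: "C2_jet q q' q''"
    unfolding q_def by blast
  define b where "b y = max 0 (q y) ^ 3" for y
  define b' where "b' y = (3 * max 0 (q y) ^ 2) *\<^sub>R q' y" for y
  define b'' where "b'' y = (3 * max 0 (q y) ^ 2) *\<^sub>R q'' y + (6 * max 0 (q y)) *\<^sub>R (blinfun_scaleR_left (q' y) o\<^sub>L q' y)" for y
  have b: "C2_jet b b' b''"
    unfolding b_def b'_def b''_def
  proof (rule C2_jet_compose[OF q])
    show "((\<lambda>t. max 0 t ^ 3) has_real_derivative 3 * (max 0 t)^2) (at t)" for t :: real
      using DERIV_pos_part_power[of 1 t] by (simp add: numeral_eq_Suc)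
    show "((\<lambda>t. 3 * (max 0 t)^2) has_real_derivative 6 * max 0 t) (at t)" for t :: real
      using DERIV_cmult[OF DERIV_pos_part_power[of 0 t], of 3] by (simp add: numeral_eq_Suc)
    show "continuous_on UNIV (\<lambda>t::real. 6 * max 0 t)" by (intro continuous_intros)
  qed
  have q0: "q y \<le> 0" if "s < norm y" for y
    using power_mono[of s "norm y" 2] that assms by (simp add: q_def)
  have b0: "b y = 0 \<and> b'' y = 0" if "s < norm y" for y
    using q0[OF that] by (simp add: b_def b''_def max_def)
  have bnn: "0 \<le> b y" for y by (simp add: b_def)
  have bc: "continuous_on S b" for S by (rule C2_jet_continuous[OF b])
  define C where "C = (\<integral>y. b y \<partial>lborel)"
  obtain u where u: "cball (0::'a) s \<subseteq> cbox (- u) u"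
    using bounded_subset_cbox_symmetric[OF bounded_cball] by blast
  have Ci: "C = integral (cbox (- u) u) b"
    unfolding C_def using b0 by (intro integral_compact_support[OF bc _ u]) auto
  have "0 \<le> C" unfolding C_def using bnn by (intro integral_nonneg_AE) auto
  moreover have "C \<noteq> 0"
  proof
    assume "C = 0"
    have "(b has_integral 0) (cbox (- u) u)"
      using Ci \<open>C = 0\<close> integrable_integral[OF integrable_continuous[OF bc]] by metis
    moreover have "ball 0 s \<subseteq> interior (cbox (- u) u)"
      using u by (intro interior_maximal) auto
    then have "(0::'a) \<in> box (- u) u" using assms by (auto simp: interior_cbox)
    ultimately have "b 0 = 0"
      using bnn by (intro has_integral_0_cbox_imp_0[of "- u" u b]) (auto intro: bc box_subset_cbox[THEN subsetD])
    then show False using assms by (simp add: b_def q_def)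
  qed
  ultimately have C: "0 < C" by simp
  have "mollify_kernel s (\<lambda>y. (1 / C) * b y) (\<lambda>y. (1 / C) *\<^sub>R b' y) (\<lambda>y. (1 / C) *\<^sub>R b'' y)"
    unfolding mollify_kernel_def using C2_jet_scaleR[OF b, of "1 / C"] b0 bnn C
    by (auto simp: C_def)
  then show thesis by (rule that)
qed

definition mollify :: "('a::euclidean_space \<Rightarrow> real) \<Rightarrow> ('a \<Rightarrow> real) \<Rightarrow> 'a \<Rightarrow> real" where
  "mollify \<rho> f x = (\<integral>y. \<rho> y * f (x - y) \<partial>lborel)"

text \<open>With the kernel evaluated at \<open>y\<close> the mollification visibly commutes with translations and averages;
with the kernel evaluated at \<open>x - y\<close> it can be differentiated under the integral sign.\<close>

lemma mollify_swap:
  assumes "continuous_on UNIV f" "continuous_on UNIV \<rho>"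
  shows "mollify \<rho> f x = (\<integral>y. f y * \<rho> (x - y) \<partial>lborel)"
proof -
  have m: "(\<lambda>y. f y * \<rho> (x - y)) \<in> borel_measurable borel"
    by (intro borel_measurable_continuous_onI continuous_intros assms continuous_on_compose2[OF assms(2)]) auto
  have L: "(lborel::'a measure) = distr lborel borel (\<lambda>y. x - y)"
    using lborel_affine[of "-1::real" x] by (simp add: density_1)
  have "(\<integral>y. f y * \<rho> (x - y) \<partial>lborel) = (\<integral>y. f (x - y) * \<rho> (x - (x - y)) \<partial>lborel)"
    by (subst L, subst integral_distr) (use m in auto)
  then show ?thesis by (simp add: mollify_def mult.commute)
qed

lemma mollify_C2_jet:
  fixes f :: "'a::euclidean_space \<Rightarrow> real"
  assumes K: "mollify_kernel s \<rho> \<rho>' \<rho>''"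
    and f: "continuous_on UNIV f" "\<And>x. R < norm x \<Longrightarrow> f x = 0"
  obtains g' g'' where "C2_jet (mollify \<rho> f) g' g''" "isUCont g''" "bounded (range g'')"
proof -
  have j: "C2_jet \<rho> \<rho>' \<rho>''" and \<rho>''0: "\<And>y. s < norm y \<Longrightarrow> \<rho>'' y = 0"
    using K by (auto simp: mollify_kernel_def)
  have d: "(\<rho> has_derivative \<rho>' x) (at x)" and d': "(\<rho>' has_derivative \<rho>'' x) (at x)"
    and c'': "continuous_on UNIV \<rho>''" and sym: "\<rho>'' x h k = \<rho>'' x k h" for x h k
    using j by (auto simp: C2_jet_def)
  have c: "continuous_on UNIV \<rho>" using C2_jet_continuous[OF j] .
  have c': "continuous_on UNIV \<rho>'"
    using d' by (meson continuous_at_imp_continuous_on has_derivative_continuous)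
  obtain M where M: "0 < M" "\<And>x. norm (f x) \<le> M" using bounded_compact_support[of f R] f by blast
  obtain B where B: "0 < B" "\<And>x. norm (\<rho>'' x) \<le> B" using bounded_compact_support[of \<rho>'' s] c'' \<rho>''0 by blast
  obtain u where u: "cball (0::'a) R \<subseteq> cbox (- u) u"
    using bounded_subset_cbox_symmetric[OF bounded_cball] by blast
  let ?B = "cbox (- u) u"
  have fc: "continuous_on S f" for S using f(1) continuous_on_subset by blast
  have fp: "continuous_on S (\<lambda>p. f (snd p))" for S :: "('a \<times> 'a) set"
    by (rule continuous_on_compose2[OF f(1)]) (auto intro!: continuous_intros)
  define g' where "g' x = integral (?B) (\<lambda>y. f y *\<^sub>R \<rho>' (x - y))" for x
  define g'' where "g'' x = integral (?B) (\<lambda>y. f y *\<^sub>R \<rho>'' (x - y))" for x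
  have mol: "mollify \<rho> f x = integral (?B) (\<lambda>y. f y * \<rho> (x - y))" for x
    unfolding mollify_swap[OF f(1) c]
  proof (rule integral_compact_support[OF _ _ u])
    show "continuous_on UNIV (\<lambda>y. f y * \<rho> (x - y))"
      by (intro continuous_intros fc continuous_on_compose2[OF c]) auto
  qed (use f(2) in auto)
  have int: "(\<lambda>y. f y *\<^sub>R \<rho>'' (x - y)) integrable_on ?B" for x
    by (intro integrable_continuous continuous_intros fc continuous_on_compose2[OF c'']) auto
  have shift: "((\<lambda>x. x - y) has_derivative (\<lambda>h. h)) (at x)" for x y :: 'a
    using has_derivative_diff[OF has_derivative_ident has_derivative_const[of y]] by simp
  have D1: "(mollify \<rho> f has_derivative g' x) (at x)" for x
  proof -
    have "((\<lambda>x. integral (?B) (\<lambda>y. f y * \<rho> (x - y))) has_derivative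
       integral (?B) (\<lambda>y. f y *\<^sub>R \<rho>' (x - y))) (at x within UNIV)"
    proof (rule leibniz_rule)
      fix x y :: 'a
      show "((\<lambda>x. f y * \<rho> (x - y)) has_derivative blinfun_apply (f y *\<^sub>R \<rho>' (x - y))) (at x within UNIV)"
        using has_derivative_mult_right[OF has_derivative_compose[OF shift d], where x="f y"]
        by (simp add: scaleR_blinfun.rep_eq)
      show "(\<lambda>y. f y * \<rho> (x - y)) integrable_on ?B"
        by (intro integrable_continuous continuous_intros fc continuous_on_compose2[OF c]) auto
      show "continuous_on (UNIV \<times> ?B) (\<lambda>(x, y). f y *\<^sub>R \<rho>' (x - y))"
        unfolding split_beta
        by (intro continuous_intros fp continuous_on_compose2[OF c']) auto
    qed auto
    then show ?thesis by (simp add: mol[abs_def] g'_def)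
  qed
  have D2: "(g' has_derivative g'' x) (at x)" for x
  proof -
    have "((\<lambda>x. integral (?B) (\<lambda>y. f y *\<^sub>R \<rho>' (x - y))) has_derivative
       integral (?B) (\<lambda>y. f y *\<^sub>R \<rho>'' (x - y))) (at x within UNIV)"
    proof (rule leibniz_rule)
      fix x y :: 'a
      show "((\<lambda>x. f y *\<^sub>R \<rho>' (x - y)) has_derivative blinfun_apply (f y *\<^sub>R \<rho>'' (x - y))) (at x within UNIV)"
        using has_derivative_scaleR_right[OF has_derivative_compose[OF shift d'], where r="f y"]
        by (simp add: scaleR_blinfun.rep_eq)
      show "(\<lambda>y. f y *\<^sub>R \<rho>' (x - y)) integrable_on ?B"
        by (intro integrable_continuous continuous_intros fc continuous_on_compose2[OF c']) auto
      show "continuous_on (UNIV \<times> ?B) (\<lambda>(x, y). f y *\<^sub>R \<rho>'' (x - y))"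
        unfolding split_beta
        by (intro continuous_intros fp continuous_on_compose2[OF c'']) auto
    qed auto
    then show ?thesis by (simp add: g'_def[abs_def] g''_def)
  qed
  have apply2: "g'' x h k = integral (?B) (\<lambda>y. f y * \<rho>'' (x - y) h k)" for x h k
  proof -
    have "bounded_linear (\<lambda>B::'a \<Rightarrow>\<^sub>L 'a \<Rightarrow>\<^sub>L real. B h k)"
      by (intro bounded_linear_compose[OF blinfun.bounded_linear_left blinfun.bounded_linear_left])
    from integral_linear[OF int this, of x] show ?thesis
      by (simp add: g''_def o_def blinfun.scaleR_left)
  qed
  have uc: "isUCont g''"
    unfolding uniformly_continuous_on_def
  proof (intro allI impI)
    fix e :: real assume e: "0 < e"
    define V where "V = M * (measure lborel (?B) + 1)"
    have V: "0 < V" unfolding V_def using M(1) measure_nonneg[of lborel "?B"]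
      by (intro mult_pos_pos) linarith+
    have e': "0 < e / (2 * V)" using e V by simp
    have "\<exists>\<delta>>0. \<forall>x\<in>UNIV. \<forall>y\<in>UNIV. dist y x < \<delta> \<longrightarrow> dist (\<rho>'' y) (\<rho>'' x) < e / (2 * V)"
      using uniformly_continuous_compact_support[of \<rho>'' s] c'' \<rho>''0 e'
      unfolding uniformly_continuous_on_def by blast
    then obtain \<delta> where \<delta>: "0 < \<delta>" "\<And>x y. dist y x < \<delta> \<Longrightarrow> dist (\<rho>'' y) (\<rho>'' x) < e / (2 * V)"
      by auto
    have "dist (g'' y) (g'' x) < e" if xy: "dist y x < \<delta>" for x y
    proof -
      have "((\<lambda>t. f t *\<^sub>R \<rho>'' (y - t) - f t *\<^sub>R \<rho>'' (x - t)) has_integral (g'' y - g'' x)) (?B)"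
        unfolding g''_def by (intro has_integral_diff integrable_integral int)
      then have "norm (g'' y - g'' x) \<le> (M * (e / (2 * V))) * measure lborel (?B)"
      proof (rule has_integral_bound[rotated])
        fix t
        have "dist (\<rho>'' (y - t)) (\<rho>'' (x - t)) < e / (2 * V)" using xy by (intro \<delta>) (simp add: dist_norm)
        then have "norm (f t) * norm (\<rho>'' (y - t) - \<rho>'' (x - t)) \<le> M * (e / (2 * V))"
          using M(2)[of t] M(1) by (intro mult_mono) (auto simp: dist_norm)
        then show "norm (f t *\<^sub>R \<rho>'' (y - t) - f t *\<^sub>R \<rho>'' (x - t)) \<le> M * (e / (2 * V))"
          by (simp only: norm_scaleR real_norm_def flip: scaleR_right_diff_distrib)
      qed (use M(1) e V in simp)
      also have "\<dots> \<le> (M * (e / (2 * V))) * (measure lborel (?B) + 1)"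
        using M e V by (intro mult_left_mono) auto
      also have "\<dots> = V * (e / (2 * V))" by (simp add: V_def)
      also have "\<dots> < e" using V e by simp
      finally show ?thesis by (simp add: dist_norm)
    qed
    then show "\<exists>d>0. \<forall>x\<in>UNIV. \<forall>x'\<in>UNIV. dist x' x < d \<longrightarrow> dist (g'' x') (g'' x) < e"
      using \<delta>(1) by blast
  qed
  have bd: "norm (g'' x) \<le> (M * B) * measure lborel (?B)" for x
  proof (rule has_integral_bound)
    show "((\<lambda>t. f t *\<^sub>R \<rho>'' (x - t)) has_integral g'' x) (?B)"
      unfolding g''_def by (intro integrable_integral int)
    show "0 \<le> M * B" using M(1) B(1) by simp
    show "norm (f t *\<^sub>R \<rho>'' (x - t)) \<le> M * B" for t
      unfolding norm_scaleR using M(2)[of t] B(2)[of "x - t"] M(1) by (intro mult_mono) auto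
  qed
  have "C2_jet (mollify \<rho> f) g' g''"
    unfolding C2_jet_def
    using D1 D2 uniformly_continuous_imp_continuous[OF uc] by (auto simp: apply2 sym)
  moreover have "bounded (range g'')" using bd by (auto simp: bounded_iff)
  ultimately show thesis using uc that by blast
qed

lemma walk_continuous:
  fixes f :: "'a::euclidean_space \<Rightarrow> real"
  assumes "continuous_on UNIV f" shows "continuous_on UNIV ((walk I d r ^^ k) f)"
proof (induction k)
  case (Suc k)
  have "continuous_on UNIV (walk I d r g)" if "continuous_on UNIV g" for g :: "'a \<Rightarrow> real"
    unfolding walk_def[abs_def]
    by (intro continuous_intros continuous_on_compose2[OF that]) auto
  from this[OF Suc] show ?case by simp
qed (use assms in simp)

context
  fixes s :: real and \<rho> :: "'a::euclidean_space \<Rightarrow> real" and \<rho>' \<rho>''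
  assumes K: "mollify_kernel s \<rho> \<rho>' \<rho>''"
begin

lemma kernel_cont: "continuous_on S \<rho>"
  using K C2_jet_continuous by (auto simp: mollify_kernel_def)

lemma kernel_nonneg: "0 \<le> \<rho> y" and kernel_zero: "s < norm y \<Longrightarrow> \<rho> y = 0"
  and kernel_integral: "(\<integral>y. \<rho> y \<partial>lborel) = 1"
  using K by (auto simp: mollify_kernel_def)

lemma kernel_mult_integrable:
  assumes "continuous_on UNIV f" shows "integrable lborel (\<lambda>y. \<rho> y * f y)"
  by (rule integrable_compact_support[where R=s]) (auto intro!: continuous_intros kernel_cont assms simp: kernel_zero)

lemma mollify_integrable:
  assumes "continuous_on UNIV f" shows "integrable lborel (\<lambda>y. \<rho> y * f (x - y))"
  by (rule kernel_mult_integrable) (auto intro!: continuous_intros continuous_on_compose2[OF assms])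

lemma mollify_mono:
  assumes "continuous_on UNIV f" "continuous_on UNIV g" "\<And>y. norm y \<le> s \<Longrightarrow> f (x - y) \<le> g (x - y)"
  shows "mollify \<rho> f x \<le> mollify \<rho> g x"
  unfolding mollify_def
proof (rule integral_mono[OF mollify_integrable[OF assms(1)] mollify_integrable[OF assms(2)]])
  show "\<rho> y * f (x - y) \<le> \<rho> y * g (x - y)" for y
    using assms(3)[of y] kernel_nonneg[of y] kernel_zero[of y]
    by (cases "norm y \<le> s") (auto intro: mult_left_mono)
qed

lemma mollify_add:
  assumes "continuous_on UNIV f" "continuous_on UNIV g"
  shows "mollify \<rho> (\<lambda>x. f x + g x) x = mollify \<rho> f x + mollify \<rho> g x"
  unfolding mollify_def distrib_left
  by (rule Bochner_Integration.integral_add[OF mollify_integrable mollify_integrable]) (rule assms)+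

lemma mollify_scale: "mollify \<rho> (\<lambda>x. c * f x) x = c * mollify \<rho> f x"
  by (simp add: mollify_def mult.left_commute)

lemma mollify_const: "mollify \<rho> (\<lambda>_. c) x = c"
  by (simp add: mollify_def kernel_integral)

lemma mollify_translate: "mollify \<rho> (\<lambda>x. f (x + a)) x = mollify \<rho> f (x + a)"
  by (simp add: mollify_def algebra_simps)

lemma mollify_sum:
  assumes "finite I" "\<And>i. i \<in> I \<Longrightarrow> continuous_on UNIV (f i)"
  shows "mollify \<rho> (\<lambda>x. \<Sum>i\<in>I. f i x) x = (\<Sum>i\<in>I. mollify \<rho> (f i) x)"
  using assms
proof (induction I rule: finite_induct)
  case (insert i I)
  then show ?case by (simp add: mollify_add continuous_on_sum)
qed (simp add: mollify_const)

lemma mollify_close: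
  assumes "continuous_on UNIV f" "\<And>y. norm y \<le> s \<Longrightarrow> \<bar>f (x - y) - f x\<bar> \<le> e"
  shows "\<bar>mollify \<rho> f x - f x\<bar> \<le> e"
proof -
  have "mollify \<rho> f x \<le> mollify \<rho> (\<lambda>_. f x + e) x"
    using assms(2) by (intro mollify_mono assms continuous_intros) (auto simp: abs_le_iff algebra_simps)
  moreover have "mollify \<rho> (\<lambda>_. f x - e) x \<le> mollify \<rho> f x"
    using assms(2) by (intro mollify_mono assms continuous_intros) (auto simp: abs_le_iff algebra_simps)
  ultimately show ?thesis by (auto simp: mollify_const abs_le_iff)
qed

lemma mollify_walk:
  assumes "finite I" "continuous_on UNIV f"
  shows "mollify \<rho> (walk I d r f) x = walk I d r (mollify \<rho> f) x"
proof -
  have c: "continuous_on UNIV (\<lambda>x. f (x + a))" for a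
    by (intro continuous_intros continuous_on_compose2[OF assms(2)]) auto
  have "mollify \<rho> (walk I d r f) x
    = mollify \<rho> (\<lambda>x. (1 / (2 * real (card I))) * (\<Sum>i\<in>I. f (x + r *\<^sub>R d i) + f (x + - (r *\<^sub>R d i)))) x"
    by (simp add: walk_def[abs_def])
  also have "\<dots> = (1 / (2 * real (card I))) * (\<Sum>i\<in>I. mollify \<rho> f (x + r *\<^sub>R d i) + mollify \<rho> f (x + - (r *\<^sub>R d i)))"
    by (simp only: mollify_scale mollify_sum[OF assms(1)] mollify_add c continuous_on_add mollify_translate)
  finally show ?thesis by (simp add: walk_def)
qed

lemma mollify_walk_pow:
  assumes "finite I" "continuous_on UNIV f"
  shows "mollify \<rho> ((walk I d r ^^ k) f) x = (walk I d r ^^ k) (mollify \<rho> f) x"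
proof (induction k arbitrary: x)
  case (Suc k)
  then have "mollify \<rho> ((walk I d r ^^ k) f) = (walk I d r ^^ k) (mollify \<rho> f)" by auto
  then show ?case by (simp add: mollify_walk[OF assms(1)] walk_continuous assms)
qed simp

end

lemma smooth_approx:
  fixes z :: "'a::euclidean_space \<Rightarrow> real"
  assumes zc: "continuous_on UNIV z" and zR: "\<And>x. R < norm x \<Longrightarrow> z x = 0" and "0 < \<eta>"
  shows "\<exists>g g' g''. C2_jet g g' g'' \<and> isUCont g'' \<and> (\<forall>x. z x \<le> g x \<and> g x \<le> z x + \<eta>)"
proof -
  obtain \<delta> where \<delta>: "0 < \<delta>" "\<And>x y. dist y x < \<delta> \<Longrightarrow> dist (z y) (z x) < \<eta> / 2"
    using uniformly_continuous_compact_support[of z R] zc zR half_gt_zero[OF \<open>0 < \<eta>\<close>]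
    unfolding uniformly_continuous_on_def by blast
  obtain \<rho> :: "'a \<Rightarrow> real" and \<rho>' \<rho>'' where K: "mollify_kernel (\<delta> / 2) \<rho> \<rho>' \<rho>''"
    using mollify_kernel_exists[of "\<delta> / 2"] \<delta>(1) by auto
  obtain g' g'' where g: "C2_jet (mollify \<rho> z) g' g''" "isUCont g''"
    using mollify_C2_jet[of _ _ _ _ z R] K zc zR by metis
  have close: "\<bar>mollify \<rho> z x - z x\<bar> \<le> \<eta> / 2" for x
  proof (rule mollify_close[OF K zc])
    fix y :: 'a assume "norm y \<le> \<delta> / 2"
    then have "dist (z (x - y)) (z x) < \<eta> / 2" using \<delta> by (intro \<delta>(2)) (simp add: dist_norm)
    then show "\<bar>z (x - y) - z x\<bar> \<le> \<eta> / 2" by (simp add: dist_real_def)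
  qed
  have "C2_jet (\<lambda>x. mollify \<rho> z x + \<eta> / 2) (\<lambda>x. g' x + 0) (\<lambda>x. g'' x + 0)"
    by (rule C2_jet_add[OF g(1) C2_jet_const])
  moreover have "z x \<le> mollify \<rho> z x + \<eta> / 2 \<and> mollify \<rho> z x + \<eta> / 2 \<le> z x + \<eta>" for x
    using close[of x] unfolding abs_le_iff by linarith
  ultimately show ?thesis using g(2)
    by (intro exI[of _ "\<lambda>x. mollify \<rho> z x + \<eta> / 2"] exI[of _ g'] exI[of _ g'']) auto
qed

context
  fixes s :: real and \<rho> :: "'a::euclidean_space \<Rightarrow> real" and \<rho>' \<rho>''
  assumes K: "mollify_kernel s \<rho> \<rho>' \<rho>''"
begin

text \<open>Mollification turns a viscosity subsolution of a constant-coefficient equation into a classical one,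
because it commutes with the random walk and preserves inequalities and constants.\<close>

lemma mollify_subsolution:
  fixes z :: "'a \<Rightarrow> real"
  assumes I: "finite I" "I \<noteq> {}"
    and zc: "continuous_on UNIV z" and z0: "\<And>x. 0 \<le> z x" and zR: "\<And>x. R < norm x \<Longrightarrow> z x = 0"
    and touch: "\<And>\<phi> \<phi>' \<phi>'' x. C2_jet \<phi> \<phi>' \<phi>'' \<Longrightarrow> (\<And>y. z y \<le> \<phi> y) \<Longrightarrow> z x = \<phi> x \<Longrightarrow> 0 < z x
       \<Longrightarrow> - c \<le> dirsum I d \<phi>'' x"
    and "0 \<le> c" and j: "C2_jet (mollify \<rho> z) g' g''"
    and uc: "isUCont g''" and bd: "bounded (range g'')"
  shows "- c \<le> dirsum I d g'' x"
proof (rule averaged_subsolution[OF I zc z0 zR touch \<open>0 \<le> c\<close> _ j uc bd])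
  fix r k \<tau> x assume le: "\<And>x. z x \<le> (walk I d r ^^ k) z x + \<tau>"
  have "mollify \<rho> z x \<le> mollify \<rho> (\<lambda>x. (walk I d r ^^ k) z x + \<tau>) x"
    by (intro mollify_mono[OF K] zc continuous_intros walk_continuous le)
  also have "\<dots> = (walk I d r ^^ k) (mollify \<rho> z) x + \<tau>"
    by (simp add: mollify_add[OF K] walk_continuous zc continuous_on_const mollify_const[OF K] mollify_walk_pow[OF K I(1) zc])
  finally show "mollify \<rho> z x \<le> (walk I d r ^^ k) (mollify \<rho> z) x + \<tau>" .
qed (use smooth_approx[OF zc zR] in blast)+

end

section \<open>Quaternionic matrices and the spectral theorem\<close>

lemma qcnj_simps [simp]:
  "qcnj 0 = 0" "qcnj 1 = 1" "qcnj (qcnj a) = a" "qcnj (a + b) = qcnj a + qcnj b"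
  "qcnj (a * b) = qcnj b * qcnj a" "qcnj (r *\<^sub>R a) = r *\<^sub>R qcnj a"
  by (simp_all add: quat_eq_iff algebra_simps)

lemma qcnj_sum: "qcnj (sum f A) = (\<Sum>i\<in>A. qcnj (f i))"
  by (induction A rule: infinite_finite_induct) auto

lemma of_real_quat_sel [simp]:
  "qRe (of_real r) = r" "qIm1 (of_real r) = 0" "qIm2 (of_real r) = 0" "qIm3 (of_real r) = 0"
  by (simp_all add: of_real_def)

lemma qcnj_of_real [simp]: "qcnj (of_real r) = of_real r"
  by (simp add: of_real_def)

lemma qRe_sum: "qRe (sum f A) = (\<Sum>i\<in>A. qRe (f i))"
  by (induction A rule: infinite_finite_induct) auto

lemma quat_inner_mult_left: "inner (a * b) c = inner b (qcnj a * c)" for a b c :: quat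
  by (simp add: inner_quat_def algebra_simps)

lemma qRe_qcnj_mult: "qRe (qcnj a * b) = inner a b"
  by (simp add: inner_quat_def)

lemma quat_norm_mult: "norm (a * b) = norm a * norm b" for a b :: quat
proof -
  have "inner (a * b) (a * b) = inner a a * inner b b"
    unfolding inner_quat_def times_quat.sel by algebra
  then show ?thesis by (simp add: norm_quat_def real_sqrt_mult)
qed

lemma quat_norm_qcnj [simp]: "norm (qcnj a) = norm a"
  by (simp add: norm_quat_def inner_quat_def)

lemma sum_quat_Basis: "(\<Sum>g\<in>Basis. f g) = f 1 + f \<i>\<^sub>H + f \<j>\<^sub>H + f \<k>\<^sub>H"
  for f :: "quat \<Rightarrow> 'b::ab_group_add"
proof -
  have "1 \<noteq> \<i>\<^sub>H" "1 \<noteq> \<j>\<^sub>H" "1 \<noteq> \<k>\<^sub>H" "\<i>\<^sub>H \<noteq> \<j>\<^sub>H" "\<i>\<^sub>H \<noteq> \<k>\<^sub>H" "\<j>\<^sub>H \<noteq> \<k>\<^sub>H"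
    by (simp_all add: quat_eq_iff)
  then show ?thesis by (simp add: Basis_quat_def add.assoc)
qed

lemma DIM_quat: "DIM(quat) = 4"
  using sum_quat_Basis[of "\<lambda>_. 1::real"] by simp

lemma qadjoint_inner: "inner X (A *v Y) = inner (qadjoint A *v X) Y"
proof -
  have "inner X (A *v Y) = (\<Sum>i\<in>UNIV. \<Sum>j\<in>UNIV. inner (X $ i) (A $ i $ j * Y $ j))"
    by (simp add: inner_vec_def matrix_vector_mult_def inner_sum_right)
  also have "\<dots> = (\<Sum>i\<in>UNIV. \<Sum>j\<in>UNIV. inner (qcnj (A $ i $ j) * X $ i) (Y $ j))"
    by (simp add: quat_inner_mult_left)
  also have "\<dots> = (\<Sum>j\<in>UNIV. \<Sum>i\<in>UNIV. inner (qcnj (A $ i $ j) * X $ i) (Y $ j))"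
    by (rule sum.swap)
  also have "\<dots> = inner (qadjoint A *v X) Y"
    by (simp add: inner_vec_def matrix_vector_mult_def inner_sum_left qadjoint_def)
  finally show ?thesis .
qed

lemma hyperhermitian_inner:
  "hyperhermitian A \<Longrightarrow> inner X (A *v Y) = inner (A *v X) Y"
  by (simp add: qadjoint_inner hyperhermitian_def)

lemma hyperhermitian_nonneg_iff:
  "hyperhermitian_nonneg A \<longleftrightarrow> hyperhermitian A \<and> (\<forall>X. 0 \<le> inner X (A *v X))"
proof -
  have "qRe (\<Sum>j\<in>UNIV. \<Sum>k\<in>UNIV. qcnj (X $ j) * A $ j $ k * X $ k) = inner X (A *v X)" for X
    by (simp only: qRe_sum mult.assoc qRe_qcnj_mult inner_vec_def matrix_vector_mult_def
        inner_sum_right vec_lambda_beta)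
  then show ?thesis by (simp add: hyperhermitian_nonneg_def)
qed

text \<open>Quaternionic matrices act from the left, so the scalars that commute with them act from the right.\<close>

definition rmult :: "quat^'n \<Rightarrow> quat \<Rightarrow> quat^'n" where
  "rmult X g = (\<chi> j. X $ j * g)"

definition qdot :: "quat^'n \<Rightarrow> quat^'n \<Rightarrow> quat" where
  "qdot X Y = (\<Sum>j\<in>UNIV. qcnj (X $ j) * Y $ j)"

lemma qdot_inner: "inner g (qdot X Y) = inner (rmult X g) Y"
  by (simp add: qdot_def rmult_def inner_vec_def inner_sum_right quat_inner_mult_left)

lemma qdot_commute: "qdot Y X = qcnj (qdot X Y)"
  by (simp add: qdot_def qcnj_sum)

lemma qdot_linear: "linear (qdot X)"
  by (rule linearI) (simp_all add: qdot_def sum.distrib distrib_left scaleR_sum_right)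

lemma qdot_self: "qdot X X = of_real ((norm X)^2)"
proof -
  have c: "qcnj a * a = of_real ((norm a)^2)" for a
    by (simp add: quat_eq_iff power2_norm_eq_inner) (simp add: inner_quat_def)
  show ?thesis
    unfolding qdot_def c by (simp add: norm_vec_def L2_set_def sum_nonneg)
qed

lemma mult_vec_rmult: "A *v rmult X g = rmult (A *v X) g"
  by (simp add: matrix_vector_mult_def rmult_def vec_eq_iff sum_distrib_right mult.assoc)

lemma qadjoint_qdot: "qdot X (A *v Y) = qdot (qadjoint A *v X) Y"
proof (rule inner_eq_zero_iff[THEN iffD1, THEN eq_iff_diff_eq_0[THEN iffD2]])
  let ?d = "qdot X (A *v Y) - qdot (qadjoint A *v X) Y"
  have "inner g (qdot X (A *v Y)) = inner g (qdot (qadjoint A *v X) Y)" for g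
    by (simp add: qdot_inner qadjoint_inner mult_vec_rmult)
  then show "inner ?d ?d = 0" by (simp add: inner_diff_right)
qed

lemma qadjoint_mult_nth: "(qadjoint U *v X) $ k = qdot (\<chi> j. U $ j $ k) X"
  by (simp add: matrix_vector_mult_def qadjoint_def qdot_def)

lemma qadjoint_qadjoint [simp]: "qadjoint (qadjoint A) = A"
  by (simp add: qadjoint_def vec_eq_iff)

lemma mult_axis: "A *v axis k 1 = (\<chi> j. A $ j $ k)" for A :: "quat^'n^'m"
  by (simp add: matrix_vector_mult_def axis_def vec_eq_iff if_distrib if_distribR cong: if_cong)

lemma qunitary_norm:
  assumes "qunitary U" shows "norm (U *v X) = norm X" "norm (qadjoint U *v X) = norm X"
proof -
  have "inner (U *v X) (U *v X) = inner X X"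
    using assms by (simp add: qunitary_def qadjoint_inner matrix_vector_mul_assoc)
  then show "norm (U *v X) = norm X" by (simp add: norm_eq_sqrt_inner)
  have "inner (qadjoint U *v X) (qadjoint U *v X) = inner X X"
    using assms qadjoint_inner[of "qadjoint U *v X" "qadjoint U" X]
    by (simp add: qunitary_def matrix_vector_mul_assoc)
  then show "norm (qadjoint U *v X) = norm X" by (simp add: norm_eq_sqrt_inner)
qed

abbreviation coord_sq :: "quat^'n^'n \<Rightarrow> quat^'n \<Rightarrow> 'n \<Rightarrow> real" where
  "coord_sq U X k \<equiv> (norm ((qadjoint U *v X) $ k))^2"

lemma norm_vec_sq: "(norm X)^2 = (\<Sum>k\<in>UNIV. (norm (X $ k))^2)" for X :: "quat^'n"
  by (simp add: norm_vec_def L2_set_def sum_nonneg)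

text \<open>The variational characterization of eigenvalues: the form \<open>X \<mapsto> \<langle>X, A X\<rangle>\<close> attains its maximum \<open>l\<close> over
the unit sphere of an invariant real subspace, and \<open>Z = l X - A X\<close> lies in that subspace again.
Moving from \<open>X\<close> in the direction \<open>- Z\<close> would increase the normalized form to first order unless \<open>Z = 0\<close>.\<close>

lemma constrained_max_eigenvector:
  fixes A :: "quat^'n^'n"
  assumes A: "hyperhermitian A" and W: "subspace W" "\<And>X. X \<in> W \<Longrightarrow> A *v X \<in> W"
    and w: "w \<in> W" "w \<noteq> 0"
  obtains X l where "X \<in> W" "norm X = 1" "A *v X = l *\<^sub>R X"
proof -
  have lin: "linear (\<lambda>X. A *v X)" by simp
  have "compact (sphere 0 1 \<inter> W)"
    by (intro compact_Int_closed closed_subspace W) auto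
  moreover have "(1 / norm w) *\<^sub>R w \<in> sphere 0 1 \<inter> W"
    using w W(1) by (auto simp: subspace_scale)
  then have "sphere 0 1 \<inter> W \<noteq> {}" by blast
  moreover have "continuous_on (sphere 0 1 \<inter> W) (\<lambda>X. inner X (A *v X))"
    by (intro continuous_intros linear_continuous_on) (use lin in \<open>simp add: linear_conv_bounded_linear\<close>)
  ultimately obtain X where X: "X \<in> sphere 0 1 \<inter> W"
    "\<And>Y. Y \<in> sphere 0 1 \<inter> W \<Longrightarrow> inner Y (A *v Y) \<le> inner X (A *v X)"
    using continuous_attains_sup[of "sphere 0 1 \<inter> W" "\<lambda>X. inner X (A *v X)"] by blast
  have XW: "X \<in> W" and X1: "norm X = 1" using X(1) by auto
  define l where "l = inner X (A *v X)"
  have max: "inner Y (A *v Y) \<le> l * (norm Y)^2" if "Y \<in> W" for Y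
  proof (cases "Y = 0")
    case False
    then have "inner ((1 / norm Y) *\<^sub>R Y) (A *v ((1 / norm Y) *\<^sub>R Y)) \<le> l"
      unfolding l_def by (intro X(2)) (use that W(1) in \<open>auto simp: subspace_scale\<close>)
    moreover have "inner ((1 / norm Y) *\<^sub>R Y) (A *v ((1 / norm Y) *\<^sub>R Y)) = inner Y (A *v Y) / (norm Y)^2"
      by (simp add: linear_scale[OF lin] power2_eq_square)
    ultimately have "inner Y (A *v Y) / (norm Y)^2 \<le> l" by (simp only:)
    then show ?thesis using False by (simp add: divide_le_eq)
  qed simp
  define Z where "Z = l *\<^sub>R X - A *v X"
  have ZW: "Z \<in> W" unfolding Z_def using W XW by (intro subspace_diff subspace_scale) auto
  have ge: "0 \<le> 2 * t * inner Z Z + t^2 * (l * (norm Z)^2 - inner Z (A *v Z))" for t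
  proof -
    have "X + t *\<^sub>R Z \<in> W" using W(1) XW ZW by (intro subspace_add subspace_scale)
    from max[OF this] have e1: "inner (X + t *\<^sub>R Z) (A *v (X + t *\<^sub>R Z)) \<le> l * (norm (X + t *\<^sub>R Z))^2" .
    have e2: "inner (X + t *\<^sub>R Z) (A *v (X + t *\<^sub>R Z))
      = l + 2 * t * inner Z (A *v X) + t^2 * inner Z (A *v Z)"
      using hyperhermitian_inner[OF A, of X Z]
      by (simp add: linear_add[OF lin] linear_scale[OF lin] inner_add_left inner_add_right l_def
          inner_commute power2_eq_square distrib_left mult.assoc)
    have e3: "(norm (X + t *\<^sub>R Z))^2 = 1 + 2 * t * inner Z X + t^2 * (norm Z)^2"
    proof -
      have "inner X X = 1" using X1 by (simp add: norm_eq_1)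
      then show ?thesis
        unfolding power2_norm_eq_inner
        by (simp add: inner_add_left inner_add_right inner_commute power2_eq_square distrib_left mult.assoc)
    qed
    have e4: "inner Z Z = l * inner Z X - inner Z (A *v X)"
      by (simp add: Z_def inner_diff_left inner_diff_right)
    have "l * (1 + 2 * t * inner Z X + t^2 * (norm Z)^2) - (l + 2 * t * inner Z (A *v X) + t^2 * inner Z (A *v Z))
      = 2 * t * inner Z Z + t^2 * (l * (norm Z)^2 - inner Z (A *v Z))"
      unfolding e4 by (simp add: algebra_simps)
    then show ?thesis using e1 unfolding e2 e3 by linarith
  qed
  have "inner Z Z = 0"
  proof (rule ccontr)
    assume "inner Z Z \<noteq> 0"
    then have z: "0 < inner Z Z" by simp
    define K where "K = \<bar>l * (norm Z)^2 - inner Z (A *v Z)\<bar> + 1"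
    have K: "0 < K" "l * (norm Z)^2 - inner Z (A *v Z) \<le> K" by (auto simp: K_def)
    define t where "t = inner Z Z / K"
    have "0 \<le> 2 * (- t) * inner Z Z + t^2 * (l * (norm Z)^2 - inner Z (A *v Z))"
      using ge[of "- t"] by simp
    also have "\<dots> \<le> 2 * (- t) * inner Z Z + t^2 * K"
      using K by (intro add_left_mono mult_left_mono) auto
    also have "\<dots> = - ((inner Z Z)^2) / K"
      using K by (simp add: t_def power2_eq_square field_simps)
    also have "\<dots> < 0" using z K by simp
    finally show False by simp
  qed
  then have "A *v X = l *\<^sub>R X" by (simp add: Z_def)
  then show thesis using that XW X1 by blast
qed

text \<open>Induction on the number of eigenvectors found. The common kernel of the maps \<open>qdot (e i)\<close> is invariant,
and it is nonzero because over the reals it is cut out by four equations for each of fewer than \<open>n\<close>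
vectors in a space of dimension \<open>4 n\<close>. The eigenvalue found is real, so it may be written on the left.\<close>

lemma orthonormal_eigenvectors:
  fixes A :: "quat^'n^'n" and J :: "'n set"
  assumes A: "hyperhermitian A"
  shows "\<exists>e l. \<forall>i\<in>J. A *v e i = l i *\<^sub>R e i \<and> (\<forall>j\<in>J. qdot (e i) (e j) = (if i = j then 1 else 0))"
  using finite[of J]
proof (induction J rule: finite_induct)
  case (insert m J)
  then obtain e l where el: "\<And>i. i \<in> J \<Longrightarrow> A *v e i = l i *\<^sub>R e i"
    "\<And>i j. i \<in> J \<Longrightarrow> j \<in> J \<Longrightarrow> qdot (e i) (e j) = (if i = j then 1 else 0)" by metis
  define W where "W = {X. \<forall>i\<in>J. qdot (e i) X = 0}"
  have W: "subspace W"
    unfolding W_def subspace_def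
    by (auto simp: linear_add[OF qdot_linear] linear_scale[OF qdot_linear] linear_0[OF qdot_linear])
  have AW: "A *v X \<in> W" if "X \<in> W" for X
  proof -
    have "qdot (e i) (A *v X) = 0" if "i \<in> J" for i
    proof -
      have "qdot (e i) (A *v X) = qdot (l i *\<^sub>R e i) X"
        using A el(1)[OF that] by (simp add: qadjoint_qdot hyperhermitian_def)
      also have "\<dots> = l i *\<^sub>R qdot (e i) X"
        by (simp add: qdot_def scaleR_sum_right)
      finally show ?thesis using that \<open>X \<in> W\<close> by (simp add: W_def)
    qed
    then show ?thesis by (simp add: W_def)
  qed
  \<comment> \<open>Dimension count: the vectors \<open>rmult (e i) g\<close> are too few to span the whole space.\<close>
  obtain w where w: "w \<noteq> 0" "w \<in> W"
  proof -
    define S where "S = (\<lambda>(i, g). rmult (e i) g) ` (J \<times> (Basis :: quat set))"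
    have "dim S \<le> card S"
      by (rule dim_le_card) (auto simp: S_def span_superset)
    also have "card S \<le> card (J \<times> (Basis :: quat set))"
      unfolding S_def by (rule card_image_le) auto
    also have "\<dots> < CARD('n) * 4"
      using psubset_card_mono[of UNIV J] insert.hyps by (auto simp: card_cartesian_product DIM_quat)
    finally have "dim S < DIM(quat^'n)" by (simp add: DIM_quat)
    then obtain x where x: "x \<noteq> 0" "\<And>y. y \<in> span S \<Longrightarrow> orthogonal x y"
      using orthogonal_to_subspace_exists by blast
    have "qdot (e i) x = 0" if "i \<in> J" for i
    proof (rule euclidean_eqI)
      fix g :: quat assume "g \<in> Basis"
      then have "rmult (e i) g \<in> S" using that by (auto simp: S_def)
      then have "inner (rmult (e i) g) x = 0" using x(2)[OF span_base] by (simp add: orthogonal_def inner_commute[of x])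
      then show "inner (qdot (e i) x) g = inner 0 g" by (simp add: inner_commute[of _ g] qdot_inner)
    qed
    then show thesis using x(1) by (intro that[of x]) (auto simp: W_def)
  qed
  obtain X c where X: "X \<in> W" "norm X = 1" "A *v X = c *\<^sub>R X"
    using constrained_max_eigenvector[OF A W AW w(2,1)] by blast
  have X0: "qdot (e i) X = 0" "qdot X (e i) = 0" if "i \<in> J" for i
    using X(1) that qdot_commute[of X "e i"] by (auto simp: W_def)
  show ?case
    using el X X0 qdot_self[of X] insert.hyps
    by (intro exI[of _ "e(m := X)"] exI[of _ "l(m := c)"]) auto
qed simp

definition diagonalizes :: "quat^'n^'n \<Rightarrow> real^'n \<Rightarrow> quat^'n^'n \<Rightarrow> bool" where
  "diagonalizes U l A \<longleftrightarrow> qunitary U \<and> qadjoint U ** A ** U = real_diag l"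

lemma real_diag_mult: "real_diag l *v X = (\<chi> k. (l $ k) *\<^sub>R (X $ k))"
  by (simp add: real_diag_def matrix_vector_mult_def vec_eq_iff if_distrib if_distribR scaleR_conv_of_real cong: if_cong)

lemma quaternionic_spectral_theorem:
  fixes A :: "quat^'n^'n"
  assumes "hyperhermitian A"
  obtains U l where "diagonalizes U l A"
proof -
  obtain e l where "\<forall>i\<in>(UNIV::'n set). A *v e i = l i *\<^sub>R e i \<and> (\<forall>j\<in>UNIV. qdot (e i) (e j) = (if i = j then 1 else 0))"
    using orthonormal_eigenvectors[OF assms, of UNIV] by auto
  then have e: "\<And>i. A *v e i = l i *\<^sub>R e i" "\<And>i j. qdot (e i) (e j) = (if i = j then 1 else 0)"
    by auto
  define U :: "quat^'n^'n" where "U = (\<chi> j k. e k $ j)"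
  have Unth: "U $ j $ k = e k $ j" for j k by (simp add: U_def)
  have left: "qadjoint U ** U = mat 1"
    by (simp add: vec_eq_iff mat_def matrix_matrix_mult_def qadjoint_def U_def flip: qdot_def)
       (simp add: e)
  \<comment> \<open>A left inverse is a right inverse because both matrices act as real linear maps on a space of finite
    dimension.\<close>
  have "(\<lambda>X. qadjoint U *v X) \<circ> (\<lambda>X. U *v X) = id"
    by (auto simp: matrix_vector_mul_assoc left)
  then have "(\<lambda>X. U *v X) \<circ> (\<lambda>X. qadjoint U *v X) = id"
    by (subst linear_inverse_left) auto
  then have right: "U ** qadjoint U = mat 1"
    by (auto simp: matrix_eq fun_eq_iff simp flip: matrix_vector_mul_assoc)
  have AU: "(A ** U) $ j $ k = l k *\<^sub>R e k $ j" for j k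
    using arg_cong[OF e(1)[of k], of "\<lambda>v. v $ j"]
    by (simp add: matrix_matrix_mult_def matrix_vector_mult_def U_def)
  have "qadjoint U ** (A ** U) = real_diag (\<chi> k. l k)"
  proof -
    have "(qadjoint U ** (A ** U)) $ i $ k = l k *\<^sub>R qdot (e i) (e k)" for i k
      unfolding matrix_matrix_mult_def[of "qadjoint U"]
      by (simp add: AU qadjoint_def Unth qdot_def scaleR_sum_right)
    then show ?thesis by (simp add: vec_eq_iff real_diag_def e of_real_def)
  qed
  then have "diagonalizes U (\<chi> k. l k) A"
    using left right by (simp add: diagonalizes_def qunitary_def matrix_mul_assoc)
  then show thesis by (rule that)
qed

lemma diagonalizes_form:
  assumes "diagonalizes U l A"
  shows "inner X (A *v X) = (\<Sum>k\<in>UNIV. l $ k * coord_sq U X k)"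
proof -
  have u: "qadjoint U ** A ** U = real_diag l" "U ** qadjoint U = mat 1"
    using assms by (auto simp: diagonalizes_def qunitary_def)
  have "A = (U ** qadjoint U) ** A ** (U ** qadjoint U)" by (simp add: u)
  also have "\<dots> = U ** (qadjoint U ** A ** U) ** qadjoint U" by (simp add: matrix_mul_assoc)
  finally have "A = U ** real_diag l ** qadjoint U" by (simp add: u)
  then have "A *v X = U *v (real_diag l *v (qadjoint U *v X))"
    by (simp only: matrix_vector_mul_assoc matrix_mul_assoc)
  then have "inner X (A *v X) = inner X (U *v (real_diag l *v (qadjoint U *v X)))" by simp
  also have "\<dots> = inner (qadjoint U *v X) (real_diag l *v (qadjoint U *v X))"
    by (rule qadjoint_inner)
  also have "\<dots> = (\<Sum>k\<in>UNIV. l $ k * coord_sq U X k)"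
    by (simp add: real_diag_mult inner_vec_def power2_norm_eq_inner)
  finally show ?thesis .
qed

text \<open>A hyperhermitian matrix is determined by its real quadratic form, by polarization. This is how matrices
obtained by perturbing a Hessian are diagonalized without computing their entries.\<close>

lemma diagonalizesI:
  assumes A: "hyperhermitian A" and U: "qunitary U"
    and form: "\<And>X. inner X (A *v X) = (\<Sum>k\<in>UNIV. l $ k * coord_sq U X k)"
  shows "diagonalizes U l A"
proof -
  have u: "qadjoint U ** U = mat 1" using U by (simp add: qunitary_def)
  define B where "B = U ** real_diag l ** qadjoint U"
  have BXY: "inner X (B *v Y) = inner (qadjoint U *v X) (real_diag l *v (qadjoint U *v Y))" for X Y
    unfolding B_def by (simp add: qadjoint_inner flip: matrix_vector_mul_assoc)
  have Bsym: "inner X (B *v Y) = inner Y (B *v X)" for X Y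
    unfolding BXY by (simp add: real_diag_mult inner_vec_def inner_commute)
  have Asym: "inner X (A *v Y) = inner Y (A *v X)" for X Y
    using hyperhermitian_inner[OF A] by (simp add: inner_commute)
  have form': "inner X (A *v X) = inner X (B *v X)" for X
    unfolding form BXY by (simp add: real_diag_mult inner_vec_def power2_norm_eq_inner)
  have pol: "inner X (M *v Y) = (inner (X + Y) (M *v (X + Y)) - inner X (M *v X) - inner Y (M *v Y)) / 2"
    if "\<And>X Y. inner X (M *v Y) = inner Y (M *v X)" for M :: "quat^'n^'n" and X Y
    using that[of X Y] by (simp add: matrix_vector_right_distrib inner_add_left inner_add_right)
  have "inner X (A *v Y) = inner X (B *v Y)" for X Y
    using pol[OF Asym] pol[OF Bsym] form' by metis
  then have "A *v Y = B *v Y" for Y by (meson vector_eq_ldot)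
  then have "A = B" by (simp add: matrix_eq)
  then have "qadjoint U ** A ** U = (qadjoint U ** U) ** real_diag l ** (qadjoint U ** U)"
    by (simp add: B_def matrix_mul_assoc)
  then show ?thesis using U u by (simp add: diagonalizes_def)
qed

section \<open>The determinant as an infimum of weighted traces\<close>

text \<open>Weighted arithmetic-geometric mean inequality. Sum \<open>ln x \<le> x - 1\<close> at \<open>x = b\<^sub>j \<lambda>\<^sub>k / (c \<beta>)\<close> with the
weights \<open>p j k\<close>; as \<open>p\<close> is doubly stochastic, the logarithms add up to
\<open>ln (\<Prod> b) + ln (\<Prod> \<lambda>) - n ln (c \<beta>) \<ge> 0\<close>.\<close>

lemma doubly_stochastic_AM_GM:
  fixes p :: "'n::finite \<Rightarrow> 'n \<Rightarrow> real" and b ev :: "'n \<Rightarrow> real" and c \<beta> :: real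
  assumes p: "\<And>j k. 0 \<le> p j k" "\<And>j. (\<Sum>k\<in>UNIV. p j k) = 1" "\<And>k. (\<Sum>j\<in>UNIV. p j k) = 1"
    and b: "\<And>j. 0 < b j" "0 < \<beta>" "\<beta> ^ CARD('n) = (\<Prod>j\<in>UNIV. b j)"
    and ev0: "\<And>k. 0 \<le> ev k" and c: "0 \<le> c" "c ^ CARD('n) \<le> (\<Prod>k\<in>UNIV. ev k)"
  shows "CARD('n) * (c * \<beta>) \<le> (\<Sum>j\<in>UNIV. b j * (\<Sum>k\<in>UNIV. ev k * p j k))"
proof (cases "c = 0")
  case True
  have "0 \<le> (\<Sum>j\<in>UNIV. b j * (\<Sum>k\<in>UNIV. ev k * p j k))"
    using b(1) p(1) ev0 by (intro sum_nonneg mult_nonneg_nonneg) (auto intro: less_imp_le)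
  then show ?thesis using True by simp
next
  case False
  then have c0: "0 < c" using c by simp
  then have "0 < c ^ CARD('n)" by simp
  then have "0 < (\<Prod>k\<in>UNIV. ev k)" using c(2) by linarith
  then have evpos: "0 < ev k" for k using ev0[of k] by (metis finite iso_tuple_UNIV_I less_le prod_zero_iff)
  define G where "G = c * \<beta>"
  have G: "0 < G" using c0 b by (simp add: G_def)
  let ?T = "(\<Sum>j\<in>UNIV. b j * (\<Sum>k\<in>UNIV. ev k * p j k))"
  let ?E = "(\<Sum>j\<in>UNIV. \<Sum>k\<in>UNIV. p j k * ln (b j * ev k / G))"
  have "real CARD('n) * ln c = ln (c ^ CARD('n))" using c0 by (simp add: ln_realpow)
  also have "\<dots> \<le> ln (\<Prod>k\<in>UNIV. ev k)" using c(2) c0 by (intro ln_mono) auto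
  also have "\<dots> = (\<Sum>k\<in>UNIV. ln (ev k))" using evpos by (intro ln_prod) (simp_all add: less_imp_neq[symmetric])
  finally have l1: "real CARD('n) * ln c \<le> (\<Sum>k\<in>UNIV. ln (ev k))" .
  have l2: "real CARD('n) * ln \<beta> = (\<Sum>j\<in>UNIV. ln (b j))"
  proof -
    have "b j \<noteq> 0" for j using b(1)[of j] by simp
    then show ?thesis using b by (simp add: ln_prod flip: ln_realpow)
  qed
  have "?E
    \<le> (\<Sum>j\<in>UNIV. \<Sum>k\<in>UNIV. p j k * (b j * ev k / G - 1))"
    using G b(1) evpos by (intro sum_mono mult_left_mono p ln_le_minus_one) auto
  also have "\<dots> = ?T / G - CARD('n)"
    by (simp add: right_diff_distrib sum_subtractf p sum_distrib_left sum_divide_distrib mult_ac)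
  finally have up: "?E
    \<le> ?T / G - CARD('n)" .
  have "p j k * ln (b j * ev k / G) = p j k * ln (b j) + p j k * ln (ev k) - p j k * ln G" for j k
    using b(1)[of j] evpos[of k] G by (simp add: ln_mult ln_div algebra_simps)
  then have "?E
    = (\<Sum>j\<in>UNIV. \<Sum>k\<in>UNIV. p j k * ln (b j)) + (\<Sum>j\<in>UNIV. \<Sum>k\<in>UNIV. p j k * ln (ev k))
      - (\<Sum>j\<in>UNIV. \<Sum>k\<in>UNIV. p j k * ln G)"
    by (simp add: sum.distrib sum_subtractf)
  also have "(\<Sum>j\<in>UNIV. \<Sum>k\<in>UNIV. p j k * ln (b j)) = (\<Sum>j\<in>UNIV. ln (b j))"
    by (simp add: p flip: sum_distrib_right)
  also have "(\<Sum>j\<in>UNIV. \<Sum>k\<in>UNIV. p j k * ln (ev k)) = (\<Sum>k\<in>UNIV. ln (ev k))"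
    by (subst sum.swap) (simp add: p flip: sum_distrib_right)
  also have "(\<Sum>j\<in>UNIV. \<Sum>k\<in>UNIV. p j k * ln G) = CARD('n) * ln c + CARD('n) * ln \<beta>"
  proof -
    have "(\<Sum>j\<in>UNIV. \<Sum>k\<in>UNIV. p j k * ln G) = CARD('n) * ln G"
      by (simp add: p flip: sum_distrib_right)
    moreover have "ln G = ln c + ln \<beta>" using c0 b by (simp add: G_def ln_mult)
    ultimately show ?thesis by (simp only: distrib_left)
  qed
  finally have "0 \<le> ?E"
    using l1 l2 by linarith
  then have "CARD('n) \<le> ?T / G" using up by linarith
  then show ?thesis using G by (simp add: G_def le_divide_eq)
qed

lemma norm_axis_one: "norm (axis j 1 :: quat^'n) = 1"
proof -
  have "(norm (axis j 1 :: quat^'n))^2 = 1"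
    by (simp add: norm_vec_sq axis_def if_distrib[of norm] if_distrib[of "\<lambda>x. x^2"] cong: if_cong)
  then show ?thesis using norm_ge_zero[of "axis j 1 :: quat^'n"] by (auto simp: power2_eq_1_iff)
qed

lemma qunitary_transition:
  assumes "qunitary U" "qunitary V"
  defines "p \<equiv> \<lambda>j k. coord_sq U (V *v axis j 1) k"
  shows "(\<Sum>k\<in>UNIV. p j k) = 1" "(\<Sum>j\<in>UNIV. p j k) = 1"
proof -
  have "(\<Sum>k\<in>UNIV. p j k) = (norm (qadjoint U *v (V *v axis j 1)))^2"
    by (simp add: p_def norm_vec_sq)
  also have "\<dots> = 1" by (simp add: qunitary_norm assms(1,2) norm_axis_one)
  finally show "(\<Sum>k\<in>UNIV. p j k) = 1" .
  have "p j k = (norm ((qadjoint V *v (U *v axis k 1)) $ j))^2" for j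
  proof -
    have "(qadjoint U *v (V *v axis j 1)) $ k = qdot (U *v axis k 1) (V *v axis j 1)"
      by (simp add: qadjoint_mult_nth mult_axis)
    also have "\<dots> = qcnj (qdot (V *v axis j 1) (U *v axis k 1))" by (rule qdot_commute)
    also have "qdot (V *v axis j 1) (U *v axis k 1) = (qadjoint V *v (U *v axis k 1)) $ j"
      by (simp add: qadjoint_mult_nth mult_axis)
    finally show ?thesis by (simp add: p_def)
  qed
  then have "(\<Sum>j\<in>UNIV. p j k) = (norm (qadjoint V *v (U *v axis k 1)))^2"
    by (simp add: norm_vec_sq)
  also have "\<dots> = 1" by (simp add: qunitary_norm assms(1,2) norm_axis_one)
  finally show "(\<Sum>j\<in>UNIV. p j k) = 1" .
qed

text \<open>For a nonnegative \<open>A\<close> this says \<open>tr (B A) \<ge> n (det B)\<^sup>1\<^sup>/\<^sup>n (det A)\<^sup>1\<^sup>/\<^sup>n\<close> for the positive matrix \<open>B\<close> with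
eigenvectors the columns of \<open>V\<close> and eigenvalues \<open>b\<close>. It bounds the nonlinear operator \<open>det\<close> by linear
ones. Roots are avoided by naming \<open>c\<close> and \<open>\<beta>\<close>.\<close>

lemma weighted_trace_lower_bound:
  fixes A U V :: "quat^'n^'n" and c \<beta> :: real
  assumes U: "diagonalizes U l A" "\<And>k. 0 \<le> l $ k" and V: "qunitary V"
    and b: "\<And>j. 0 < b j" "0 < \<beta>" "\<beta> ^ CARD('n) = (\<Prod>j\<in>UNIV. b j)"
    and c: "0 \<le> c" "c ^ CARD('n) \<le> (\<Prod>k\<in>UNIV. l $ k)"
  shows "CARD('n) * (c * \<beta>) \<le> (\<Sum>j\<in>UNIV. b j * inner (V *v axis j 1) (A *v (V *v axis j 1)))"
  unfolding diagonalizes_form[OF U(1)]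
  using U V b c by (intro doubly_stochastic_AM_GM qunitary_transition) (auto simp: diagonalizes_def)

lemma diagonalizes_column:
  assumes "diagonalizes V m A"
  shows "inner (V *v axis j 1) (A *v (V *v axis j 1)) = m $ j"
proof -
  have "qadjoint V *v (V *v axis j 1) = axis j 1"
    using assms by (simp add: diagonalizes_def qunitary_def matrix_vector_mul_assoc)
  then show ?thesis
    by (simp add: diagonalizes_form[OF assms] axis_def if_distrib if_distribR cong: if_cong)
qed

text \<open>The Moore determinant is well defined. For a positive matrix \<open>doubly_stochastic_AM_GM\<close> with
\<open>b\<^sub>j = 1 / m\<^sub>j\<close> is Hadamard's inequality, which gives both comparisons between the two products. Applied
to \<open>A + t\<close> for all large \<open>t\<close> it shows that the polynomials \<open>\<Prod> (l\<^sub>k + t)\<close> and \<open>\<Prod> (m\<^sub>k + t)\<close> agree at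
infinitely many points, hence also at \<open>t = 0\<close>.\<close>

lemma eigenvalue_product_unique:
  fixes A U V :: "quat^'n^'n"
  assumes "diagonalizes U l A" "diagonalizes V m A"
  shows "(\<Prod>k\<in>UNIV. l $ k) = (\<Prod>k\<in>UNIV. m $ k)"
proof -
  have le: "(\<Prod>k\<in>UNIV. l $ k + t) \<le> (\<Prod>k\<in>UNIV. m $ k + t)"
    if U: "diagonalizes U l A" and V: "diagonalizes V m A"
      and t: "\<And>k. 0 < l $ k + t" "\<And>k. 0 < m $ k + t" for U V :: "quat^'n^'n" and l m t
  proof -
    have uU: "qunitary U" and uV: "qunitary V" using U V by (auto simp: diagonalizes_def)
    let ?n = "CARD('n)"
    let ?L = "(\<Prod>k\<in>UNIV. l $ k + t)" and ?M = "(\<Prod>k\<in>UNIV. m $ k + t)"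
    define p where "p j k = coord_sq U (V *v axis j 1) k" for j k
    have p: "(\<Sum>k\<in>UNIV. p j k) = 1" "(\<Sum>j\<in>UNIV. p j k) = 1" for j k
      unfolding p_def by (rule qunitary_transition[OF uU uV])+
    have m: "m $ j + t = (\<Sum>k\<in>UNIV. (l $ k + t) * p j k)" for j
      using diagonalizes_column[OF V, of j] p(1)
      by (simp add: diagonalizes_form[OF U] p_def distrib_right sum.distrib flip: sum_distrib_left)
    define c where "c = root ?n ?L"
    define \<beta> where "\<beta> = root ?n (\<Prod>k\<in>UNIV. inverse (m $ k + t))"
    have lp: "0 < ?L" and mp: "0 < ?M"
      using t by (auto intro!: prod_pos)
    have ip: "0 < (\<Prod>k\<in>UNIV. inverse (m $ k + t))" using t by (auto intro!: prod_pos)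
    have "real ?n * (c * \<beta>) \<le> (\<Sum>j\<in>UNIV. inverse (m $ j + t) * (\<Sum>k\<in>UNIV. (l $ k + t) * p j k))"
    proof (rule doubly_stochastic_AM_GM[OF _ p])
      show "\<beta> ^ ?n = (\<Prod>j\<in>UNIV. inverse (m $ j + t))" "0 < \<beta>"
        using ip by (auto simp: \<beta>_def)
      show "0 \<le> c" "c ^ ?n \<le> ?L" using lp by (auto simp: c_def)
    qed (use t in \<open>auto simp: p_def intro: less_imp_le\<close>)
    also have "\<dots> = (\<Sum>j\<in>(UNIV::'n set). 1::real)"
      unfolding m[symmetric] by (rule sum.cong) (use t(2) in \<open>simp_all add: less_imp_neq[symmetric]\<close>)
    finally have "c * \<beta> \<le> 1" by simp
    moreover have "0 \<le> c * \<beta>" using lp ip by (simp add: c_def \<beta>_def)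
    ultimately have "(c * \<beta>) ^ ?n \<le> 1" by (rule power_le_one[rotated])
    moreover have "(c * \<beta>) ^ ?n = ?L / ?M"
      using lp ip by (simp add: power_mult_distrib c_def \<beta>_def prod_inversef[unfolded o_def] divide_inverse)
    ultimately show ?thesis using mp by (simp add: divide_le_eq)
  qed
  define P where "P l = (\<Prod>k\<in>UNIV. [:l $ k, 1:])" for l :: "real^'n"
  have P: "poly (P l) t = (\<Prod>k\<in>UNIV. l $ k + t)" for l t
    by (simp add: P_def poly_prod)
  define T where "T = 1 + (\<Sum>k\<in>UNIV. \<bar>l $ k\<bar> + \<bar>m $ k\<bar>)"
  have T: "\<bar>l $ k\<bar> < T" "\<bar>m $ k\<bar> < T" for k
  proof -
    have "\<bar>l $ k\<bar> + \<bar>m $ k\<bar> \<le> (\<Sum>k\<in>UNIV. \<bar>l $ k\<bar> + \<bar>m $ k\<bar>)"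
      by (rule member_le_sum) auto
    then show "\<bar>l $ k\<bar> < T" "\<bar>m $ k\<bar> < T" unfolding T_def by linarith+
  qed
  have "{T..} \<subseteq> {t. poly (P l - P m) t = 0}"
  proof
    fix t assume "t \<in> {T..}"
    then have "0 < l $ k + t" "0 < m $ k + t" for k
      using T[of k] by (auto simp: abs_if split: if_splits)
    then show "t \<in> {t. poly (P l - P m) t = 0}"
      using le[OF assms(1,2), of t] le[OF assms(2,1), of t] by (simp add: P)
  qed
  then have "infinite {t. poly (P l - P m) t = 0}"
    using infinite_Ici finite_subset by blast
  then have "P l - P m = 0" using poly_roots_finite by blast
  then have "poly (P l) 0 = poly (P m) 0" by simp
  then show ?thesis by (simp add: P)
qed

lemma moore_det_eq:
  assumes "diagonalizes U l A"
  shows "moore_det A = (\<Prod>k\<in>UNIV. l $ k)"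
  unfolding moore_det_def
proof (rule the_equality)
  show "\<exists>U l'. qunitary U \<and> qadjoint U ** A ** U = real_diag l' \<and> (\<Prod>k\<in>UNIV. l $ k) = (\<Prod>j\<in>UNIV. l' $ j)"
    using assms by (auto simp: diagonalizes_def)
  fix d assume "\<exists>U l. qunitary U \<and> qadjoint U ** A ** U = real_diag l \<and> d = (\<Prod>j\<in>UNIV. l $ j)"
  then show "d = (\<Prod>k\<in>UNIV. l $ k)"
    using eigenvalue_product_unique[OF assms] by (auto simp: diagonalizes_def)
qed

text \<open>The converse of \<open>weighted_trace_lower_bound\<close>, for numbers \<open>\<mu>\<close> in the role of the eigenvalues. Letting all weights but one tend to
\<open>0\<close> shows that each eigenvalue is nonnegative, and the weights \<open>1 / (\<mu>\<^sub>j + \<epsilon>)\<close> recover the product.\<close>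

lemma prod_ge_of_weighted_sums:
  fixes \<mu> :: "'n::finite \<Rightarrow> real" and c :: real
  assumes "0 \<le> c" and sums: "\<And>b \<beta>. (\<And>j. 0 < b j) \<Longrightarrow> 0 < \<beta> \<Longrightarrow> \<beta> ^ CARD('n) = (\<Prod>j\<in>UNIV. b j) \<Longrightarrow>
      CARD('n) * (c * \<beta>) \<le> (\<Sum>j\<in>UNIV. b j * \<mu> j)"
  shows "0 \<le> \<mu> j" and "0 < \<epsilon> \<Longrightarrow> c ^ CARD('n) \<le> (\<Prod>j\<in>UNIV. \<mu> j + \<epsilon>)"
proof -
  let ?n = "CARD('n)"
  have sums': "real ?n * (c * root ?n (\<Prod>j\<in>UNIV. b j)) \<le> (\<Sum>j\<in>UNIV. b j * \<mu> j)"
    if "\<And>j. 0 < b j" for b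
  proof (rule sums[OF that])
    have "0 < (\<Prod>j\<in>UNIV. b j)" using that by (intro prod_pos) auto
    then show "0 < root ?n (\<Prod>j\<in>UNIV. b j)" "root ?n (\<Prod>j\<in>UNIV. b j) ^ ?n = (\<Prod>j\<in>UNIV. b j)"
      by auto
  qed
  show nn: "0 \<le> \<mu> j" for j
  proof (rule ccontr)
    assume neg: "\<not> 0 \<le> \<mu> j"
    define S where "S = \<bar>\<Sum>k\<in>UNIV - {j}. \<mu> k\<bar> + 1"
    define s where "s = - \<mu> j / (2 * S)"
    have S: "0 < S" "(\<Sum>k\<in>UNIV - {j}. \<mu> k) \<le> S" by (auto simp: S_def)
    have s: "0 < s" using neg S by (simp add: s_def divide_neg_pos)
    define b where "b k = (if k = j then 1 else s)" for k
    have b: "0 < b k" for k using s by (simp add: b_def)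
    have "0 \<le> real ?n * (c * root ?n (\<Prod>j\<in>UNIV. b j))"
      using \<open>0 \<le> c\<close> b by (intro mult_nonneg_nonneg real_root_ge_zero prod_nonneg) (auto intro: less_imp_le)
    also have "\<dots> \<le> (\<Sum>k\<in>UNIV. b k * \<mu> k)" by (rule sums'[OF b])
    also have "\<dots> = b j * \<mu> j + (\<Sum>k\<in>UNIV - {j}. b k * \<mu> k)" by (rule sum.remove) auto
    also have "(\<Sum>k\<in>UNIV - {j}. b k * \<mu> k) = s * (\<Sum>k\<in>UNIV - {j}. \<mu> k)"
      by (simp add: b_def sum_distrib_left)
    also have "\<dots> \<le> s * S" using s S by (intro mult_left_mono) auto
    also have "s * S = - \<mu> j / 2" using S by (simp add: s_def)
    finally show False using neg by (simp add: b_def)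
  qed
  show "c ^ ?n \<le> (\<Prod>j\<in>UNIV. \<mu> j + \<epsilon>)" if "0 < \<epsilon>"
  proof -
    have pos: "0 < \<mu> j + \<epsilon>" for j using nn[of j] that by linarith
    define b where "b j = inverse (\<mu> j + \<epsilon>)" for j
    have b: "0 < b j" for j using pos by (simp add: b_def)
    have "real ?n * (c * root ?n (\<Prod>j\<in>UNIV. b j)) \<le> (\<Sum>j\<in>UNIV. b j * \<mu> j)" by (rule sums'[OF b])
    also have "\<dots> \<le> (\<Sum>j\<in>(UNIV::'n set). 1)"
      using pos that by (intro sum_mono) (simp add: b_def field_simps)
    finally have "c * root ?n (\<Prod>j\<in>UNIV. b j) \<le> 1" by simp
    moreover have bp: "0 < (\<Prod>j\<in>UNIV. b j)" using b by (auto intro!: prod_pos)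
    moreover have "0 \<le> c * root ?n (\<Prod>j\<in>UNIV. b j)" using \<open>0 \<le> c\<close> bp by simp
    ultimately have "(c * root ?n (\<Prod>j\<in>UNIV. b j)) ^ ?n \<le> 1" by (intro power_le_one)
    then have "c ^ ?n * (\<Prod>j\<in>UNIV. b j) \<le> 1" using bp by (simp add: power_mult_distrib)
    moreover have "(\<Prod>j\<in>UNIV. b j) = inverse (\<Prod>j\<in>UNIV. \<mu> j + \<epsilon>)"
      by (simp add: b_def prod_inversef[unfolded o_def])
    moreover have "0 < (\<Prod>j\<in>UNIV. \<mu> j + \<epsilon>)" using pos by (auto intro!: prod_pos)
    ultimately show ?thesis by (simp add: divide_inverse[symmetric] divide_le_eq)
  qed
qed

lemma prod_add_const_ge:
  fixes a :: "'i \<Rightarrow> real"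
  assumes "finite I" "I \<noteq> {}" "\<And>i. i \<in> I \<Longrightarrow> 0 \<le> a i" "0 \<le> \<epsilon>"
  shows "(\<Prod>i\<in>I. a i) + \<epsilon> ^ card I \<le> (\<Prod>i\<in>I. a i + \<epsilon>)"
  using assms
proof (induction I rule: finite_ne_induct)
  case (insert i I)
  have "a i * (\<Prod>i\<in>I. a i) + \<epsilon> * \<epsilon> ^ card I \<le> (a i + \<epsilon>) * ((\<Prod>i\<in>I. a i) + \<epsilon> ^ card I)"
    using insert by (simp add: algebra_simps prod_nonneg)
  also have "\<dots> \<le> (a i + \<epsilon>) * (\<Prod>i\<in>I. a i + \<epsilon>)"
    using insert by (intro mult_left_mono) auto
  finally show ?case using insert by simp
qed simp

section \<open>The quaternionic Hessian as a quadratic form\<close>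

lemma qpartial_of_real:
  assumes "(\<phi> has_derivative D) (at q)"
  shows "qpartial k e (\<lambda>p. of_real (\<phi> p)) q = of_real (D (axis k e))"
proof -
  have "((\<lambda>p. of_real (\<phi> p) :: quat) has_derivative (\<lambda>h. of_real (D h))) (at q)"
    by (rule bounded_linear.has_derivative[OF bounded_linear_of_real assms])
  from frechet_derivative_at[OF this] show ?thesis
    unfolding qpartial_def by metis
qed

lemma qhessian_jet:
  fixes \<phi> :: "quat^'n \<Rightarrow> real"
  assumes j: "C2_jet \<phi> \<phi>' \<phi>''"
  shows "qhessian \<phi> q $ j $ k =
     (\<Sum>f\<in>Basis. \<Sum>e\<in>Basis. \<phi>'' q (axis j f) (axis k e) *\<^sub>R (f * qcnj e))"
proof -
  have d: "(\<phi> has_derivative \<phi>' p) (at p)" and d': "(\<phi>' has_derivative \<phi>'' p) (at p)" for p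
    using j by (auto simp: C2_jet_def)
  have del: "del k (\<lambda>p. of_real (\<phi> p)) = (\<lambda>p. \<Sum>e\<in>Basis. \<phi>' p (axis k e) *\<^sub>R qcnj e)" for k
  proof
    fix p
    have neg: "qcnj \<i>\<^sub>H = - \<i>\<^sub>H" "qcnj \<j>\<^sub>H = - \<j>\<^sub>H" "qcnj \<k>\<^sub>H = - \<k>\<^sub>H" by (simp_all add: quat_eq_iff)
    show "del k (\<lambda>p. of_real (\<phi> p)) p = (\<Sum>e\<in>Basis. \<phi>' p (axis k e) *\<^sub>R qcnj e)"
      by (simp add: del_def qpartial_of_real[OF d] sum_quat_Basis neg scaleR_conv_of_real)
  qed
  have par: "qpartial j f (\<lambda>p. \<Sum>e\<in>Basis. \<phi>' p (axis k e) *\<^sub>R qcnj e) q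
     = (\<Sum>e\<in>Basis. \<phi>'' q (axis j f) (axis k e) *\<^sub>R qcnj e)" for f
  proof -
    have "((\<lambda>p. \<Sum>e\<in>Basis. \<phi>' p (axis k e) *\<^sub>R qcnj e) has_derivative
       (\<lambda>h. \<Sum>e\<in>Basis. \<phi>'' q h (axis k e) *\<^sub>R qcnj e)) (at q)"
      by (intro has_derivative_sum has_derivative_scaleR_left
          bounded_linear.has_derivative[OF blinfun.bounded_linear_left] d')
    from frechet_derivative_at[OF this] show ?thesis
      unfolding qpartial_def by metis
  qed
  define P where "P f = (\<Sum>e\<in>Basis. \<phi>'' q (axis j f) (axis k e) *\<^sub>R qcnj e)" for f
  have "qhessian \<phi> q $ j $ k = P 1 + \<i>\<^sub>H * P \<i>\<^sub>H + \<j>\<^sub>H * P \<j>\<^sub>H + \<k>\<^sub>H * P \<k>\<^sub>H"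
    unfolding P_def par[symmetric] del[symmetric] by (simp add: qhessian_def del_bar_def)
  also have "\<dots> = (\<Sum>f\<in>Basis. f * P f)"
    by (simp only: sum_quat_Basis[of "\<lambda>f. f * P f"] mult_1_left)
  finally have "qhessian \<phi> q $ j $ k = (\<Sum>f\<in>Basis. f * P f)" .
  then show ?thesis by (simp add: P_def sum_distrib_left)
qed

lemma hyperhermitian_qhessian:
  assumes "C2_jet \<phi> \<phi>' \<phi>''" shows "hyperhermitian (qhessian \<phi> q)"
proof -
  have sym: "\<phi>'' q h k = \<phi>'' q k h" for h k using assms by (simp add: C2_jet_def)
  have "qcnj (qhessian \<phi> q $ k $ j) = qhessian \<phi> q $ j $ k" for j k
    unfolding qhessian_jet[OF assms] qcnj_sum
    by (subst sum.swap) (simp add: sym[of "axis j _"])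
  then show ?thesis by (simp add: hyperhermitian_def qadjoint_def vec_eq_iff)
qed

lemma quat_inner_expand:
  fixes a b e f :: quat
  shows "inner a (f * qcnj e * b) = (\<Sum>g\<in>Basis. inner (a * g) f * inner (b * g) e)"
  unfolding sum_quat_Basis by (simp add: inner_quat_def) algebra

text \<open>The real form of the quaternionic Hessian at \<open>X\<close> is the Laplacian along the quaternionic line
spanned by \<open>X\<close>. Thus weighted traces of the Hessian are operators of the form \<open>dirsum\<close>.\<close>

lemma qhessian_form:
  fixes \<phi> :: "quat^'n \<Rightarrow> real"
  assumes j: "C2_jet \<phi> \<phi>' \<phi>''"
  shows "inner X (qhessian \<phi> q *v X) = (\<Sum>g\<in>Basis. \<phi>'' q (rmult X g) (rmult X g))"
proof -
  define T where "T j f k e g = inner (X $ j * g) f * (inner (X $ k * g) e * \<phi>'' q (axis j f) (axis k e))"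
    for j f k e g
  have exp: "rmult X g = (\<Sum>j\<in>UNIV. \<Sum>f\<in>Basis. inner (X $ j * g) f *\<^sub>R axis j f)" for g
  proof -
    have ax: "(\<Sum>f\<in>Basis. inner (X $ j * g) f *\<^sub>R axis j f) = axis j (X $ j * g)" for j
    proof -
      have "(\<Sum>f\<in>Basis. inner (X $ j * g) f *\<^sub>R axis j f) $ i = axis j (X $ j * g) $ i" for i
        using euclidean_representation[of "X $ j * g"] by (cases "i = j") (auto simp: axis_def)
      then show ?thesis by (simp add: vec_eq_iff)
    qed
    have "rmult X g = (\<Sum>j\<in>UNIV. axis j (X $ j * g))"
      by (simp add: vec_eq_iff rmult_def axis_def if_distrib cong: if_cong)
    then show ?thesis by (simp only: ax)
  qed
  have bil: "\<phi>'' q (rmult X g) (rmult X g) = (\<Sum>j\<in>UNIV. \<Sum>f\<in>Basis. \<Sum>k\<in>UNIV. \<Sum>e\<in>Basis.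
       T j f k e g)" for g
  proof -
    have 1: "\<phi>'' q (rmult X g) Y = (\<Sum>j\<in>UNIV. \<Sum>f\<in>Basis. inner (X $ j * g) f * \<phi>'' q (axis j f) Y)" for Y
      by (subst exp) (simp add: blinfun.sum_left blinfun.sum_right blinfun.scaleR_left blinfun.scaleR_right)
    have 2: "\<phi>'' q Y (rmult X g) = (\<Sum>k\<in>UNIV. \<Sum>e\<in>Basis. inner (X $ k * g) e * \<phi>'' q Y (axis k e))" for Y
      by (subst exp) (simp add: blinfun.sum_right blinfun.scaleR_right)
    show ?thesis unfolding 1 unfolding 2 sum_distrib_left T_def ..
  qed
  have "inner X (qhessian \<phi> q *v X) = (\<Sum>j\<in>UNIV. \<Sum>k\<in>UNIV. inner (X $ j) (qhessian \<phi> q $ j $ k * X $ k))"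
    by (simp add: inner_vec_def matrix_vector_mult_def inner_sum_right)
  also have "\<dots> = (\<Sum>j\<in>UNIV. \<Sum>k\<in>UNIV. \<Sum>f\<in>Basis. \<Sum>e\<in>Basis.
      \<phi>'' q (axis j f) (axis k e) * (\<Sum>g\<in>Basis. inner (X $ j * g) f * inner (X $ k * g) e))"
    by (simp add: qhessian_jet[OF j] sum_distrib_right inner_sum_right quat_inner_expand)
  also have "\<dots> = (\<Sum>j\<in>UNIV. \<Sum>k\<in>UNIV. \<Sum>f\<in>Basis. \<Sum>e\<in>Basis. \<Sum>g\<in>Basis.
      T j f k e g)"
    by (simp add: T_def sum_distrib_left mult_ac)
  also have "\<dots> = (\<Sum>j\<in>UNIV. \<Sum>k\<in>UNIV. \<Sum>f\<in>Basis. \<Sum>g\<in>Basis. \<Sum>e\<in>Basis.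
      T j f k e g)"
    by (intro sum.cong refl sum.swap)
  also have "\<dots> = (\<Sum>j\<in>UNIV. \<Sum>k\<in>UNIV. \<Sum>g\<in>Basis. \<Sum>f\<in>Basis. \<Sum>e\<in>Basis.
      T j f k e g)"
    by (intro sum.cong refl sum.swap)
  also have "\<dots> = (\<Sum>j\<in>UNIV. \<Sum>g\<in>Basis. \<Sum>k\<in>UNIV. \<Sum>f\<in>Basis. \<Sum>e\<in>Basis.
      T j f k e g)"
    by (intro sum.cong refl sum.swap)
  also have "\<dots> = (\<Sum>g\<in>Basis. \<Sum>j\<in>UNIV. \<Sum>k\<in>UNIV. \<Sum>f\<in>Basis. \<Sum>e\<in>Basis.
      T j f k e g)"
    by (rule sum.swap)
  also have "\<dots> = (\<Sum>g\<in>Basis. \<Sum>j\<in>UNIV. \<Sum>f\<in>Basis. \<Sum>k\<in>UNIV. \<Sum>e\<in>Basis.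
      T j f k e g)"
    by (intro sum.cong refl sum.swap)
  finally show ?thesis by (simp only: bil)
qed

lemma hess_det_jet:
  assumes "C2_jet \<phi> \<phi>' \<phi>''"
  obtains U l where "diagonalizes U l (qhessian \<phi> q)" "hess_det \<phi> q = (\<Prod>k\<in>UNIV. l $ k)"
  using quaternionic_spectral_theorem[OF hyperhermitian_qhessian[OF assms, of q]] moore_det_eq
  unfolding hess_det_def by metis

text \<open>If \<open>det \<ge> 0\<close> persists for all larger test functions, the Hessian itself is nonnegative: otherwise keep
one negative eigenvalue and make all the others positive by adding a quadratic polynomial that is
nonnegative and vanishes along the chosen eigenvector; the determinant becomes negative.\<close>

lemma nonneg_of_hess_det_nonneg:
  fixes \<phi> :: "quat^'n \<Rightarrow> real"
  assumes j: "C2_jet \<phi> \<phi>' \<phi>''" and D: "diagonalizes U l (qhessian \<phi> q)"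
    and stable: "\<And>\<psi> \<psi>' \<psi>''. C2_jet \<psi> \<psi>' \<psi>'' \<Longrightarrow> \<psi> q = \<phi> q \<Longrightarrow> (\<And>x. \<phi> x \<le> \<psi> x) \<Longrightarrow> 0 \<le> hess_det \<psi> q"
  shows "0 \<le> l $ m"
proof (rule ccontr)
  assume neg: "\<not> 0 \<le> l $ m"
  \<comment> \<open>Each \<open>s k\<close> enters the Hessian with factor \<open>8\<close>: two derivatives of a square, in four real directions.\<close>
  define s where "s k = (if k = m then 0 else (\<bar>l $ k\<bar> + 1) / 8)" for k
  have s0: "0 \<le> s k" for k by (simp add: s_def)
  define \<beta> where "\<beta> h h' = (\<Sum>k\<in>UNIV. s k * inner ((qadjoint U *v h) $ k) ((qadjoint U *v h') $ k))" for h h'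
  have lin: "linear (\<lambda>h. qadjoint U *v h)" by simp
  have "bilinear \<beta>"
    unfolding \<beta>_def bilinear_def
    by (auto intro!: linearI simp: linear_add[OF lin] linear_scale[OF lin] inner_add_left inner_add_right
        sum.distrib sum_distrib_left algebra_simps)
  then obtain p' p'' where p: "C2_jet (\<lambda>x. \<beta> (x - q) (x - q)) p' p''" "\<And>x h k. p'' x h k = 2 * \<beta> h k"
    by (rule C2_jet_quadratic) (auto simp: \<beta>_def inner_commute)
  define \<psi> where "\<psi> x = \<phi> x + \<beta> (x - q) (x - q)" for x
  have j\<psi>: "C2_jet \<psi> (\<lambda>x. \<phi>' x + p' x) (\<lambda>x. \<phi>'' x + p'' x)"
    unfolding \<psi>_def by (rule C2_jet_add[OF j p(1)])
  have \<beta>0: "0 \<le> \<beta> h h" for h by (auto simp: \<beta>_def s0 intro!: sum_nonneg)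
  have ge: "0 \<le> hess_det \<psi> q"
    by (rule stable[OF j\<psi>]) (use \<beta>0 in \<open>auto simp: \<psi>_def \<beta>_def\<close>)
  have norm1: "norm g = 1" if "g \<in> Basis" for g :: quat using that by simp
  have "diagonalizes U (\<chi> k. l $ k + 8 * s k) (qhessian \<psi> q)"
  proof (rule diagonalizesI[OF hyperhermitian_qhessian[OF j\<psi>]])
    show "qunitary U" using D by (simp add: diagonalizes_def)
    fix X
    have "(\<Sum>g\<in>Basis. \<beta> (rmult X g) (rmult X g)) = (\<Sum>g::quat\<in>Basis. \<Sum>k\<in>UNIV. s k * coord_sq U X k)"
    proof (rule sum.cong[OF refl])
      fix g :: quat assume "g \<in> Basis"
      then have "norm ((qadjoint U *v rmult X g) $ k) = norm ((qadjoint U *v X) $ k)" for k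
        by (simp add: mult_vec_rmult) (simp add: rmult_def quat_norm_mult)
      then show "\<beta> (rmult X g) (rmult X g) = (\<Sum>k\<in>UNIV. s k * coord_sq U X k)"
        by (simp add: \<beta>_def flip: power2_norm_eq_inner)
    qed
    then have b: "(\<Sum>g\<in>Basis. \<beta> (rmult X g) (rmult X g)) = 4 * (\<Sum>k\<in>UNIV. s k * coord_sq U X k)"
      by (simp add: DIM_quat)
    have "inner X (qhessian \<psi> q *v X) = inner X (qhessian \<phi> q *v X) + (\<Sum>g\<in>Basis. 2 * \<beta> (rmult X g) (rmult X g))"
      by (simp add: qhessian_form[OF j\<psi>] qhessian_form[OF j] blinfun.add_left p(2) sum.distrib)
    also have "(\<Sum>g\<in>Basis. 2 * \<beta> (rmult X g) (rmult X g)) = 8 * (\<Sum>k\<in>UNIV. s k * coord_sq U X k)"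
      by (simp add: b flip: sum_distrib_left)
    finally show "inner X (qhessian \<psi> q *v X) = (\<Sum>k\<in>UNIV. (\<chi> k. l $ k + 8 * s k) $ k * coord_sq U X k)"
      by (simp add: diagonalizes_form[OF D] distrib_right sum.distrib sum_distrib_left mult.assoc)
  qed
  then have "hess_det \<psi> q = (\<Prod>k\<in>UNIV. l $ k + 8 * s k)"
    by (simp add: hess_det_def moore_det_eq)
  also have "\<dots> = (l $ m + 8 * s m) * (\<Prod>k\<in>UNIV - {m}. l $ k + 8 * s k)"
    by (rule prod.remove) auto
  also have "\<dots> < 0"
  proof (rule mult_neg_pos)
    show "l $ m + 8 * s m < 0" using neg by (simp add: s_def)
    show "0 < (\<Prod>k\<in>UNIV - {m}. l $ k + 8 * s k)"
    proof (rule prod_pos)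
      fix k assume "k \<in> UNIV - {m}"
      then have "l $ k + 8 * s k = l $ k + \<bar>l $ k\<bar> + 1" by (simp add: s_def)
      then show "0 < l $ k + 8 * s k" using abs_ge_minus_self[of "l $ k"] by linarith
    qed
  qed
  finally show False using ge by simp
qed

section \<open>Mollified subsolutions of the determinant inequality\<close>

lemma C2_jet_second_derivative_limit:
  assumes j: "C2_jet f f' f''"
  shows "((\<lambda>t. (f (x + t *\<^sub>R d) + f (x - t *\<^sub>R d) - 2 * f x) / t^2) \<longlongrightarrow> f'' x d d) (at_right 0)"
proof (rule tendstoI)
  fix e :: real assume e: "0 < e"
  have c: "continuous_on UNIV (\<lambda>t::real. f'' (x + t *\<^sub>R d) d d)"
  proof -
    have "continuous_on UNIV (\<lambda>t::real. f'' (x + t *\<^sub>R d))"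
      by (rule continuous_on_compose2[where g=f'' and t=UNIV])
         (use j in \<open>auto simp: C2_jet_def intro!: continuous_intros\<close>)
    then show ?thesis by (intro continuous_intros)
  qed
  then have "isCont (\<lambda>t::real. f'' (x + t *\<^sub>R d) d d) 0"
    by (simp add: continuous_on_eq_continuous_at)
  then obtain \<delta> where \<delta>: "0 < \<delta>" "\<And>t. \<bar>t\<bar> < \<delta> \<Longrightarrow> \<bar>f'' (x + t *\<^sub>R d) d d - f'' x d d\<bar> < e"
    unfolding continuous_at_eps_delta using e by (auto simp: dist_real_def)
  have "dist ((f (x + t *\<^sub>R d) + f (x - t *\<^sub>R d) - 2 * f x) / t^2) (f'' x d d) < e"
    if t: "0 < t" "t < \<delta>" for t
  proof -
    obtain \<xi> where xi: "0 < \<xi>" "\<xi> < t"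
      "f (x + t *\<^sub>R d) + f (x - t *\<^sub>R d) - 2 * f x = t^2 / 2 * (f'' (x + \<xi> *\<^sub>R d) d d + f'' (x - \<xi> *\<^sub>R d) d d)"
      using C2_jet_second_difference[OF j t(1)] .
    have "\<bar>f'' (x + \<xi> *\<^sub>R d) d d - f'' x d d\<bar> < e" "\<bar>f'' (x - \<xi> *\<^sub>R d) d d - f'' x d d\<bar> < e"
      using \<delta>(2)[of \<xi>] \<delta>(2)[of "- \<xi>"] xi t by auto
    moreover have "\<bar>(a + b) / 2 - v\<bar> < e" if "\<bar>a - v\<bar> < e" "\<bar>b - v\<bar> < e" for a b v :: real
      using that by (auto simp: abs_less_iff field_simps)
    ultimately show ?thesis using t by (simp add: xi(3) dist_real_def)
  qed
  then show "\<forall>\<^sub>F t in at_right 0. dist ((f (x + t *\<^sub>R d) + f (x - t *\<^sub>R d) - 2 * f x) / t^2) (f'' x d d) < e"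
    unfolding eventually_at_right_field using \<delta>(1) by blast
qed

text \<open>The real directions whose second derivatives sum to the weighted trace of the quaternionic Hessian in the
frame given by the columns of \<open>V\<close>.\<close>

definition frame_dirs :: "quat^'n^'n \<Rightarrow> ('n \<Rightarrow> real) \<Rightarrow> 'n \<times> quat \<Rightarrow> quat^'n" where
  "frame_dirs V b = (\<lambda>(j, g). rmult (sqrt (b j) *\<^sub>R (V *v axis j 1)) g)"

lemma norm_rmult: "norm (rmult X g) = norm X * norm g"
proof -
  have "(norm (rmult X g))^2 = (norm X * norm g)^2"
    by (simp add: norm_vec_sq rmult_def quat_norm_mult power_mult_distrib sum_distrib_right)
  then show ?thesis by (simp add: power2_eq_iff_nonneg)
qed

lemma frame_dirsum:
  fixes \<phi> :: "quat^'n \<Rightarrow> real"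
  assumes "C2_jet \<phi> \<phi>' \<phi>''" "\<And>j. 0 < b j"
  shows "dirsum (UNIV \<times> Basis) (frame_dirs V b) \<phi>'' x
    = (\<Sum>j\<in>UNIV. b j * inner (V *v axis j 1) (qhessian \<phi> x *v (V *v axis j 1)))"
proof -
  have sc: "rmult (c *\<^sub>R X) g = c *\<^sub>R rmult X g" for c and X :: "quat^'n" and g
    by (simp add: rmult_def vec_eq_iff)
  have "0 \<le> b j" for j using assms(2)[of j] by simp
  then have "dirsum (UNIV \<times> Basis) (frame_dirs V b) \<phi>'' x
    = (\<Sum>j\<in>UNIV. \<Sum>g\<in>Basis. b j * \<phi>'' x (rmult (V *v axis j 1) g) (rmult (V *v axis j 1) g))"
    by (simp add: dirsum_def frame_dirs_def sc sum.cartesian_product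
        blinfun.scaleR_left blinfun.scaleR_right split_beta flip: mult.assoc)
  then show ?thesis by (simp add: qhessian_form[OF assms(1)] sum_distrib_left)
qed

text \<open>A viscosity subsolution of \<open>det \<ge> c\<^sup>n\<close> is a viscosity subsolution of every linear equation
\<open>tr (B Hess) \<ge> n c (det B)\<^sup>1\<^sup>/\<^sup>n\<close>.\<close>

lemma hess_det_lower_bound_imp_dirsum:
  fixes \<phi> :: "quat^'n \<Rightarrow> real" and c \<beta> :: real
  assumes j: "C2_jet \<phi> \<phi>' \<phi>''" and V: "qunitary V"
    and stable: "\<And>\<psi> \<psi>' \<psi>''. C2_jet \<psi> \<psi>' \<psi>'' \<Longrightarrow> \<psi> q = \<phi> q \<Longrightarrow> (\<And>x. \<phi> x \<le> \<psi> x) \<Longrightarrow>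
       c ^ CARD('n) \<le> hess_det \<psi> q"
    and b: "\<And>j. 0 < b j" "0 < \<beta>" "\<beta> ^ CARD('n) = (\<Prod>j\<in>UNIV. b j)" and c: "0 \<le> c"
  shows "CARD('n) * (c * \<beta>) \<le> dirsum (UNIV \<times> Basis) (frame_dirs V b) \<phi>'' q"
proof -
  obtain U l where U: "diagonalizes U l (qhessian \<phi> q)" "hess_det \<phi> q = (\<Prod>k\<in>UNIV. l $ k)"
    using hess_det_jet[OF j] .
  have "0 \<le> hess_det \<psi> q" if "C2_jet \<psi> \<psi>' \<psi>''" "\<psi> q = \<phi> q" "\<And>x. \<phi> x \<le> \<psi> x" for \<psi> \<psi>' \<psi>''
    using stable[OF that] c by (meson order_trans zero_le_power)
  then have l: "0 \<le> l $ k" for k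
    using nonneg_of_hess_det_nonneg[OF j U(1)] by blast
  have "c ^ CARD('n) \<le> (\<Prod>k\<in>UNIV. l $ k)" using stable[OF j] U(2) by simp
  then show ?thesis
    unfolding frame_dirsum[OF j b(1)] by (intro weighted_trace_lower_bound[OF U(1) l V b c])
qed

text \<open>The linear inequality for the mollification at \<open>q\<close> needs the viscosity inequality only near \<open>q\<close>. To
localize, replace \<open>w\<close> by \<open>max p w\<close> where \<open>p\<close> is a steep quadratic polynomial, below \<open>w\<close> near \<open>q\<close> and
above \<open>w\<close> away from \<open>q\<close>. The function \<open>z = max p w - p\<close> has compact support, satisfies a linear viscosity
inequality where it is positive, and differs from \<open>w\<close> near \<open>q\<close> by \<open>p\<close> only.\<close>

lemma mollify_frame_dirsum_ge:
  fixes w :: "quat^'n \<Rightarrow> real" and c \<beta> :: real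
  assumes K: "mollify_kernel s \<rho> \<rho>' \<rho>''" and s: "0 < R" "s \<le> R / 4"
    and wc: "continuous_on UNIV w" and w0: "\<And>x. 0 \<le> w x" and wB: "\<And>x. w x \<le> B"
    and sub: "\<And>\<phi> \<phi>' \<phi>'' x. C2_jet \<phi> \<phi>' \<phi>'' \<Longrightarrow> norm (x - q) < R \<Longrightarrow> \<phi> x = w x \<Longrightarrow> (\<And>y. w y \<le> \<phi> y) \<Longrightarrow>
       c ^ CARD('n) \<le> hess_det \<phi> x"
    and j: "C2_jet (mollify \<rho> w) g' g''" and V: "qunitary V"
    and b: "\<And>j. 0 < b j" "0 < \<beta>" "\<beta> ^ CARD('n) = (\<Prod>j\<in>UNIV. b j)" and c: "0 \<le> c"
  shows "CARD('n) * (c * \<beta>) \<le> dirsum (UNIV \<times> Basis) (frame_dirs V b) g'' q"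
proof -
  let ?m = "mollify \<rho>"
  let ?I = "UNIV \<times> Basis :: ('n \<times> quat) set"
  let ?d = "frame_dirs V b"
  let ?t = "real CARD('n) * (c * \<beta>)"
  define S where "S = (\<Sum>i\<in>?I. (norm (?d i))^2)"
  have "norm (?d (undefined, 1)) = sqrt (b undefined)"
    using b(1)[of undefined] by (simp add: frame_dirs_def norm_rmult qunitary_norm[OF V] norm_axis_one)
  then have "0 < (norm (?d (undefined, 1)))^2" using b(1)[of undefined] by simp
  also have "\<dots> \<le> S"
    unfolding S_def by (rule member_le_sum) (auto simp: Basis_quat_def)
  finally have S: "0 < S" .
  have B0: "0 \<le> B" using w0 wB order_trans by blast
  \<comment> \<open>The first summand makes \<open>p\<close> exceed the bound \<open>B\<close> at distance \<open>R\<close>, the second makes the constant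
    \<open>2 A S - ?t\<close> of the linear inequality for \<open>z\<close> nonnegative.\<close>
  define A where "A = 4 * B / (3 * R^2) + ?t / (2 * S)"
  have t0: "0 \<le> ?t" using b(2) c by simp
  have A0: "0 \<le> A" using B0 s t0 S by (simp add: A_def)
  have AB: "B \<le> A * (3 * R^2 / 4)"
  proof -
    have "B = 4 * B / (3 * R^2) * (3 * R^2 / 4)" using s by simp
    also have "\<dots> \<le> A * (3 * R^2 / 4)"
      using t0 S by (intro mult_right_mono) (simp_all add: A_def)
    finally show ?thesis .
  qed
  have AS: "?t \<le> 2 * A * S"
  proof -
    have "?t = 2 * (?t / (2 * S)) * S" using S by simp
    also have "\<dots> \<le> 2 * A * S"
      using B0 S by (intro mult_right_mono mult_left_mono) (simp_all add: A_def)
    finally show ?thesis .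
  qed
  define p where "p x = A * (norm (x - q))^2 + (- (A * R^2 / 4))" for x
  obtain p0' p0'' where p0: "C2_jet (\<lambda>x. A * (norm (x - q))^2) p0' p0''" "\<And>x h k. p0'' x h k = 2 * A * (inner h k)"
    using C2_jet_dist_sq[of A q] by blast
  have jp: "C2_jet p (\<lambda>x. p0' x + 0) (\<lambda>x. p0'' x + 0)"
    unfolding p_def by (rule C2_jet_add[OF p0(1) C2_jet_const])
  have pin: "p x \<le> 0" if "norm (x - q) \<le> R / 2" for x
  proof -
    have "(norm (x - q))^2 \<le> (R / 2)^2" using that by (intro power_mono) auto
    then have "A * (norm (x - q))^2 \<le> A * (R^2 / 4)"
      using A0 by (intro mult_left_mono) (auto simp: power_divide)
    then show ?thesis by (simp add: p_def)
  qed
  have pout: "w x \<le> p x" if "R \<le> norm (x - q)" for x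
  proof -
    have "R^2 \<le> (norm (x - q))^2" using that s by (intro power_mono) auto
    then have "A * R^2 \<le> A * (norm (x - q))^2" using A0 by (intro mult_left_mono)
    then show ?thesis using AB wB[of x] by (simp add: p_def)
  qed
  define z where "z x = max 0 (w x - p x)" for x
  have zc: "continuous_on UNIV z"
    unfolding z_def by (intro continuous_intros wc C2_jet_continuous[OF jp])
  have z0: "0 \<le> z x" for x by (simp add: z_def)
  have zR: "z x = 0" if "norm q + R < norm x" for x
    using pout[of x] norm_triangle_sub[of x q] that by (auto simp: z_def)
  obtain h' h'' where h: "C2_jet (?m z) h' h''" "isUCont h''" "bounded (range h'')"
    using mollify_C2_jet[of _ _ _ _ z "norm q + R"] K zc zR by metis
  have "- (2 * A * S - ?t) \<le> dirsum ?I ?d h'' q"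
  proof (rule mollify_subsolution[OF K _ _ zc z0 zR _ _ h])
    show "0 \<le> 2 * A * S - ?t" using AS by simp
    fix \<phi> \<phi>' \<phi>'' x
    assume \<phi>: "C2_jet \<phi> \<phi>' \<phi>''" "\<And>y. z y \<le> \<phi> y" "z x = \<phi> x" "0 < z x"
    have xR: "norm (x - q) < R" using pout[of x] \<phi>(4) by (force simp: z_def not_less[symmetric])
    have j\<phi>: "C2_jet (\<lambda>x. \<phi> x + p x) (\<lambda>x. \<phi>' x + (p0' x + 0)) (\<lambda>x. \<phi>'' x + (p0'' x + 0))"
      by (rule C2_jet_add[OF \<phi>(1) jp])
    have "?t \<le> dirsum ?I ?d (\<lambda>x. \<phi>'' x + (p0'' x + 0)) x"
    proof (rule hess_det_lower_bound_imp_dirsum[OF j\<phi> V _ b c])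
      fix \<psi> \<psi>' \<psi>''
      assume \<psi>: "C2_jet \<psi> \<psi>' \<psi>''" "\<psi> x = \<phi> x + p x" "\<And>y. \<phi> y + p y \<le> \<psi> y"
      show "c ^ CARD('n) \<le> hess_det \<psi> x"
      proof (rule sub[OF \<psi>(1) xR])
        show "\<psi> x = w x" using \<psi>(2) \<phi>(3,4) by (simp add: z_def max_def split: if_splits)
        show "w y \<le> \<psi> y" for y using \<psi>(3)[of y] \<phi>(2)[of y] by (simp add: z_def)
      qed
    qed
    also have "\<dots> = dirsum ?I ?d \<phi>'' x + 2 * A * S"
      by (simp add: dirsum_def blinfun.add_left p0(2) sum.distrib S_def power2_norm_eq_inner sum_distrib_left)
    finally show "- (2 * A * S - ?t) \<le> dirsum ?I ?d \<phi>'' x" by simp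
  qed auto
  \<comment> \<open>Second differences of the two mollifications at \<open>q\<close> are compared under the integral: the difference
    \<open>w - z\<close> is the quadratic \<open>p\<close> there, whose second differences are constant.\<close>
  moreover have "g'' q e e = h'' q e e + 2 * A * (norm e)^2" for e
  proof -
    let ?Q = "\<lambda>f t. (?m f (q + t *\<^sub>R e) + ?m f (q - t *\<^sub>R e) - 2 * ?m f q) / t^2"
    have eq: "?m w (q + k) + ?m w (q - k) - 2 * ?m w q
        = ?m z (q + k) + ?m z (q - k) - 2 * ?m z q + 2 * A * (norm k)^2"
      if k: "norm k \<le> R / 4" for k
    proof -
      let ?\<Delta> = "\<lambda>f x. (f (x + k) + f (x + - k)) + (-2) * f x"
      have D: "?m (\<lambda>x. ?\<Delta> f x) q
        = ?m f (q + k) + ?m f (q - k) - 2 * ?m f q"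
        and Dc: "continuous_on UNIV (\<lambda>x. ?\<Delta> f x)"
        if fc: "continuous_on UNIV f" for f
      proof -
        have ft: "continuous_on UNIV (\<lambda>x. f (x + a))" for a
          by (intro continuous_intros continuous_on_compose2[OF fc]) auto
        show "continuous_on UNIV (\<lambda>x. ?\<Delta> f x)"
          by (intro continuous_on_add continuous_on_mult continuous_on_const ft fc)
        show "?m (\<lambda>x. ?\<Delta> f x) q
          = ?m f (q + k) + ?m f (q - k) - 2 * ?m f q"
          by (subst mollify_add[OF K], intro continuous_on_add ft, intro continuous_on_mult continuous_on_const fc,
              subst mollify_add[OF K ft ft], subst mollify_scale[OF K])
             (simp only: mollify_translate[OF K], simp)
      qed
      have pt: "?\<Delta> w (q - y)
         = ?\<Delta> z (q - y) + 2 * A * (norm k)^2"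
        if y: "norm y \<le> s" for y
      proof -
        have "norm (q - y + k - q) \<le> norm y + norm k" "norm (q - y + - k - q) \<le> norm y + norm k"
          "norm (q - y - q) \<le> norm y"
          using norm_triangle_ineq[of "- y" k] norm_triangle_ineq[of "- y" "- k"] by auto
        then have "p (q - y + k) \<le> 0" "p (q - y + - k) \<le> 0" "p (q - y) \<le> 0"
          using y k s by (intro pin; linarith)+
        then have "z (q - y + k) = w (q - y + k) - p (q - y + k)"
          "z (q - y + - k) = w (q - y + - k) - p (q - y + - k)"
          "z (q - y) = w (q - y) - p (q - y)"
          using w0[of "q - y + k"] w0[of "q - y + - k"] w0[of "q - y"] by (simp_all add: z_def)
        moreover have "p (q - y + k) + p (q - y + - k) + (-2) * p (q - y) = 2 * A * (norm k)^2"
        proof -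
          have "(norm (- y + k))^2 + (norm (- y + - k))^2 - 2 * (norm (- y))^2 = 2 * (norm k)^2"
            unfolding power2_norm_eq_inner by (simp add: inner_add_left inner_add_right inner_diff_left inner_diff_right inner_commute)
          from arg_cong[OF this, of "\<lambda>t. A * t"] show ?thesis
            by (simp add: p_def algebra_simps)
        qed
        ultimately show ?thesis by linarith
      qed
      have "?m (\<lambda>x. ?\<Delta> w x) q
        = ?m (\<lambda>x. ?\<Delta> z x + 2 * A * (norm k)^2) q"
        by (intro antisym mollify_mono[OF K] Dc wc zc continuous_on_add continuous_on_const) (simp_all only: pt order_refl)
      also have "\<dots> = ?m (\<lambda>x. ?\<Delta> z x) q + 2 * A * (norm k)^2"
        by (simp only: mollify_add[OF K Dc[OF zc] continuous_on_const] mollify_const[OF K])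
      finally show ?thesis unfolding D[OF wc] D[OF zc] .
    qed
    have "((\<lambda>t. ?Q w t)
        \<longlongrightarrow> h'' q e e + 2 * A * (norm e)^2) (at_right 0)"
    proof (rule Lim_transform_eventually)
      show "((\<lambda>t. ?Q z t + 2 * A * (norm e)^2)
        \<longlongrightarrow> h'' q e e + 2 * A * (norm e)^2) (at_right 0)"
        by (intro tendsto_add tendsto_const C2_jet_second_derivative_limit[OF h(1)])
      define t0 where "t0 = R / (4 * (norm e + 1))"
      have t0: "0 < t0" using s by (simp add: t0_def add_nonneg_pos)
      have "?Q z t + 2 * A * (norm e)^2
        = ?Q w t"
        if t: "0 < t" "t < t0" for t
      proof -
        have "norm (t *\<^sub>R e) \<le> t * (norm e + 1)" using t by simp
        also have "\<dots> \<le> t0 * (norm e + 1)" using t by (intro mult_right_mono) auto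
        also have "\<dots> = R / 4" using add_nonneg_pos[OF norm_ge_zero[of e] zero_less_one] by (simp add: t0_def divide_simps)
        finally show ?thesis using t by (simp add: eq add_divide_distrib power_mult_distrib)
      qed
      then show "\<forall>\<^sub>F t in at_right 0. ?Q z t + 2 * A * (norm e)^2
        = ?Q w t"
        unfolding eventually_at_right_field using t0 by blast
    qed
    then show ?thesis
      by (rule tendsto_unique[OF trivial_limit_at_right_real C2_jet_second_derivative_limit[OF j]])
  qed
  then have "dirsum ?I ?d g'' q = dirsum ?I ?d h'' q + 2 * A * S"
    by (simp add: dirsum_def S_def sum.distrib sum_distrib_left)
  ultimately show ?thesis by linarith
qed

text \<open>By concavity of \<open>det\<^sup>1\<^sup>/\<^sup>n\<close>, in the guise of the linear inequalities, mollification preserves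
\<open>det \<ge> c\<^sup>n\<close>. It is enough to use the frame that diagonalizes the Hessian of the mollification.\<close>

lemma mollify_eigenvalues:
  fixes w :: "quat^'n \<Rightarrow> real" and c :: real
  assumes K: "mollify_kernel s \<rho> \<rho>' \<rho>''" and s: "0 < R" "s \<le> R / 4"
    and wc: "continuous_on UNIV w" and w0: "\<And>x. 0 \<le> w x" and wB: "\<And>x. w x \<le> B"
    and sub: "\<And>\<phi> \<phi>' \<phi>'' x. C2_jet \<phi> \<phi>' \<phi>'' \<Longrightarrow> norm (x - q) < R \<Longrightarrow> \<phi> x = w x \<Longrightarrow> (\<And>y. w y \<le> \<phi> y) \<Longrightarrow>
       c ^ CARD('n) \<le> hess_det \<phi> x"
    and j: "C2_jet (mollify \<rho> w) g' g''" and c: "0 \<le> c"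
    and D: "diagonalizes U l (qhessian (mollify \<rho> w) q)"
  shows "0 \<le> l $ k" and "0 < \<epsilon> \<Longrightarrow> c ^ CARD('n) \<le> (\<Prod>k\<in>UNIV. l $ k + \<epsilon>)"
proof -
  have U: "qunitary U" using D by (simp add: diagonalizes_def)
  have "real CARD('n) * (c * \<beta>) \<le> (\<Sum>k\<in>UNIV. b k * l $ k)"
    if b: "\<And>j. 0 < b j" "0 < \<beta>" "\<beta> ^ CARD('n) = (\<Prod>j\<in>UNIV. b j)" for b and \<beta> :: real
  proof -
    have "real CARD('n) * (c * \<beta>) \<le> dirsum (UNIV \<times> Basis) (frame_dirs U b) g'' q"
      by (rule mollify_frame_dirsum_ge[OF K s wc w0 wB sub j U b c])
    then show ?thesis by (simp add: frame_dirsum[OF j b(1)] diagonalizes_column[OF D])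
  qed
  note * = prod_ge_of_weighted_sums[of c "\<lambda>k. l $ k", OF c this]
  show "0 \<le> l $ k" by (rule *(1))
  show "0 < \<epsilon> \<Longrightarrow> c ^ CARD('n) \<le> (\<Prod>k\<in>UNIV. l $ k + \<epsilon>)" by (rule *(2))
qed

lemma hess_det_plus_add_dist_sq:
  fixes g :: "quat^'n \<Rightarrow> real"
  assumes j: "C2_jet g g' g''" and D: "diagonalizes U l (qhessian g q)" and l: "\<And>k. 0 \<le> l $ k" and "0 \<le> \<epsilon>"
  obtains \<psi>' \<psi>'' where "C2_jet (\<lambda>x. g x + \<epsilon> * (norm x)^2 + a) \<psi>' \<psi>''"
    "hess_det_plus (\<lambda>x. g x + \<epsilon> * (norm x)^2 + a) q = (\<Prod>k\<in>UNIV. l $ k + 8 * \<epsilon>)"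
proof -
  let ?\<psi> = "\<lambda>x. g x + \<epsilon> * (norm x)^2 + a"
  obtain p' p'' where p: "C2_jet (\<lambda>x::quat^'n. \<epsilon> * (norm (x - 0))^2) p' p''" "\<And>x h k. p'' x h k = 2 * \<epsilon> * (inner h k)"
    using C2_jet_dist_sq[of \<epsilon> 0] by blast
  have j\<psi>: "C2_jet ?\<psi> (\<lambda>x. g' x + p' x + 0) (\<lambda>x. g'' x + p'' x + 0)"
    using C2_jet_add[OF C2_jet_add[OF j p(1)] C2_jet_const[of a]] by simp
  have U: "qunitary U" using D by (simp add: diagonalizes_def)
  have form: "inner X (qhessian ?\<psi> q *v X) = inner X (qhessian g q *v X) + 8 * \<epsilon> * (norm X)^2" for X
  proof -
    have "(\<Sum>g::quat\<in>Basis. (norm (rmult X g))^2) = (\<Sum>g::quat\<in>Basis. (norm X)^2)"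
      by (rule sum.cong) (simp_all add: norm_rmult)
    then have "(\<Sum>g::quat\<in>Basis. (norm (rmult X g))^2) = 4 * (norm X)^2" by (simp add: DIM_quat)
    then have "(\<Sum>g\<in>Basis. p'' q (rmult X g) (rmult X g)) = 8 * \<epsilon> * (norm X)^2"
      by (simp add: p(2) flip: power2_norm_eq_inner sum_distrib_left)
    then show ?thesis
      by (simp add: qhessian_form[OF j\<psi>] qhessian_form[OF j] blinfun.add_left sum.distrib)
  qed
  have "diagonalizes U (\<chi> k. l $ k + 8 * \<epsilon>) (qhessian ?\<psi> q)"
  proof (rule diagonalizesI[OF hyperhermitian_qhessian[OF j\<psi>] U])
    fix X
    have "(norm X)^2 = (\<Sum>k\<in>UNIV. coord_sq U X k)"
      using qunitary_norm(2)[OF U, of X] by (simp flip: norm_vec_sq)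
    then show "inner X (qhessian ?\<psi> q *v X) = (\<Sum>k\<in>UNIV. (\<chi> k. l $ k + 8 * \<epsilon>) $ k * coord_sq U X k)"
      by (simp add: form diagonalizes_form[OF D] distrib_right sum.distrib flip: sum_distrib_left)
  qed
  then have "hess_det ?\<psi> q = (\<Prod>k\<in>UNIV. l $ k + 8 * \<epsilon>)"
    by (simp add: hess_det_def moore_det_eq)
  moreover have "0 \<le> inner X (qhessian g q *v X)" for X
    unfolding diagonalizes_form[OF D] using l by (intro sum_nonneg mult_nonneg_nonneg) auto
  then have "hyperhermitian_nonneg (qhessian ?\<psi> q)"
    unfolding hyperhermitian_nonneg_iff using hyperhermitian_qhessian[OF j\<psi>] \<open>0 \<le> \<epsilon>\<close> by (simp add: form)
  ultimately show thesis using j\<psi> by (intro that) (auto simp: hess_det_plus_def)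
qed

section \<open>Sup-convolution\<close>

lemma usc_attains_max:
  fixes f :: "'a::metric_space \<Rightarrow> real"
  assumes D: "compact D" "D \<noteq> {}"
    and usc: "\<And>x a. x \<in> D \<Longrightarrow> f x < a \<Longrightarrow> \<exists>e>0. \<forall>y\<in>ball x e \<inter> D. f y < a"
  obtains m where "m \<in> D" "\<And>y. y \<in> D \<Longrightarrow> f y \<le> f m"
proof -
  have "\<exists>m\<in>D. \<forall>y\<in>D. f y \<le> f m"
  proof (rule ccontr)
    assume no: "\<not> ?thesis"
    have "\<exists>e>0. \<exists>x'\<in>D. \<forall>y\<in>ball x e \<inter> D. f y < f x'" if x: "x \<in> D" for x
    proof -
      obtain x' where "x' \<in> D" "f x < f x'" using no x by (meson not_le)
      then show ?thesis using usc[OF x, of "f x'"] by blast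
    qed
    then obtain e t where et: "\<And>x. x \<in> D \<Longrightarrow> 0 < e x" "\<And>x. x \<in> D \<Longrightarrow> t x \<in> D"
      "\<And>x y. x \<in> D \<Longrightarrow> y \<in> ball x (e x) \<Longrightarrow> y \<in> D \<Longrightarrow> f y < f (t x)"
      by (metis IntI)
    have "D \<subseteq> (\<Union>x\<in>D. ball x (e x))" using et(1) by force
    then obtain C where C: "C \<subseteq> D" "finite C" "D \<subseteq> (\<Union>x\<in>C. ball x (e x))"
      using compactE_image[OF D(1), of D "\<lambda>x. ball x (e x)"] by (metis open_ball)
    have "C \<noteq> {}" using C(3) D(2) by auto
    then obtain x where x: "x \<in> C" "\<And>y. y \<in> C \<Longrightarrow> f (t y) \<le> f (t x)"
      using C(2) Max_in[of "(\<lambda>x. f (t x)) ` C"] Max_ge[of "(\<lambda>x. f (t x)) ` C"] by fastforce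
    have "t x \<in> D" using x C(1) et(2) by blast
    then obtain y where y: "y \<in> C" "t x \<in> ball y (e y)" using C(3) by blast
    have "f (t x) < f (t y)" using y C(1) \<open>t x \<in> D\<close> et(3) by blast
    then show False using x(2)[OF y(1)] by simp
  qed
  then show thesis using that by blast
qed

lemma usc_plus_continuous_attains_max:
  fixes f g :: "'a::metric_space \<Rightarrow> real"
  assumes D: "compact D" "D \<noteq> {}"
    and usc: "\<And>x a. x \<in> D \<Longrightarrow> f x < a \<Longrightarrow> \<exists>e>0. \<forall>y\<in>ball x e \<inter> D. f y < a"
    and g: "continuous_on D g"
  obtains m where "m \<in> D" "\<And>y. y \<in> D \<Longrightarrow> f y + g y \<le> f m + g m"
proof -
  have "\<exists>e>0. \<forall>y\<in>ball x e \<inter> D. f y + g y < a" if x: "x \<in> D" "f x + g x < a" for x a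
  proof -
    define \<eta> where "\<eta> = (a - (f x + g x)) / 2"
    have \<eta>: "0 < \<eta>" "a = f x + g x + 2 * \<eta>" using x by (simp_all add: \<eta>_def field_simps)
    obtain e1 where e1: "e1 > 0" "\<forall>y\<in>ball x e1 \<inter> D. f y < f x + \<eta>"
      using usc[OF x(1), of "f x + \<eta>"] \<eta>(1) by auto
    obtain e2 where e2: "e2 > 0" "\<forall>y\<in>D. dist y x < e2 \<longrightarrow> dist (g y) (g x) < \<eta>"
      using g x(1) \<eta>(1) unfolding continuous_on_iff by blast
    have "f y + g y < a" if y: "y \<in> ball x (min e1 e2) \<inter> D" for y
    proof -
      have "f y < f x + \<eta>" using e1 y by auto
      moreover have "dist y x < e2" "y \<in> D" using y by (simp_all add: dist_commute)
      then have "g y < g x + \<eta>" using e2(2) by (force simp: dist_real_def)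
      ultimately show ?thesis using \<eta>(2) by linarith
    qed
    then show ?thesis using e1(1) e2(1) by (intro exI[of _ "min e1 e2"]) auto
  qed
  then show thesis using usc_attains_max[OF D, of "\<lambda>x. f x + g x"] that by blast
qed

text \<open>Sup-convolution regularizes an upper semicontinuous subsolution to a continuous one lying above it.
Continuity is what allows mollification to approximate uniformly.\<close>

definition sup_convolution :: "'a::euclidean_space set \<Rightarrow> ('a \<Rightarrow> real) \<Rightarrow> real \<Rightarrow> 'a \<Rightarrow> real" where
  "sup_convolution \<Omega> U \<alpha> x = (SUP y\<in>\<Omega>. U y - \<alpha> * (norm (x - y))^2)"

context
  fixes \<Omega> :: "'a::euclidean_space set" and U :: "'a \<Rightarrow> real" and M \<alpha> :: real
  assumes ne: "\<Omega> \<noteq> {}" and bd: "bounded \<Omega>" and M: "\<And>x. x \<in> \<Omega> \<Longrightarrow> \<bar>U x\<bar> \<le> M" and \<alpha>: "0 < \<alpha>"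
begin

lemma penalized_le: "y \<in> \<Omega> \<Longrightarrow> U y - \<alpha> * (norm (x - y))^2 \<le> M"
proof -
  assume "y \<in> \<Omega>"
  then have "U y \<le> M" using M[of y] by linarith
  moreover have "0 \<le> \<alpha> * (norm (x - y))^2" using \<alpha> by simp
  ultimately show ?thesis by linarith
qed

lemma sup_convolution_bdd: "bdd_above ((\<lambda>y. U y - \<alpha> * (norm (x - y))^2) ` \<Omega>)"
  by (rule bdd_aboveI2[OF penalized_le])

lemma sup_convolution_upper: "y \<in> \<Omega> \<Longrightarrow> U y - \<alpha> * (norm (x - y))^2 \<le> sup_convolution \<Omega> U \<alpha> x"
  unfolding sup_convolution_def by (rule cSUP_upper[OF _ sup_convolution_bdd])

lemma sup_convolution_least: "(\<And>y. y \<in> \<Omega> \<Longrightarrow> U y - \<alpha> * (norm (x - y))^2 \<le> c) \<Longrightarrow> sup_convolution \<Omega> U \<alpha> x \<le> c"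
  unfolding sup_convolution_def by (rule cSUP_least[OF ne])

lemma sup_convolution_le_M: "sup_convolution \<Omega> U \<alpha> x \<le> M"
  by (rule sup_convolution_least[OF penalized_le])

lemma sup_convolution_continuous: "continuous_on UNIV (sup_convolution \<Omega> U \<alpha>)"
proof -
  obtain R where R: "\<And>y. y \<in> \<Omega> \<Longrightarrow> norm y \<le> R" using bd by (auto simp: bounded_iff)
  have lip: "sup_convolution \<Omega> U \<alpha> x \<le> sup_convolution \<Omega> U \<alpha> x' + \<alpha> * (norm (x - x') * (norm x + norm x' + 2 * R))" for x x'
  proof (rule sup_convolution_least)
    fix y assume y: "y \<in> \<Omega>"
    have "(norm (x' - y))^2 - (norm (x - y))^2 = (norm (x' - y) - norm (x - y)) * (norm (x' - y) + norm (x - y))"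
      by (simp add: power2_eq_square algebra_simps)
    also have "\<dots> \<le> norm (x - x') * (norm x + norm x' + 2 * R)"
    proof -
      have "norm (x' - y) - norm (x - y) \<le> norm (x - x')"
        using norm_triangle_ineq2[of "x' - y" "x - y"] by (simp add: norm_minus_commute)
      moreover have "norm (x' - y) + norm (x - y) \<le> norm x + norm x' + 2 * R"
        using norm_triangle_ineq4[of x' y] norm_triangle_ineq4[of x y] R[OF y] by linarith
      ultimately show ?thesis by (intro mult_mono) auto
    qed
    finally have "\<alpha> * ((norm (x' - y))^2 - (norm (x - y))^2) \<le> \<alpha> * (norm (x - x') * (norm x + norm x' + 2 * R))"
      using \<alpha> by (intro mult_left_mono) auto
    then show "U y - \<alpha> * (norm (x - y))^2 \<le> sup_convolution \<Omega> U \<alpha> x' + \<alpha> * (norm (x - x') * (norm x + norm x' + 2 * R))"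
      using sup_convolution_upper[OF y, of x'] by (simp add: right_diff_distrib)
  qed
  have "(sup_convolution \<Omega> U \<alpha> \<longlongrightarrow> sup_convolution \<Omega> U \<alpha> x) (at x)" for x
  proof (rule LIM_zero_cancel, rule Lim_null_comparison)
    show "\<forall>\<^sub>F y in at x. norm (sup_convolution \<Omega> U \<alpha> y - sup_convolution \<Omega> U \<alpha> x) \<le> \<alpha> * (norm (x - y) * (norm x + norm y + 2 * R))"
      using lip[of x] lip[of _ x]
      by (intro always_eventually allI) (auto simp: abs_le_iff norm_minus_commute algebra_simps)
    have "((\<lambda>y. \<alpha> * (norm (x - y) * (norm x + norm y + 2 * R))) \<longlongrightarrow> \<alpha> * (norm (x - x) * (norm x + norm x + 2 * R))) (at x)"
      by (intro tendsto_intros)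
    then show "((\<lambda>y. \<alpha> * (norm (x - y) * (norm x + norm y + 2 * R))) \<longlongrightarrow> 0) (at x)" by simp
  qed
  then show ?thesis by (simp add: continuous_on_def)
qed

text \<open>Points further than \<open>r\<close> from \<open>x\<close> are penalized by more than the oscillation \<open>2 M\<close> of \<open>U\<close>.\<close>

lemma sup_convolution_attained:
  assumes usc: "\<And>x a. x \<in> \<Omega> \<Longrightarrow> U x < a \<Longrightarrow> \<exists>e>0. \<forall>y\<in>ball x e \<inter> \<Omega>. U y < a"
    and r: "0 < r" "cball x r \<subseteq> \<Omega>" "2 * M < \<alpha> * r^2"
  obtains y where "y \<in> cball x r" "sup_convolution \<Omega> U \<alpha> x = U y - \<alpha> * (norm (x - y))^2"
proof -
  obtain y where y: "y \<in> cball x r"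
    "\<And>z. z \<in> cball x r \<Longrightarrow> U z + - (\<alpha> * (norm (x - z))^2) \<le> U y + - (\<alpha> * (norm (x - y))^2)"
  proof (rule usc_plus_continuous_attains_max[of "cball x r" U "\<lambda>z. - (\<alpha> * (norm (x - z))^2)"])
    show "cball x r \<noteq> {}" using r(1) by simp
    show "continuous_on (cball x r) (\<lambda>z. - (\<alpha> * (norm (x - z))^2))" by (intro continuous_intros)
    show "\<exists>e>0. \<forall>z\<in>ball y e \<inter> cball x r. U z < a" if "y \<in> cball x r" "U y < a" for y a
      using usc[of y a] that r(2) by blast
  qed (use that in auto)
  have x: "x \<in> cball x r" using r by simp
  have "sup_convolution \<Omega> U \<alpha> x \<le> U y - \<alpha> * (norm (x - y))^2"
  proof (rule sup_convolution_least)
    fix z assume z: "z \<in> \<Omega>"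
    show "U z - \<alpha> * (norm (x - z))^2 \<le> U y - \<alpha> * (norm (x - y))^2"
    proof (cases "z \<in> cball x r")
      case False
      then have "r^2 \<le> (norm (x - z))^2" using r(1) by (intro power_mono) (auto simp: dist_norm)
      then have "\<alpha> * r^2 \<le> \<alpha> * (norm (x - z))^2" using \<alpha> by (intro mult_left_mono) auto
      moreover have "U z \<le> M" "- M \<le> U x" using M[OF z] M[OF subsetD[OF r(2) x]] by (simp_all add: abs_le_iff)
      moreover have "U x \<le> U y - \<alpha> * (norm (x - y))^2" using y(2)[OF x] by simp
      ultimately show ?thesis using r(3) by linarith
    qed (use y(2) in simp)
  qed
  moreover have "U y - \<alpha> * (norm (x - y))^2 \<le> sup_convolution \<Omega> U \<alpha> x"
    using y r(2) by (intro sup_convolution_upper) auto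
  ultimately show thesis using that y(1) by force
qed

end

lemma qhessian_translate:
  assumes "C2_jet \<phi> \<phi>' \<phi>''"
  shows "qhessian (\<lambda>x. \<phi> (x + a) + c) q = qhessian \<phi> (q + a)"
  using qhessian_jet[OF C2_jet_add[OF C2_jet_translate[OF assms, of a] C2_jet_const[of c]]] qhessian_jet[OF assms]
  by (simp add: vec_eq_iff)

text \<open>If the supremum at \<open>x\<close> is attained at \<open>y\<close>, then translating a test function by \<open>x - y\<close> and adding a
constant turns contact with the sup-convolution at \<open>x\<close> into contact with \<open>U\<close> at \<open>y\<close>, with the same
Hessian. The value \<open>U y\<close> is at least the value of the sup-convolution, which is the right direction for
a monotone right-hand side.\<close>

lemma sup_convolution_subsolution:
  fixes \<Omega> :: "(quat^'n) set"
  assumes ne: "\<Omega> \<noteq> {}" and bd: "bounded \<Omega>" and M: "\<And>x. x \<in> \<Omega> \<Longrightarrow> \<bar>U x\<bar> \<le> M" and \<alpha>: "0 < \<alpha>"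
    and usc: "\<And>x a. x \<in> \<Omega> \<Longrightarrow> U x < a \<Longrightarrow> \<exists>e>0. \<forall>y\<in>ball x e \<inter> \<Omega>. U y < a"
    and sub: "\<And>x \<psi> \<psi>' \<psi>''. x \<in> \<Omega> \<Longrightarrow> C2_jet \<psi> \<psi>' \<psi>'' \<Longrightarrow> \<psi> x = U x \<Longrightarrow> (\<And>y. y \<in> \<Omega> \<Longrightarrow> U y \<le> \<psi> y) \<Longrightarrow>
       G x (U x) \<le> hess_det \<psi> x"
    and r: "0 < r" "cball x r \<subseteq> \<Omega>" "2 * M < \<alpha> * r^2"
    and \<phi>: "C2_jet \<phi> \<phi>' \<phi>''" "\<phi> x = sup_convolution \<Omega> U \<alpha> x" "\<And>y. sup_convolution \<Omega> U \<alpha> y \<le> \<phi> y"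
  obtains y where "y \<in> cball x r" "\<phi> x \<le> U y" "G y (U y) \<le> hess_det \<phi> x"
proof -
  obtain y where y: "y \<in> cball x r" "sup_convolution \<Omega> U \<alpha> x = U y - \<alpha> * (norm (x - y))^2"
    by (rule sup_convolution_attained[OF ne bd M \<alpha> usc r])
  have y\<Omega>: "y \<in> \<Omega>" using y r by auto
  let ?c = "\<alpha> * (norm (x - y))^2"
  let ?\<psi> = "\<lambda>z. \<phi> (z + (x - y)) + ?c"
  have j: "C2_jet ?\<psi> (\<lambda>z. \<phi>' (z + (x - y)) + 0) (\<lambda>z. \<phi>'' (z + (x - y)) + 0)"
    by (rule C2_jet_add[OF C2_jet_translate[OF \<phi>(1)] C2_jet_const])
  have "G y (U y) \<le> hess_det ?\<psi> y"
  proof (rule sub[OF y\<Omega> j])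
    show "?\<psi> y = U y" using \<phi>(2) y(2) by simp
    fix z assume z: "z \<in> \<Omega>"
    have "U z - \<alpha> * (norm (z + (x - y) - z))^2 \<le> sup_convolution \<Omega> U \<alpha> (z + (x - y))"
      by (rule sup_convolution_upper[OF ne bd M \<alpha> z])
    also have "\<dots> \<le> \<phi> (z + (x - y))" by (rule \<phi>(3))
    finally show "U z \<le> ?\<psi> z" by simp
  qed
  moreover have "hess_det ?\<psi> y = hess_det \<phi> x"
    using qhessian_translate[OF \<phi>(1), of "x - y" ?c y] by (simp add: hess_det_def)
  moreover have "\<phi> x \<le> U y" using \<phi>(2) y(2) \<alpha> by simp
  ultimately show thesis using that y(1) by simp
qed

section \<open>The comparison principle\<close>

lemma usc_superlevel_compact:
  fixes h :: "'a::euclidean_space \<Rightarrow> real"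
  assumes "bounded \<Omega>"
    and usc: "\<And>x a. x \<in> \<Omega> \<Longrightarrow> h x < a \<Longrightarrow> \<exists>e>0. \<forall>y\<in>ball x e \<inter> \<Omega>. h y < a"
    and bdry: "\<And>\<zeta>. \<zeta> \<in> frontier \<Omega> \<Longrightarrow> \<exists>e>0. \<forall>y\<in>ball \<zeta> e \<inter> \<Omega>. h y < c"
  shows "compact {q \<in> \<Omega>. c \<le> h q}"
proof -
  have "\<exists>e>0. ball \<zeta> e \<subseteq> - {q \<in> \<Omega>. c \<le> h q}" if \<zeta>: "\<zeta> \<in> - {q \<in> \<Omega>. c \<le> h q}" for \<zeta>
  proof -
    have "\<exists>e>0. \<forall>y\<in>ball \<zeta> e \<inter> \<Omega>. h y < c"
    proof (cases "\<zeta> \<in> closure \<Omega>")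
      case True
      then show ?thesis using usc[of \<zeta> c] bdry[of \<zeta>] \<zeta> closure_Un_frontier[of \<Omega>] by auto
    next
      case False
      then obtain e where "0 < e" "ball \<zeta> e \<subseteq> - closure \<Omega>"
        using open_contains_ball[of "- closure \<Omega>"] by auto
      then show ?thesis using closure_subset[of \<Omega>] by blast
    qed
    then show ?thesis by force
  qed
  then have "closed {q \<in> \<Omega>. c \<le> h q}"
    unfolding closed_def open_contains_ball by blast
  moreover have "bounded {q \<in> \<Omega>. c \<le> h q}"
    by (rule bounded_subset[OF \<open>bounded \<Omega>\<close>]) auto
  ultimately show ?thesis by (simp add: compact_eq_bounded_closed)
qed

text \<open>Suppose \<open>U - V\<close> has a positive value \<open>m\<close>. The set \<open>K\<close> where \<open>U - V \<ge> m / 2\<close> is compact by the boundary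
condition. Regularize \<open>U\<close> to \<open>w\<close> by sup-convolution and then to \<open>g\<close> by mollification, so closely that on a
compact neighbourhood \<open>D\<close> of \<open>K\<close> the maximum of \<open>g + \<epsilon> |\<cdot>|\<^sup>2 - V\<close> is attained at a point \<open>q\<close> of an
open set \<open>N\<close> between \<open>K\<close> and \<open>D\<close>. Then \<open>g + \<epsilon> |\<cdot>|\<^sup>2\<close>, up to a constant, is a smooth test function for \<open>V\<close> at
\<open>q\<close>, and its determinant is at least \<open>F q (V q) - \<delta> + (4 \<epsilon>)\<^sup>n\<close> with \<open>\<delta> < (4 \<epsilon>)\<^sup>n\<close>. This
contradicts the supersolution property.\<close>

lemma comparison_principle_real:
  fixes \<Omega> :: "(quat^'n) set" and F :: "quat^'n \<Rightarrow> real \<Rightarrow> real" and U V :: "quat^'n \<Rightarrow> real"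
  assumes "open \<Omega>" and bd: "bounded \<Omega>"
    and Fc: "continuous_on (\<Omega> \<times> UNIV) (\<lambda>(q, t). F q t)"
    and F0: "\<And>q t. q \<in> \<Omega> \<Longrightarrow> 0 \<le> F q t"
    and Fmono: "\<And>q s t. q \<in> \<Omega> \<Longrightarrow> s \<le> t \<Longrightarrow> F q s \<le> F q t"
    and UM: "\<And>x. x \<in> \<Omega> \<Longrightarrow> \<bar>U x\<bar> \<le> M" and VM: "\<And>x. x \<in> \<Omega> \<Longrightarrow> \<bar>V x\<bar> \<le> M"
    and usc: "\<And>x a. x \<in> \<Omega> \<Longrightarrow> U x < a \<Longrightarrow> \<exists>e>0. \<forall>y\<in>ball x e \<inter> \<Omega>. U y < a"
    and lsc: "\<And>x a. x \<in> \<Omega> \<Longrightarrow> a < V x \<Longrightarrow> \<exists>e>0. \<forall>y\<in>ball x e \<inter> \<Omega>. a < V y"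
    and sub: "\<And>x \<psi> \<psi>' \<psi>''. x \<in> \<Omega> \<Longrightarrow> C2_jet \<psi> \<psi>' \<psi>'' \<Longrightarrow> \<psi> x = U x \<Longrightarrow> (\<And>y. y \<in> \<Omega> \<Longrightarrow> U y \<le> \<psi> y) \<Longrightarrow>
       F x (U x) \<le> hess_det \<psi> x"
    and super: "\<And>x N \<psi> \<psi>' \<psi>''. open N \<Longrightarrow> x \<in> N \<Longrightarrow> N \<subseteq> \<Omega> \<Longrightarrow> C2_jet \<psi> \<psi>' \<psi>'' \<Longrightarrow> \<psi> x = V x \<Longrightarrow>
       (\<And>y. y \<in> N \<Longrightarrow> \<psi> y \<le> V y) \<Longrightarrow> hess_det_plus \<psi> x \<le> F x (V x)"
    and bdry: "\<And>\<zeta> a. \<zeta> \<in> frontier \<Omega> \<Longrightarrow> 0 < a \<Longrightarrow> \<exists>e>0. \<forall>y\<in>ball \<zeta> e \<inter> \<Omega>. U y - V y < a"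
    and x0: "x0 \<in> \<Omega>"
  shows "U x0 \<le> V x0"
proof (rule ccontr)
  assume less: "\<not> ?thesis"
  define m where "m = U x0 - V x0"
  have m: "0 < m" using less by (simp add: m_def)
  have M0: "0 \<le> M" using UM[OF x0] by linarith
  have UV: "\<exists>e>0. ball x e \<subseteq> \<Omega> \<and> (\<forall>y\<in>ball x e. U y < U x + \<eta> \<and> V x - \<eta> < V y)"
    if x: "x \<in> \<Omega>" and \<eta>: "0 < \<eta>" for x \<eta>
  proof -
    obtain e1 where e1: "0 < e1" "\<forall>y\<in>ball x e1 \<inter> \<Omega>. U y < U x + \<eta>" using usc[OF x, of "U x + \<eta>"] \<eta> by auto
    obtain e2 where e2: "0 < e2" "\<forall>y\<in>ball x e2 \<inter> \<Omega>. V x - \<eta> < V y" using lsc[OF x, of "V x - \<eta>"] \<eta> by auto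
    obtain e3 where e3: "0 < e3" "ball x e3 \<subseteq> \<Omega>" using \<open>open \<Omega>\<close> x open_contains_ball by blast
    show ?thesis
      using e1 e2 e3 by (intro exI[of _ "min e1 (min e2 e3)"]) auto
  qed
  define K where "K = {q \<in> \<Omega>. m / 2 \<le> U q - V q}"
  have x0K: "x0 \<in> K" using x0 m by (simp add: K_def m_def)
  have cK: "compact K"
    unfolding K_def
  proof (rule usc_superlevel_compact[OF bd])
    show "\<exists>e>0. \<forall>y\<in>ball x e \<inter> \<Omega>. U y - V y < a" if x: "x \<in> \<Omega>" "U x - V x < a" for x a
    proof -
      define \<eta> where "\<eta> = (a - (U x - V x)) / 2"
      have \<eta>: "0 < \<eta>" "U x - V x + 2 * \<eta> = a" using x by (simp_all add: \<eta>_def field_simps)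
      obtain e where e: "0 < e" "\<forall>y\<in>ball x e. U y < U x + \<eta> \<and> V x - \<eta> < V y" using UV[OF x(1) \<eta>(1)] by blast
      have "U y - V y < a" if "y \<in> ball x e" for y
      proof -
        have "U y < U x + \<eta>" "V x - \<eta> < V y" using e(2) that by auto
        then show ?thesis using \<eta>(2) by linarith
      qed
      then show ?thesis using e(1) by blast
    qed
    show "\<exists>e>0. \<forall>y\<in>ball \<zeta> e \<inter> \<Omega>. U y - V y < m / 2" if "\<zeta> \<in> frontier \<Omega>" for \<zeta>
      using bdry[OF that, of "m / 2"] m by auto
  qed
  obtain e0 where e0: "0 < e0" "(\<Union>x\<in>K. cball x e0) \<subseteq> \<Omega>"
  proof (rule compact_subset_open_imp_cball_epsilon_subset[OF cK \<open>open \<Omega>\<close>])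
    show "K \<subseteq> \<Omega>" by (auto simp: K_def)
  qed
  define d where "d = e0 / 3"
  have d: "0 < d" "d \<le> e0" using e0 by (auto simp: d_def)
  define Nb where "Nb r = (\<Union>x\<in>K. cball x r)" for r
  have Nbc: "compact (Nb r)" for r
    unfolding Nb_def by (rule compact_minkowski_sum_cball[OF cK])
  define D where "D = Nb d"
  define N where "N = (\<Union>x\<in>K. ball x d)"
  have NO: "open N" and ND: "N \<subseteq> D" by (auto simp: N_def D_def Nb_def)
  have D\<Omega>: "D \<subseteq> \<Omega>" and D2\<Omega>: "Nb e0 \<subseteq> \<Omega>" using e0 d by (force simp: D_def Nb_def)+
  have x0D: "x0 \<in> D" using x0K d by (force simp: D_def Nb_def)
  have KN: "K \<subseteq> N" using d by (auto simp: N_def)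
  obtain \<delta>C where \<delta>C: "0 < \<delta>C" "\<And>p y. p \<in> D - N \<Longrightarrow> y \<in> ball p \<delta>C \<Longrightarrow> y \<in> \<Omega> \<Longrightarrow> U y - V p < 3 * m / 4"
  proof -
    define \<G> where "\<G> = {G. open G \<and> (\<forall>y\<in>G. \<forall>p\<in>G. U y - V p < 3 * m / 4)}"
    have cDN: "compact (D - N)" unfolding D_def by (intro compact_diff Nbc NO)
    have cover: "D - N \<subseteq> \<Union>\<G>"
    proof
      fix x assume x: "x \<in> D - N"
      have x\<Omega>: "x \<in> \<Omega>" using x D\<Omega> by blast
      then have lt: "U x - V x < m / 2" using x KN by (force simp: K_def)
      obtain e where e: "0 < e" "\<forall>y\<in>ball x e. U y < U x + m / 8 \<and> V x - m / 8 < V y"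
        using UV[OF x\<Omega>, of "m / 8"] m by auto
      have "U y - V p < 3 * m / 4" if "y \<in> ball x e" "p \<in> ball x e" for y p
      proof -
        have "U y < U x + m / 8" "V x - m / 8 < V p" using e(2) that by auto
        then show ?thesis using lt by linarith
      qed
      then have "ball x e \<in> \<G>" by (simp add: \<G>_def)
      then show "x \<in> \<Union>\<G>" using e(1) by (meson UnionI centre_in_ball)
    qed
    obtain \<delta> where \<delta>: "0 < \<delta>" "\<And>x. x \<in> D - N \<Longrightarrow> \<exists>G\<in>\<G>. ball x \<delta> \<subseteq> G"
      by (rule Heine_Borel_lemma[OF cDN cover]) (auto simp: \<G>_def)
    show thesis
    proof (rule that[OF \<delta>(1)])
      fix p y assume py: "p \<in> D - N" "y \<in> ball p \<delta>"
      obtain G where G: "G \<in> \<G>" "ball p \<delta> \<subseteq> G" using \<delta>(2)[OF py(1)] by blast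
      have "p \<in> G" "y \<in> G" using G py \<delta>(1) by auto
      then show "U y - V p < 3 * m / 4" using G(1) by (simp add: \<G>_def)
    qed
  qed
  obtain Rb where Rb: "0 < Rb" "\<And>x. x \<in> \<Omega> \<Longrightarrow> norm x \<le> Rb" using bd by (auto simp: bounded_pos)
  \<comment> \<open>The strictness gained from \<open>\<epsilon> |\<cdot>|\<^sup>2\<close> is of order \<open>\<epsilon>\<^sup>n\<close>, while the function itself stays below \<open>m / 16\<close>.\<close>
  define \<epsilon> where "\<epsilon> = m / (16 * Rb^2)"
  have \<epsilon>: "0 < \<epsilon>" using m Rb by (simp add: \<epsilon>_def)
  have \<epsilon>R: "\<epsilon> * (norm x)^2 \<le> m / 16" if "x \<in> \<Omega>" for x
  proof -
    have "(norm x)^2 \<le> Rb^2" using Rb(2)[OF that] by (intro power_mono) auto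
    then have "\<epsilon> * (norm x)^2 \<le> \<epsilon> * Rb^2" using \<epsilon> by (intro mult_left_mono) auto
    also have "\<dots> = m / 16" using Rb(1) by (simp add: \<epsilon>_def)
    finally show ?thesis .
  qed
  define \<delta> where "\<delta> = (4 * \<epsilon>) ^ CARD('n) / 2"
  have \<delta>: "0 < \<delta>" using \<epsilon> by (simp add: \<delta>_def)
  \<comment> \<open>Uniform continuity of \<open>F\<close> absorbs the shift of the contact point caused by both regularizations.\<close>
  obtain d' where d': "0 < d'" "\<And>q y t. q \<in> Nb e0 \<Longrightarrow> y \<in> Nb e0 \<Longrightarrow> \<bar>t\<bar> \<le> M \<Longrightarrow> dist y q < d' \<Longrightarrow> \<bar>F y t - F q t\<bar> < \<delta>"
  proof -
    have "uniformly_continuous_on (Nb e0 \<times> {-M..M}) (\<lambda>(q, t). F q t)"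
      by (intro compact_uniformly_continuous compact_Times Nbc compact_Icc continuous_on_subset[OF Fc])
         (use D2\<Omega> in auto)
    then have "\<exists>d'>0. \<forall>p\<in>Nb e0 \<times> {-M..M}. \<forall>p'\<in>Nb e0 \<times> {-M..M}. dist p' p < d' \<longrightarrow>
        dist ((\<lambda>(q, t). F q t) p') ((\<lambda>(q, t). F q t) p) < \<delta>"
      unfolding uniformly_continuous_on_def using \<delta> by simp
    then obtain d' where d': "0 < d'" "\<And>p p'. p \<in> Nb e0 \<times> {-M..M} \<Longrightarrow> p' \<in> Nb e0 \<times> {-M..M} \<Longrightarrow> dist p' p < d' \<Longrightarrow>
        dist ((\<lambda>(q, t). F q t) p') ((\<lambda>(q, t). F q t) p) < \<delta>"
      by meson
    show thesis
    proof (rule that[OF d'(1)])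
      fix q y t assume "q \<in> Nb e0" "y \<in> Nb e0" "\<bar>t\<bar> \<le> M" "dist y q < d'"
      then show "\<bar>F y t - F q t\<bar> < \<delta>"
        using d'(2)[of "(q, t)" "(y, t)"] by (auto simp: dist_Pair_Pair dist_real_def abs_le_iff)
    qed
  qed
  define r0 where "r0 = min d (d' / 2)"
  have r0: "0 < r0" "r0 \<le> d" "r0 \<le> d' / 2" using d d' by (auto simp: r0_def)
  \<comment> \<open>Large enough that the supremum sees only points at distance below both \<open>r0\<close> and \<open>\<delta>C\<close>.\<close>
  define \<alpha> where "\<alpha> = (2 * M + 2) / (min r0 \<delta>C)^2"
  have mn: "0 < min r0 \<delta>C" using r0 \<delta>C by simp
  have mn2: "0 < (min r0 \<delta>C)^2" using mn by (rule zero_less_power)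
  have \<alpha>: "0 < \<alpha>" unfolding \<alpha>_def by (rule divide_pos_pos[OF _ mn2]) (use M0 in simp)
  have \<alpha>mn: "2 * M + 2 \<le> \<alpha> * t^2" if "min r0 \<delta>C \<le> t" for t
  proof -
    have "(min r0 \<delta>C)^2 \<le> t^2" using that mn by (intro power_mono) auto
    then have "\<alpha> * (min r0 \<delta>C)^2 \<le> \<alpha> * t^2" using \<alpha> by (intro mult_left_mono) auto
    moreover have "\<alpha> * (min r0 \<delta>C)^2 = 2 * M + 2"
      unfolding \<alpha>_def using mn2 by (intro nonzero_eq_divide_eq[THEN iffD1]) auto
    ultimately show ?thesis by linarith
  qed
  have ne: "\<Omega> \<noteq> {}" using x0 by blast
  define S where "S = sup_convolution \<Omega> U \<alpha>"
  have S_upper: "U y - \<alpha> * (norm (x - y))^2 \<le> S x" if "y \<in> \<Omega>" for x y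
    unfolding S_def by (rule sup_convolution_upper[OF ne bd _ \<alpha> that]) (rule UM)
  have S_least: "S x \<le> c" if "\<And>y. y \<in> \<Omega> \<Longrightarrow> U y - \<alpha> * (norm (x - y))^2 \<le> c" for x c
    unfolding S_def by (rule sup_convolution_least[OF ne bd _ \<alpha> that]) (rule UM)
  have S_M: "S x \<le> M" for x
    unfolding S_def by (rule sup_convolution_le_M[OF ne bd _ \<alpha>]) (rule UM)
  have Sc: "continuous_on UNIV S"
    unfolding S_def by (rule sup_convolution_continuous[OF ne bd _ \<alpha>]) (rule UM)
  have SU: "U x \<le> S x" if "x \<in> \<Omega>" for x using S_upper[OF that, of x] by simp
  \<comment> \<open>The shift by \<open>M + 1\<close> makes \<open>S\<close> positive on \<open>\<Omega>\<close>, while \<open>S\<close> tends to \<open>- \<infinity>\<close> far away; so cutting off at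
    \<open>0\<close> gives compact support without changing the function on \<open>\<Omega>\<close>.\<close>
  define w where "w x = max 0 (S x + M + 1)" for x
  have wc: "continuous_on UNIV w"
    unfolding w_def by (intro continuous_intros Sc)
  have w0: "0 \<le> w x" for x by (simp add: w_def)
  have wB: "w x \<le> 2 * M + 1" for x
    using S_M[of x] M0 by (simp add: w_def)
  have wS: "w x = S x + M + 1" if "x \<in> \<Omega>" for x
    using SU[OF that] UM[OF that] by (simp add: w_def)
  have wR: "w x = 0" if "Rb + \<delta>C < norm x" for x
  proof -
    have "S x \<le> - M - 1"
    proof (rule S_least)
      fix y assume y: "y \<in> \<Omega>"
      have "\<delta>C \<le> norm (x - y)" using norm_triangle_sub[of x y] Rb(2)[OF y] that by linarith
      then have "2 * M + 2 \<le> \<alpha> * (norm (x - y))^2" by (intro \<alpha>mn) auto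
      then show "U y - \<alpha> * (norm (x - y))^2 \<le> - M - 1" using UM[OF y] by linarith
    qed
    then show ?thesis by (simp add: w_def)
  qed
  define \<eta> where "\<eta> = m / 16"
  have \<eta>: "0 < \<eta>" using m by (simp add: \<eta>_def)
  obtain R1 where R1: "0 < R1" "\<And>x y. dist y x < R1 \<Longrightarrow> \<bar>w y - w x\<bar> < \<eta>"
  proof -
    have "isUCont w"
      by (rule uniformly_continuous_compact_support[OF wc wR])
    then have "\<exists>d>0. \<forall>x\<in>UNIV. \<forall>y\<in>UNIV. dist y x < d \<longrightarrow> dist (w y) (w x) < \<eta>"
      using \<eta> unfolding uniformly_continuous_on_def by blast
    then show thesis using that by (auto simp: dist_real_def)
  qed
  define R where "R = min R1 (min d (d' / 2))"
  have R: "0 < R" "R \<le> R1" "R \<le> d" "R \<le> d' / 2" using R1 d d' by (auto simp: R_def)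
  obtain \<rho> :: "quat^'n \<Rightarrow> real" and \<rho>' \<rho>'' where K: "mollify_kernel (R / 4) \<rho> \<rho>' \<rho>''"
    using mollify_kernel_exists[of "R / 4"] R by auto
  define g where "g = mollify \<rho> w"
  obtain g' g'' where jg: "C2_jet g g' g''"
    using mollify_C2_jet[of _ _ _ _ w "Rb + \<delta>C"] K wc wR unfolding g_def by metis
  have gw: "\<bar>g x - w x\<bar> \<le> \<eta>" for x
    unfolding g_def
  proof (rule mollify_close[OF K wc])
    fix y :: "quat^'n" assume "norm y \<le> R / 4"
    then have "dist (x - y) x < R1" using R by (simp add: dist_norm)
    then show "\<bar>w (x - y) - w x\<bar> \<le> \<eta>" using R1(2) by (auto intro: less_imp_le)
  qed
  define f where "f x = g x + \<epsilon> * (norm x)^2 - V x" for x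
  obtain q where "q \<in> D" "\<And>y. y \<in> D \<Longrightarrow> - V y + (g y + \<epsilon> * (norm y)^2) \<le> - V q + (g q + \<epsilon> * (norm q)^2)"
  proof (rule usc_plus_continuous_attains_max[of D "\<lambda>x. - V x" "\<lambda>x. g x + \<epsilon> * (norm x)^2"])
    show "compact D" unfolding D_def by (rule Nbc)
    show "D \<noteq> {}" using x0D by blast
    show "continuous_on D (\<lambda>x. g x + \<epsilon> * (norm x)^2)"
      by (intro continuous_intros C2_jet_continuous[OF jg])
    show "\<exists>e>0. \<forall>y\<in>ball x e \<inter> D. - V y < a" if "x \<in> D" "- V x < a" for x a
    proof -
      have "x \<in> \<Omega>" "- a < V x" using that D\<Omega> by auto
      then obtain e where "0 < e" "\<forall>y\<in>ball x e \<inter> \<Omega>. - a < V y" using lsc by blast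
      then show ?thesis using D\<Omega> by (intro exI[of _ e]) force
    qed
  qed (rule that)
  then have q: "q \<in> D" "\<And>y. y \<in> D \<Longrightarrow> f y \<le> f q"
    by (auto simp: f_def)
  have q\<Omega>: "q \<in> \<Omega>" using q D\<Omega> by blast
  have fq: "m + M + 1 - \<eta> \<le> f q"
  proof -
    have "U x0 + M + 1 \<le> w x0" using SU[OF x0] wS[OF x0] by simp
    moreover have "w x0 - \<eta> \<le> g x0" using gw[of x0] by linarith
    moreover have "0 \<le> \<epsilon> * (norm x0)^2" using \<epsilon> by simp
    ultimately have "m + M + 1 - \<eta> \<le> f x0" by (simp add: f_def m_def)
    also have "\<dots> \<le> f q" by (rule q(2)[OF x0D])
    finally show ?thesis .
  qed
  have fqw: "f q \<le> w q + \<eta> + m / 16 - V q"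
    using gw[of q] \<epsilon>R[OF q\<Omega>] unfolding f_def by linarith
  \<comment> \<open>Outside \<open>N\<close> the difference, less \<open>M + 1\<close>, is at most \<open>3 m / 4 + m / 8\<close>, but at \<open>x0\<close> it is at least \<open>m - m / 16\<close>.\<close>
  have qN: "q \<in> N"
  proof (rule ccontr)
    assume "q \<notin> N"
    then have qC: "q \<in> D - N" using q by blast
    have "S q \<le> V q + 3 * m / 4"
    proof (rule S_least)
      fix y assume y: "y \<in> \<Omega>"
      have p0: "0 \<le> \<alpha> * (norm (q - y))^2" using \<alpha> by simp
      show "U y - \<alpha> * (norm (q - y))^2 \<le> V q + 3 * m / 4"
      proof (cases "y \<in> ball q \<delta>C")
        case True
        then show ?thesis using \<delta>C(2)[OF qC True y] p0 by linarith
      next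
        case False
        then have "2 * M + 2 \<le> \<alpha> * (norm (q - y))^2" by (intro \<alpha>mn) (auto simp: dist_norm)
        then show ?thesis using UM[OF y] VM[OF q\<Omega>] m by linarith
      qed
    qed
    then show False using fq fqw wS[OF q\<Omega>] m by (simp add: \<eta>_def)
  qed
  have wq: "V q + M + 1 + m / 16 \<le> w q" using fq fqw m by (simp add: \<eta>_def)
  define c where "c = root CARD('n) (max 0 (F q (V q) - \<delta>))"
  have c: "0 \<le> c" "c ^ CARD('n) = max 0 (F q (V q) - \<delta>)" by (auto simp: c_def)
  \<comment> \<open>Near \<open>q\<close> the function \<open>w\<close> is a subsolution with constant right-hand side: the contact point \<open>y\<close> for \<open>U\<close>
    is close to \<open>q\<close> and \<open>U y \<ge> V q\<close>, so monotonicity and continuity of \<open>F\<close> compare \<open>F y (U y)\<close> with \<open>F q (V q)\<close>.\<close>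
  have touch: "c ^ CARD('n) \<le> hess_det \<phi> x"
    if \<phi>: "C2_jet \<phi> \<phi>' \<phi>''" "norm (x - q) < R" "\<phi> x = w x" "\<And>y. w y \<le> \<phi> y" for \<phi> \<phi>' \<phi>'' x
  proof -
    obtain k where k: "k \<in> K" "dist k q \<le> d" using q by (auto simp: D_def Nb_def)
    have e0d: "e0 = d + d + d" by (simp add: d_def)
    have cb: "cball x r0 \<subseteq> Nb e0"
    proof
      fix y assume "y \<in> cball x r0"
      then have "dist k y \<le> e0"
        using dist_triangle[of k y q] dist_triangle[of q y x] k(2) \<phi>(2) R(3) r0(2)
        by (simp add: dist_norm norm_minus_commute e0d)
      then show "y \<in> Nb e0" using k by (auto simp: Nb_def)
    qed
    have cb\<Omega>: "cball x r0 \<subseteq> \<Omega>" using cb D2\<Omega> by (rule subset_trans)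
    moreover have "x \<in> cball x r0" using r0(1) by simp
    ultimately have x\<Omega>: "x \<in> \<Omega>" by (rule subsetD)
    have j: "C2_jet (\<lambda>x. \<phi> x + (- M - 1)) (\<lambda>x. \<phi>' x + 0) (\<lambda>x. \<phi>'' x + 0)"
      by (rule C2_jet_add[OF \<phi>(1) C2_jet_const])
    obtain y where y: "y \<in> cball x r0" "\<phi> x + (- M - 1) \<le> U y" "F y (U y) \<le> hess_det (\<lambda>x. \<phi> x + (- M - 1)) x"
    proof (rule sup_convolution_subsolution[where U=U and G=F, OF ne bd _ \<alpha> _ _ r0(1) cb\<Omega> _ j])
      show "2 * M < \<alpha> * r0^2" using \<alpha>mn[of r0] by simp
      show "\<phi> x + (- M - 1) = sup_convolution \<Omega> U \<alpha> x" using \<phi>(3) wS[OF x\<Omega>] by (simp add: S_def)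
      show "sup_convolution \<Omega> U \<alpha> y \<le> \<phi> y + (- M - 1)" for y using \<phi>(4)[of y] by (simp add: w_def S_def)
      show "\<bar>U y\<bar> \<le> M" if "y \<in> \<Omega>" for y by (rule UM[OF that])
      show "\<exists>e>0. \<forall>z\<in>ball y e \<inter> \<Omega>. U z < a" if "y \<in> \<Omega>" "U y < a" for y a by (rule usc[OF that])
      show "F y (U y) \<le> hess_det \<psi> y"
        if "y \<in> \<Omega>" "C2_jet \<psi> \<psi>' \<psi>''" "\<psi> y = U y" "\<And>z. z \<in> \<Omega> \<Longrightarrow> U z \<le> \<psi> z" for y \<psi> \<psi>' \<psi>''
        by (rule sub[OF that])
    qed (rule that)
    have y\<Omega>: "y \<in> \<Omega>" using y cb\<Omega> by blast
    have "\<bar>w x - w q\<bar> < \<eta>" using \<phi>(2) R by (intro R1(2)) (simp add: dist_norm)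
    then have "V q \<le> U y" using wq y(2) \<phi>(3) unfolding \<eta>_def by linarith
    then have "F y (V q) \<le> F y (U y)" by (rule Fmono[OF y\<Omega>])
    moreover have "\<bar>F y (V q) - F q (V q)\<bar> < \<delta>"
    proof (rule d'(2))
      show "q \<in> Nb e0" using k d by (auto simp: Nb_def intro: order_trans)
      show "y \<in> Nb e0" using y cb by blast
      show "\<bar>V q\<bar> \<le> M" by (rule VM[OF q\<Omega>])
      show "dist y q < d'"
        using dist_triangle[of y q x] y(1) \<phi>(2) R(4) r0(3) by (simp add: dist_norm norm_minus_commute)
    qed
    ultimately have "max 0 (F q (V q) - \<delta>) \<le> F y (U y)" using F0[OF y\<Omega>, of "U y"] by simp
    also have "\<dots> \<le> hess_det \<phi> x"
      using y(3) qhessian_translate[OF \<phi>(1), of 0 "- M - 1" x] by (simp add: hess_det_def)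
    finally show ?thesis by (simp add: c)
  qed
  obtain W l where D: "diagonalizes W l (qhessian g q)" using hess_det_jet[OF jg] by blast
  have R4: "R / 4 \<le> R / 4" by simp
  have l0: "0 \<le> l $ k" for k
    by (rule mollify_eigenvalues(1)[OF K R(1) R4 wc w0 wB touch jg[unfolded g_def] c(1) D[unfolded g_def]])
  have lp: "c ^ CARD('n) \<le> (\<Prod>k\<in>UNIV. l $ k + 4 * \<epsilon>)"
  proof (rule mollify_eigenvalues(2)[OF K R(1) R4 wc w0 wB touch jg[unfolded g_def] c(1) D[unfolded g_def]])
    show "0 < 4 * \<epsilon>" using \<epsilon> by simp
  qed
  define a where "a = - f q"
  obtain \<psi>' \<psi>'' where \<psi>: "C2_jet (\<lambda>x. g x + \<epsilon> * (norm x)^2 + a) \<psi>' \<psi>''"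
    "hess_det_plus (\<lambda>x. g x + \<epsilon> * (norm x)^2 + a) q = (\<Prod>k\<in>UNIV. l $ k + 8 * \<epsilon>)"
    using hess_det_plus_add_dist_sq[OF jg D l0 less_imp_le[OF \<epsilon>]] by blast
  have "(\<Prod>k\<in>UNIV. l $ k + 8 * \<epsilon>) \<le> F q (V q)"
    unfolding \<psi>(2)[symmetric]
  proof (rule super[OF NO qN _ \<psi>(1)])
    show "N \<subseteq> \<Omega>" using ND D\<Omega> by blast
    show "g q + \<epsilon> * (norm q)^2 + a = V q" by (simp add: a_def f_def)
    show "g y + \<epsilon> * (norm y)^2 + a \<le> V y" if "y \<in> N" for y
      using q(2)[of y] that ND by (auto simp: a_def f_def)
  qed
  moreover have "(\<Prod>k\<in>UNIV. l $ k + 4 * \<epsilon>) + (4 * \<epsilon>) ^ CARD('n) \<le> (\<Prod>k\<in>UNIV. (l $ k + 4 * \<epsilon>) + 4 * \<epsilon>)"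
    using l0 \<epsilon> by (intro prod_add_const_ge) (auto intro: add_nonneg_nonneg)
  moreover have "(4 * \<epsilon>) ^ CARD('n) = 2 * \<delta>" by (simp add: \<delta>_def)
  ultimately show False using lp c(2) \<delta> by (simp add: add.assoc)
qed

text \<open>Boundedness makes \<open>u\<close> and \<open>v\<close> real-valued on \<open>\<Omega>\<close>, and test functions of class \<open>C\<^sup>2\<close> on the whole space are
enough to exploit both viscosity inequalities.\<close>

theorem theorem1p3:
  fixes \<Omega> :: "(quat^'n) set"
    and F :: "quat^'n \<Rightarrow> real \<Rightarrow> real"
    and u v :: "quat^'n \<Rightarrow> ereal"
  assumes "open \<Omega>" and "connected \<Omega>" and "\<Omega> \<noteq> {}" and "bounded \<Omega>"
    and "continuous_on (\<Omega> \<times> UNIV) (\<lambda>(q, t). F q t)"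
    and "\<And>q t. q \<in> \<Omega> \<Longrightarrow> 0 \<le> F q t"
    and "\<And>q s t. q \<in> \<Omega> \<Longrightarrow> s \<le> t \<Longrightarrow> F q s \<le> F q t"
    and "viscosity_subsolution \<Omega> F u"
    and "\<exists>M::real. \<forall>q\<in>\<Omega>. \<bar>u q\<bar> \<le> ereal M"
    and "viscosity_supersolution \<Omega> F v"
    and "\<exists>M::real. \<forall>q\<in>\<Omega>. \<bar>v q\<bar> \<le> ereal M"
    and "boundary_le \<Omega> u v"
  shows "\<forall>q\<in>\<Omega>. u q \<le> v q"
proof
  fix x0 assume x0: "x0 \<in> \<Omega>"
  obtain M1 M2 where M12: "\<And>q. q \<in> \<Omega> \<Longrightarrow> \<bar>u q\<bar> \<le> ereal M1" "\<And>q. q \<in> \<Omega> \<Longrightarrow> \<bar>v q\<bar> \<le> ereal M2"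
    using assms(9,11) by blast
  define U where "U q = real_of_ereal (u q)" for q
  define V where "V q = real_of_ereal (v q)" for q
  have u: "u q = ereal (U q)" and v: "v q = ereal (V q)" if "q \<in> \<Omega>" for q
    using M12[OF that] unfolding U_def V_def by (cases "u q"; cases "v q"; auto)+
  have openin: "\<exists>e>0. \<forall>y\<in>ball x e \<inter> \<Omega>. P y" if P: "openin (top_of_set \<Omega>) {x \<in> \<Omega>. P x}" "x \<in> \<Omega>" "P x" for P x
  proof -
    have "open {x \<in> \<Omega>. P x}" using P(1) openin_open_eq[OF assms(1)] by blast
    then obtain e where "0 < e" "ball x e \<subseteq> {x \<in> \<Omega>. P x}"
      using open_contains_ball P(2,3) by blast
    then show ?thesis by blast
  qed
  have "U x0 \<le> V x0"
  proof (rule comparison_principle_real[OF assms(1,4,5), where M = "max M1 M2"])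
    show "0 \<le> F q t" if "q \<in> \<Omega>" for q t using that by (rule assms(6))
    show "F q s \<le> F q t" if "q \<in> \<Omega>" "s \<le> t" for q s t using that by (rule assms(7))
    show "\<bar>U x\<bar> \<le> max M1 M2" "\<bar>V x\<bar> \<le> max M1 M2" if "x \<in> \<Omega>" for x
      using M12[OF that] by (auto simp: u[OF that] v[OF that])
    show "\<exists>e>0. \<forall>y\<in>ball x e \<inter> \<Omega>. U y < a" if "x \<in> \<Omega>" "U x < a" for x a
    proof -
      have "openin (top_of_set \<Omega>) {x \<in> \<Omega>. u x < ereal a}"
        using assms(8) by (auto simp: viscosity_subsolution_def usc_on_def)
      from openin[OF this that(1)] show ?thesis using that by (auto simp: u)
    qed
    show "\<exists>e>0. \<forall>y\<in>ball x e \<inter> \<Omega>. a < V y" if "x \<in> \<Omega>" "a < V x" for x a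
    proof -
      have "openin (top_of_set \<Omega>) {x \<in> \<Omega>. ereal a < v x}"
        using assms(10) by (auto simp: viscosity_supersolution_def lsc_on_def)
      from openin[OF this that(1)] show ?thesis using that by (auto simp: v)
    qed
    show "F x (U x) \<le> hess_det \<psi> x"
      if "x \<in> \<Omega>" "C2_jet \<psi> \<psi>' \<psi>''" "\<psi> x = U x" "\<And>y. y \<in> \<Omega> \<Longrightarrow> U y \<le> \<psi> y" for x \<psi> \<psi>' \<psi>''
    proof -
      have "touches_above \<Omega> u \<psi> x"
        unfolding touches_above_def
        using that assms(1) C2_jet_C2_on[OF that(2)] by (intro conjI exI[of _ \<Omega>]) (auto simp: u)
      then have "F x (\<psi> x) \<le> hess_det \<psi> x" using assms(8) that(1) by (auto simp: viscosity_subsolution_def)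
      then show ?thesis by (simp add: that(3))
    qed
    show "hess_det_plus \<psi> x \<le> F x (V x)"
      if "open N" "x \<in> N" "N \<subseteq> \<Omega>" "C2_jet \<psi> \<psi>' \<psi>''" "\<psi> x = V x" "\<And>y. y \<in> N \<Longrightarrow> \<psi> y \<le> V y" for N x \<psi> \<psi>' \<psi>''
    proof -
      have x: "x \<in> \<Omega>" using that by blast
      have "touches_below \<Omega> v \<psi> x"
        unfolding touches_below_def
        using that C2_jet_C2_on[OF that(4)] x by (intro conjI exI[of _ N]) (auto simp: v subset_iff)
      then have "hess_det_plus \<psi> x \<le> F x (\<psi> x)" using assms(10) x by (auto simp: viscosity_supersolution_def)
      then show ?thesis by (simp add: that(5))
    qed
    show "\<exists>e>0. \<forall>y\<in>ball \<zeta> e \<inter> \<Omega>. U y - V y < a" if \<zeta>: "\<zeta> \<in> frontier \<Omega>" and "0 < a" for \<zeta> a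
    proof -
      have "Limsup (at \<zeta> within \<Omega>) (\<lambda>q. u q - v q) < ereal a"
        using assms(12) \<zeta> \<open>0 < a\<close> by (auto simp: boundary_le_def intro: le_less_trans)
      then have "\<forall>\<^sub>F y in at \<zeta> within \<Omega>. u y - v y < ereal a" by (rule Limsup_lessD)
      then obtain e where e: "0 < e" "\<And>y. y \<in> \<Omega> \<Longrightarrow> y \<noteq> \<zeta> \<Longrightarrow> dist y \<zeta> < e \<Longrightarrow> u y - v y < ereal a"
        unfolding eventually_at by blast
      have "\<zeta> \<notin> \<Omega>" using \<zeta> assms(1) by (simp add: frontier_def interior_open)
      then have "U y - V y < a" if "y \<in> ball \<zeta> e \<inter> \<Omega>" for y
        using e(2)[of y] that by (auto simp: u v dist_commute)
      then show ?thesis using e(1) by blast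
    qed
    show "x0 \<in> \<Omega>" by (rule x0)
  qed
  then show "u x0 \<le> v x0" by (simp add: u[OF x0] v[OF x0])
qed

end
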